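(* Let $\mathcal V^\omega$ be a normal oplax monoidal category (i.e. the counit $\omega^0(x)\to x$ is invertible for every object $x$). Then the 2-functor sending a category $(\mathcal M,[-,-])$ enriched over $\mathcal V$ to the $\mathcal V$-$\delta$module with $R^{n+1}(\mathbf a,x;y)=\mathcal V(\omega^n(\mathbf a),[x,y])$ ($n\ge-1$) induces a 2-equivalence $$\mathsf{Cat}_{\mathcal V}\ \simeq\ \mathsf{right\ rep.}\ \mathcal V\text{-}\delta\mathsf{mod}^{\mathrm{fun}}_{\mathrm{oplax}}$$ between the 2-category of categories enriched over $\mathcal V$ and the 2-category of right representable $\mathcal V$-$\delta$modules, oplax functors and natural transformations.
   Context: **Oplax monoidal category.** $\mathcal V^\omega$ is a category $\mathcal V$ with functors $\omega^n:\mathcal V^{n+1}\to\mathcal V$ ($n\ge-1$), natural transformations $\omega^{p+q}\to\omega^p(-,\omega^q,-)$ for $p\ge0,q\ge-1$ and each of the $p+1$ insertion positions, and a counit $\omega^0\to\mathrm{Id}$, such that: $\omega^p\to\omega^0\omega^p\to\omega^p$ and $\omega^p\to\omega^p(-,\omega^0,-)\to\omega^p$ are identities; the two composites $\omega^{p+q+r}\to\omega^p(-,\omega^q,-,\omega^r,-)$ agree; the two composites $\omega^{p+q+r}\to\omega^p(-,\omega^q(-,\omega^r,-),-)$ agree. Write $1_\omega=\omega^{-1}$, $\otimes_\omega=\omega^1$. **The 2-category $\mathsf{Cat}_{\mathcal V}$.** An object is a category $\mathcal C$ with a functor $[-,-]:\mathcal C^{\mathrm{op}}\times\mathcal C\to\mathcal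 V$, maps $\eta_x:1_\omega\to[x,x]$ extranatural in $x$, and $\mu_{x,y,z}:[y,z]\otimes_\omega[x,y]\to[x,z]$ natural in $x,z$, extranatural in $y$, such that the two composites $\omega^2([y,z],[x,y],[w,x])\to[w,z]$, through $([y,z]\otimes_\omega[x,y])\otimes_\omega[w,x]$ and through $[y,z]\otimes_\omega([x,y]\otimes_\omega[w,x])$, agree, and the composites $\omega^0([x,y])\to1_\omega\otimes_\omega[x,y]\to[y,y]\otimes_\omega[x,y]\to[x,y]$ and $\omega^0([x,y])\to[x,y]\otimes_\omega1_\omega\to[x,y]\otimes_\omega[x,x]\to[x,y]$ both equal the counit. A 1-morphism $(\mathcal B,[-,-],\eta,\mu)\to(\mathcal C,\langle-,-\rangle,\theta,\nu)$ is a functor $F$ with a natural family $F_{x,y}:[x,y]\to\langle Fx,Fy\rangle$ such that $F_{x,x}\eta_x=\theta_{Fx}$ and $F_{x,z}\mu_{x,y,z}=\nu_{Fx,Fy,Fz}(F_{y,z}\otimes_\omega F_{x,y})$. A 2-morphism $F\Rightarrow G$ is a natural transformation $\alpha$ with $\langle-,\alpha_y\rangle F_{x,y}=\langle\alpha_x,-\rangle G_{x,y}$. **$\mathcal V$-$\delta$module $\mathcal M^R$.** A category $\mathcal M$ with functors $R^n:(\mathcal V^n\times\mathcal M)^{\mathrm{op}}\times\mathcal M\to\mathsf{Sets}$ ($n\ge0$), values $R^n(a_1,\dots,a_n,x;y)$, with natural maps (α) $R^p(\mathbf a,\omega^q(\mathbf b),\mathbf a',x;y)\to R^{p+q}(\mathbf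 a,\mathbf b,\mathbf a',x;y)$ for $p\ge1,q\ge-1$ and each position; (β) $R^p(\mathbf a,m;y)\times R^q(\mathbf b,x;m)\to R^{p+q}(\mathbf a,\mathbf b,x;y)$ for $p,q\ge0$, extranatural in $m$ (i.e. a map out of the coend over $m$); (ι) $\mathcal M(x,y)\to R^0(x;y)$. Axioms (whenever they make sense): β$(\iota(g),r)=g_*r$ and β$(r,\iota(f))=f^*r$; $R^p(\mathbf a,v,\mathbf a',x;y)\to R^p(\mathbf a,\omega^0v,\mathbf a',x;y)\xrightarrow{\alpha}R^p(\mathbf a,v,\mathbf a',x;y)$ (first map induced by the counit) is the identity; applications of α in two distinct slots commute; α in the $R^p$-argument commutes with β; α in the $R^q$-argument commutes with β; applying α twice to $R^p(\mathbf a,\omega^q(\mathbf b,\omega^r(\mathbf c),\mathbf b'),\mathbf a',x;y)$ agrees with first restricting along $\omega^{q+r}\to\omega^q(-,\omega^r,-)$ and then applying α; β is associative. It is *right representable* if there exist a functor $[-,-]:\mathcal M^{\mathrm{op}}\times\mathcal M\to\mathcal V$ and a natural isomorphism $\phi:\mathcal V(\omega^0(a),[x,y])\cong R^1(a,x;y)$ such that for every $p\ge0$ the map $\phi^p:\mathcal V(\omega^{p-1}(\mathbf a),[x,y])\to\mathcal V(\omega^0\omega^{p-1}(\mathbf a),[x,y])\xrightarrow{\phi}R^1(\omega^{p-1}(\mathbf a),x;y)\xrightarrow{\alpha}R^p(\mathbf a,x;y)$ (first arrow: precomposition with the counit) is an isomorphism. An *oplax functor* $\mathcal M^R\to\mathcal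 N^S$ is a functor $F:\mathcal M\to\mathcal N$ with natural maps $f^p:R^p(\mathbf a,x;y)\to S^p(\mathbf a,Fx;Fy)$ ($p\ge0$) compatible with ι (i.e. $f^0\circ\iota=\iota\circ F$), α and β. A natural transformation $(F,f)\Rightarrow(G,g)$ is a natural transformation $\alpha:F\Rightarrow G$ with $(\alpha_y)_*f^p=(\alpha_x)^*g^p:R^p(\mathbf a,x;y)\to S^p(\mathbf a,Fx;Gy)$ for all $p$. **The 2-functor.** For $(\mathcal M,[-,-],\eta,\mu)$: α is precomposition with $\omega^{p+q-1}\to\omega^{p-1}(-,\omega^q,-)$; β sends $(f:\omega^{p-1}(\mathbf a)\to[m,y],\ g:\omega^{q-1}(\mathbf b)\to[x,m])$ to $\omega^{p+q-1}(\mathbf a,\mathbf b)\to\omega^{p-1}(\mathbf a)\otimes_\omega\omega^{q-1}(\mathbf b)\xrightarrow{f\otimes g}[m,y]\otimes_\omega[x,m]\xrightarrow{\mu}[x,y]$; ι sends $f:x\to y$ to $[x,f]\circ\eta_x$. An enriched functor $F$ is sent to $F$ with $f^p$ = postcomposition with $F_{x,y}$; the 2-functor is the identity on underlying natural transformations. *)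

theory Defs
  imports Main "HOL-Library.FuncSet"
begin

section \<open>Categories, functors, natural transformations\<close>

record ('o, 'a) cat =
  Ob  :: "'o set"
  Ar  :: "'a set"
  Dom :: "'a \<Rightarrow> 'o"
  Cod :: "'a \<Rightarrow> 'o"
  Idn :: "'o \<Rightarrow> 'a"
  Cmp :: "'a \<Rightarrow> 'a \<Rightarrow> 'a" (infixr "\<odot>\<index>" 70)

definition hom :: "('o, 'a, 'z) cat_scheme \<Rightarrow> 'o \<Rightarrow> 'o \<Rightarrow> 'a set" where
  "hom C x y = {f \<in> Ar C. Dom C f = x \<and> Cod C f = y}"

locale category =
  fixes C :: "('o, 'a, 'z) cat_scheme" (structure)
  assumes Dom_in: "f \<in> Ar C \<Longrightarrow> Dom C f \<in> Ob C"
    and Cod_in: "f \<in> Ar C \<Longrightarrow> Cod C f \<in> Ob C"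
    and Idn_hom: "x \<in> Ob C \<Longrightarrow> Idn C x \<in> hom C x x"
    and Cmp_hom: "f \<in> hom C x y \<Longrightarrow> g \<in> hom C y z \<Longrightarrow> g \<odot> f \<in> hom C x z"
    and Idn_left: "f \<in> hom C x y \<Longrightarrow> Idn C y \<odot> f = f"
    and Idn_right: "f \<in> hom C x y \<Longrightarrow> f \<odot> Idn C x = f"
    and Cmp_assoc: "f \<in> hom C w x \<Longrightarrow> g \<in> hom C x y \<Longrightarrow> h \<in> hom C y z \<Longrightarrow>
        (h \<odot> g) \<odot> f = h \<odot> (g \<odot> f)"

definition opcat :: "('o, 'a, 'z) cat_scheme \<Rightarrow> ('o, 'a) cat" where
  "opcat C = \<lparr>Ob = Ob C, Ar = Ar C, Dom = Cod C, Cod = Dom C, Idn = Idn C,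
     Cmp = (\<lambda>g f. f \<odot>\<^bsub>C\<^esub> g)\<rparr>"

definition invertible :: "('o, 'a, 'z) cat_scheme \<Rightarrow> 'a \<Rightarrow> bool" where
  "invertible C f \<longleftrightarrow> (\<exists>g \<in> hom C (Cod C f) (Dom C f).
     g \<odot>\<^bsub>C\<^esub> f = Idn C (Dom C f) \<and> f \<odot>\<^bsub>C\<^esub> g = Idn C (Cod C f))"

locale is_functor =
  fixes C :: "('o, 'a, 'z) cat_scheme" and D :: "('p, 'b, 'y) cat_scheme"
    and Fo :: "'o \<Rightarrow> 'p" and Fa :: "'a \<Rightarrow> 'b"
  assumes Fo_in: "x \<in> Ob C \<Longrightarrow> Fo x \<in> Ob D"
    and Fa_hom: "f \<in> Ar C \<Longrightarrow> Fa f \<in> hom D (Fo (Dom C f)) (Fo (Cod C f))"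
    and Fa_Idn: "x \<in> Ob C \<Longrightarrow> Fa (Idn C x) = Idn D (Fo x)"
    and Fa_Cmp: "f \<in> Ar C \<Longrightarrow> g \<in> Ar C \<Longrightarrow> Dom C g = Cod C f \<Longrightarrow>
        Fa (g \<odot>\<^bsub>C\<^esub> f) = Fa g \<odot>\<^bsub>D\<^esub> Fa f"

text \<open>A functor out of the product category \<open>C \<times> D\<close>, in curried form.\<close>

locale bifunctor =
  fixes C :: "('o, 'a, 'z) cat_scheme" and D :: "('p, 'b, 'y) cat_scheme"
    and E :: "('q, 'c, 'x) cat_scheme"
    and Fo :: "'o \<Rightarrow> 'p \<Rightarrow> 'q" and Fa :: "'a \<Rightarrow> 'b \<Rightarrow> 'c"
  assumes Fo_in: "x \<in> Ob C \<Longrightarrow> y \<in> Ob D \<Longrightarrow> Fo x y \<in> Ob E"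
    and Fa_hom: "f \<in> Ar C \<Longrightarrow> g \<in> Ar D \<Longrightarrow>
        Fa f g \<in> hom E (Fo (Dom C f) (Dom D g)) (Fo (Cod C f) (Cod D g))"
    and Fa_Idn: "x \<in> Ob C \<Longrightarrow> y \<in> Ob D \<Longrightarrow> Fa (Idn C x) (Idn D y) = Idn E (Fo x y)"
    and Fa_Cmp: "f \<in> Ar C \<Longrightarrow> f' \<in> Ar C \<Longrightarrow> Dom C f' = Cod C f \<Longrightarrow>
        g \<in> Ar D \<Longrightarrow> g' \<in> Ar D \<Longrightarrow> Dom D g' = Cod D g \<Longrightarrow>
        Fa (f' \<odot>\<^bsub>C\<^esub> f) (g' \<odot>\<^bsub>D\<^esub> g) = Fa f' g' \<odot>\<^bsub>E\<^esub> Fa f g"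

record ('o, 'a) func =
  FO :: "'o \<Rightarrow> 'o"
  FA :: "'a \<Rightarrow> 'a"

record ('f, 'o, 'a) cell =
  Src :: 'f
  Tgt :: 'f
  At  :: "'o \<Rightarrow> 'a"

definition is_natural ::
  "('o, 'a, 'z) cat_scheme \<Rightarrow> ('o, 'a, 'y) cat_scheme \<Rightarrow>
   ('o, 'a, 'f) func_scheme \<Rightarrow> ('o, 'a, 'f) func_scheme \<Rightarrow> ('o \<Rightarrow> 'a) \<Rightarrow> bool" where
  "is_natural C D F G t \<longleftrightarrow>
     (\<forall>x \<in> Ob C. t x \<in> hom D (FO F x) (FO G x)) \<and>
     (\<forall>f \<in> Ar C. t (Cod C f) \<odot>\<^bsub>D\<^esub> FA F f = FA G f \<odot>\<^bsub>D\<^esub> t (Dom C f))"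


section \<open>Strict 2-categories, 2-functors, 2-equivalences\<close>

text \<open>The 2-category has hom-categories \<open>HomC A B\<close>; \<open>Cmp1\<close> and \<open>Cmp2\<close> are composition of
  1-cells and horizontal composition of 2-cells (\<open>g\<close> after \<open>f\<close>).\<close>

record ('o, 'f, 't) two_cat =
  Ob0  :: "'o set"
  HomC :: "'o \<Rightarrow> 'o \<Rightarrow> ('f, 't) cat"
  Id1  :: "'o \<Rightarrow> 'f"
  Cmp1 :: "'o \<Rightarrow> 'o \<Rightarrow> 'o \<Rightarrow> 'f \<Rightarrow> 'f \<Rightarrow> 'f"
  Cmp2 :: "'o \<Rightarrow> 'o \<Rightarrow> 'o \<Rightarrow> 't \<Rightarrow> 't \<Rightarrow> 't"

locale two_category =
  fixes T :: "('o, 'f, 't) two_cat"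
  assumes hom_category: "A \<in> Ob0 T \<Longrightarrow> B \<in> Ob0 T \<Longrightarrow> category (HomC T A B)"
    and Id1_in: "A \<in> Ob0 T \<Longrightarrow> Id1 T A \<in> Ob (HomC T A A)"
    and Cmp_bifunctor: "A \<in> Ob0 T \<Longrightarrow> B \<in> Ob0 T \<Longrightarrow> C \<in> Ob0 T \<Longrightarrow>
        bifunctor (HomC T B C) (HomC T A B) (HomC T A C) (Cmp1 T A B C) (Cmp2 T A B C)"
    and Cmp1_left: "A \<in> Ob0 T \<Longrightarrow> B \<in> Ob0 T \<Longrightarrow> u \<in> Ob (HomC T A B) \<Longrightarrow>
        Cmp1 T A B B (Id1 T B) u = u"
    and Cmp1_right: "A \<in> Ob0 T \<Longrightarrow> B \<in> Ob0 T \<Longrightarrow> u \<in> Ob (HomC T A B) \<Longrightarrow>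
        Cmp1 T A A B u (Id1 T A) = u"
    and Cmp1_assoc: "A \<in> Ob0 T \<Longrightarrow> B \<in> Ob0 T \<Longrightarrow> C \<in> Ob0 T \<Longrightarrow> D \<in> Ob0 T \<Longrightarrow>
        u \<in> Ob (HomC T A B) \<Longrightarrow> v \<in> Ob (HomC T B C) \<Longrightarrow> w \<in> Ob (HomC T C D) \<Longrightarrow>
        Cmp1 T A B D (Cmp1 T B C D w v) u = Cmp1 T A C D w (Cmp1 T A B C v u)"
    and Cmp2_left: "A \<in> Ob0 T \<Longrightarrow> B \<in> Ob0 T \<Longrightarrow> a \<in> Ar (HomC T A B) \<Longrightarrow>
        Cmp2 T A B B (Idn (HomC T B B) (Id1 T B)) a = a"
    and Cmp2_right: "A \<in> Ob0 T \<Longrightarrow> B \<in> Ob0 T \<Longrightarrow> a \<in> Ar (HomC T A B) \<Longrightarrow>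
        Cmp2 T A A B a (Idn (HomC T A A) (Id1 T A)) = a"
    and Cmp2_assoc: "A \<in> Ob0 T \<Longrightarrow> B \<in> Ob0 T \<Longrightarrow> C \<in> Ob0 T \<Longrightarrow> D \<in> Ob0 T \<Longrightarrow>
        a \<in> Ar (HomC T A B) \<Longrightarrow> b \<in> Ar (HomC T B C) \<Longrightarrow> c \<in> Ar (HomC T C D) \<Longrightarrow>
        Cmp2 T A B D (Cmp2 T B C D c b) a = Cmp2 T A C D c (Cmp2 T A B C b a)"

definition full_sub :: "('o, 'f, 't) two_cat \<Rightarrow> ('o \<Rightarrow> bool) \<Rightarrow> ('o, 'f, 't) two_cat" where
  "full_sub T P = T\<lparr>Ob0 := {A \<in> Ob0 T. P A}\<rparr>"

record ('o, 'f, 't, 'p, 'g, 's) two_func =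
  P0 :: "'o \<Rightarrow> 'p"
  P1 :: "'o \<Rightarrow> 'o \<Rightarrow> 'f \<Rightarrow> 'g"
  P2 :: "'o \<Rightarrow> 'o \<Rightarrow> 't \<Rightarrow> 's"

locale two_functor = S: two_category S + T: two_category T
  for S :: "('o, 'f, 't) two_cat" and T :: "('p, 'g, 's) two_cat" +
  fixes P :: "('o, 'f, 't, 'p, 'g, 's) two_func"
  assumes P0_in: "A \<in> Ob0 S \<Longrightarrow> P0 P A \<in> Ob0 T"
    and P_functor: "A \<in> Ob0 S \<Longrightarrow> B \<in> Ob0 S \<Longrightarrow>
        is_functor (HomC S A B) (HomC T (P0 P A) (P0 P B)) (P1 P A B) (P2 P A B)"
    and P1_Id1: "A \<in> Ob0 S \<Longrightarrow> P1 P A A (Id1 S A) = Id1 T (P0 P A)"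
    and P1_Cmp1: "A \<in> Ob0 S \<Longrightarrow> B \<in> Ob0 S \<Longrightarrow> C \<in> Ob0 S \<Longrightarrow>
        u \<in> Ob (HomC S A B) \<Longrightarrow> v \<in> Ob (HomC S B C) \<Longrightarrow>
        P1 P A C (Cmp1 S A B C v u)
          = Cmp1 T (P0 P A) (P0 P B) (P0 P C) (P1 P B C v) (P1 P A B u)"
    and P2_Cmp2: "A \<in> Ob0 S \<Longrightarrow> B \<in> Ob0 S \<Longrightarrow> C \<in> Ob0 S \<Longrightarrow>
        a \<in> Ar (HomC S A B) \<Longrightarrow> b \<in> Ar (HomC S B C) \<Longrightarrow>
        P2 P A C (Cmp2 S A B C b a)
          = Cmp2 T (P0 P A) (P0 P B) (P0 P C) (P2 P B C b) (P2 P A B a)"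

definition two_id :: "('o, 'f, 't, 'o, 'f, 't) two_func" where
  "two_id = \<lparr>P0 = (\<lambda>A. A), P1 = (\<lambda>A B u. u), P2 = (\<lambda>A B a. a)\<rparr>"

definition two_comp ::
  "('p, 'g, 's, 'q, 'h, 'r) two_func \<Rightarrow> ('o, 'f, 't, 'p, 'g, 's) two_func \<Rightarrow>
   ('o, 'f, 't, 'q, 'h, 'r) two_func" where
  "two_comp Q P = \<lparr>P0 = (\<lambda>A. P0 Q (P0 P A)),
     P1 = (\<lambda>A B u. P1 Q (P0 P A) (P0 P B) (P1 P A B u)),
     P2 = (\<lambda>A B a. P2 Q (P0 P A) (P0 P B) (P2 P A B a))\<rparr>"

definition two_natural ::
  "('o, 'f, 't) two_cat \<Rightarrow> ('p, 'g, 's) two_cat \<Rightarrow> ('o, 'f, 't, 'p, 'g, 's) two_func \<Rightarrow>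
   ('o, 'f, 't, 'p, 'g, 's) two_func \<Rightarrow> ('o \<Rightarrow> 'g) \<Rightarrow> bool" where
  "two_natural S T P Q \<sigma> \<longleftrightarrow>
     (\<forall>A \<in> Ob0 S. \<sigma> A \<in> Ob (HomC T (P0 P A) (P0 Q A))) \<and>
     (\<forall>A \<in> Ob0 S. \<forall>B \<in> Ob0 S. \<forall>u \<in> Ob (HomC S A B).
        Cmp1 T (P0 P A) (P0 P B) (P0 Q B) (\<sigma> B) (P1 P A B u)
          = Cmp1 T (P0 P A) (P0 Q A) (P0 Q B) (P1 Q A B u) (\<sigma> A)) \<and>
     (\<forall>A \<in> Ob0 S. \<forall>B \<in> Ob0 S. \<forall>a \<in> Ar (HomC S A B).
        Cmp2 T (P0 P A) (P0 P B) (P0 Q B)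
            (Idn (HomC T (P0 P B) (P0 Q B)) (\<sigma> B)) (P2 P A B a)
          = Cmp2 T (P0 P A) (P0 Q A) (P0 Q B)
            (P2 Q A B a) (Idn (HomC T (P0 P A) (P0 Q A)) (\<sigma> A)))"

definition invertible1 :: "('o, 'f, 't) two_cat \<Rightarrow> 'o \<Rightarrow> 'o \<Rightarrow> 'f \<Rightarrow> bool" where
  "invertible1 T A B u \<longleftrightarrow> (\<exists>v \<in> Ob (HomC T B A).
     Cmp1 T A B A v u = Id1 T A \<and> Cmp1 T B A B u v = Id1 T B)"

definition two_natural_iso ::
  "('o, 'f, 't) two_cat \<Rightarrow> ('p, 'g, 's) two_cat \<Rightarrow> ('o, 'f, 't, 'p, 'g, 's) two_func \<Rightarrow>
   ('o, 'f, 't, 'p, 'g, 's) two_func \<Rightarrow> ('o \<Rightarrow> 'g) \<Rightarrow> bool" where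
  "two_natural_iso S T P Q \<sigma> \<longleftrightarrow> two_natural S T P Q \<sigma> \<and>
     (\<forall>A \<in> Ob0 S. invertible1 T (P0 P A) (P0 Q A) (\<sigma> A))"

definition two_equivalence ::
  "('o, 'f, 't) two_cat \<Rightarrow> ('p, 'g, 's) two_cat \<Rightarrow> ('o, 'f, 't, 'p, 'g, 's) two_func \<Rightarrow> bool"
  where
  "two_equivalence S T P \<longleftrightarrow> two_functor S T P \<and>
     (\<exists>Q \<sigma> \<tau>. two_functor T S Q \<and>
        two_natural_iso S S two_id (two_comp Q P) \<sigma> \<and>
        two_natural_iso T T (two_comp P Q) two_id \<tau>)"


section \<open>Oplax monoidal categories\<close>

text \<open>\<open>\<omega>\<^sup>n(a\<^sub>0, \<dots>, a\<^sub>n)\<close> is \<open>om V [a\<^sub>0, \<dots>, a\<^sub>n]\<close>, so a list of length \<open>n + 1\<close> (with \<open>n \<ge> -1\<close>)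
  determines \<open>n\<close>; \<open>omA\<close> is the action on arrows. The component of
  \<open>\<omega>\<^sup>p\<^sup>+\<^sup>q \<rightarrow> \<omega>\<^sup>p(-, \<omega>\<^sup>q, -)\<close> at \<open>(as, bs, cs)\<close> is \<open>ins V as bs cs\<close>, where
  \<open>q + 1 = length bs\<close>, \<open>p = length as + length cs\<close> and \<open>length as\<close> is the position of insertion.\<close>

record ('o, 'a) oplax = "('o, 'a) cat" +
  om  :: "'o list \<Rightarrow> 'o"
  omA :: "'a list \<Rightarrow> 'a"
  ins :: "'o list \<Rightarrow> 'o list \<Rightarrow> 'o list \<Rightarrow> 'a"
  cou :: "'o \<Rightarrow> 'a"

abbreviation ids :: "('o, 'a, 'z) cat_scheme \<Rightarrow> 'o list \<Rightarrow> 'a list" where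
  "ids C as \<equiv> map (Idn C) as"

locale oplax_monoidal = category V
  for V :: "('o, 'a, 'z) oplax_scheme" (structure) +
  assumes om_in: "as \<in> lists (Ob V) \<Longrightarrow> om V as \<in> Ob V"
    and omA_hom: "fs \<in> lists (Ar V) \<Longrightarrow>
        omA V fs \<in> hom V (om V (map (Dom V) fs)) (om V (map (Cod V) fs))"
    and omA_ids: "as \<in> lists (Ob V) \<Longrightarrow> omA V (ids V as) = Idn V (om V as)"
    and omA_Cmp: "fs \<in> lists (Ar V) \<Longrightarrow> gs \<in> lists (Ar V) \<Longrightarrow>
        map (Dom V) gs = map (Cod V) fs \<Longrightarrow>
        omA V (map2 (Cmp V) gs fs) = omA V gs \<odot> omA V fs"
    and ins_hom: "as \<in> lists (Ob V) \<Longrightarrow> bs \<in> lists (Ob V) \<Longrightarrow> cs \<in> lists (Ob V) \<Longrightarrow>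
        ins V as bs cs \<in> hom V (om V (as @ bs @ cs)) (om V (as @ [om V bs] @ cs))"
    and ins_natural: "fs \<in> lists (Ar V) \<Longrightarrow> gs \<in> lists (Ar V) \<Longrightarrow> hs \<in> lists (Ar V) \<Longrightarrow>
        ins V (map (Cod V) fs) (map (Cod V) gs) (map (Cod V) hs) \<odot> omA V (fs @ gs @ hs)
          = omA V (fs @ [omA V gs] @ hs)
              \<odot> ins V (map (Dom V) fs) (map (Dom V) gs) (map (Dom V) hs)"
    and cou_hom: "a \<in> Ob V \<Longrightarrow> cou V a \<in> hom V (om V [a]) a"
    and cou_natural: "f \<in> Ar V \<Longrightarrow>
        cou V (Cod V f) \<odot> omA V [f] = f \<odot> cou V (Dom V f)"
    and cou_outer: "bs \<in> lists (Ob V) \<Longrightarrow>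
        cou V (om V bs) \<odot> ins V [] bs [] = Idn V (om V bs)"
    and cou_inner: "as \<in> lists (Ob V) \<Longrightarrow> b \<in> Ob V \<Longrightarrow> cs \<in> lists (Ob V) \<Longrightarrow>
        omA V (ids V as @ [cou V b] @ ids V cs) \<odot> ins V as [b] cs
          = Idn V (om V (as @ [b] @ cs))"
    and ins_parallel: "as \<in> lists (Ob V) \<Longrightarrow> bs \<in> lists (Ob V) \<Longrightarrow> cs \<in> lists (Ob V) \<Longrightarrow>
        ds \<in> lists (Ob V) \<Longrightarrow> es \<in> lists (Ob V) \<Longrightarrow>
        ins V (as @ [om V bs] @ cs) ds es \<odot> ins V as bs (cs @ ds @ es)
          = ins V as bs (cs @ [om V ds] @ es) \<odot> ins V (as @ bs @ cs) ds es"
    and ins_nested: "as \<in> lists (Ob V) \<Longrightarrow> bs \<in> lists (Ob V) \<Longrightarrow> cs \<in> lists (Ob V) \<Longrightarrow>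
        ds \<in> lists (Ob V) \<Longrightarrow> es \<in> lists (Ob V) \<Longrightarrow>
        omA V (ids V as @ [ins V bs cs ds] @ ids V es) \<odot> ins V as (bs @ cs @ ds) es
          = ins V as (bs @ [om V cs] @ ds) es \<odot> ins V (as @ bs) cs (ds @ es)"

locale normal_oplax_monoidal = oplax_monoidal +
  assumes normal: "a \<in> Ob V \<Longrightarrow> invertible V (cou V a)"


section \<open>2-cells between functors with extra structure\<close>

text \<open>1-cells and 2-cells are maps defined on the objects and arrows of a category only. To make
  equality of cells mean equality of these maps, every component is required to be \<open>undefined\<close>
  outside its domain (cf.\ \<^const>\<open>extensional\<close>), and compositions are cut down accordingly.
  \<open>cell_cat A B X Y\<close> has as objects the functors (with extra structure) in \<open>X\<close> and as arrows the
  natural transformations satisfying \<open>Y\<close>.\<close>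

definition cell_cat ::
  "('o, 'a, 'z) cat_scheme \<Rightarrow> ('o, 'a, 'y) cat_scheme \<Rightarrow> ('o, 'a, 'f) func_scheme set \<Rightarrow>
   (('o, 'a, 'f) func_scheme \<Rightarrow> ('o, 'a, 'f) func_scheme \<Rightarrow> ('o \<Rightarrow> 'a) \<Rightarrow> bool) \<Rightarrow>
   (('o, 'a, 'f) func_scheme, (('o, 'a, 'f) func_scheme, 'o, 'a) cell) cat" where
  "cell_cat A B X Y = \<lparr>
     Ob = X,
     Ar = {c. Src c \<in> X \<and> Tgt c \<in> X \<and> At c \<in> extensional (Ob A) \<and>
              is_natural A B (Src c) (Tgt c) (At c) \<and> Y (Src c) (Tgt c) (At c)},
     Dom = Src,
     Cod = Tgt,
     Idn = (\<lambda>F. \<lparr>Src = F, Tgt = F, At = (\<lambda>x\<in>Ob A. Idn B (FO F x))\<rparr>),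
     Cmp = (\<lambda>d c. \<lparr>Src = Src c, Tgt = Tgt d, At = (\<lambda>x\<in>Ob A. At d x \<odot>\<^bsub>B\<^esub> At c x)\<rparr>)\<rparr>"

definition cell_hcomp ::
  "('o, 'a, 'z) cat_scheme \<Rightarrow> ('o, 'a, 'y) cat_scheme \<Rightarrow>
   (('o, 'a, 'f) func_scheme \<Rightarrow> ('o, 'a, 'f) func_scheme \<Rightarrow> ('o, 'a, 'f) func_scheme) \<Rightarrow>
   (('o, 'a, 'f) func_scheme, 'o, 'a) cell \<Rightarrow> (('o, 'a, 'f) func_scheme, 'o, 'a) cell \<Rightarrow>
   (('o, 'a, 'f) func_scheme, 'o, 'a) cell" where
  "cell_hcomp A C cmp d c = \<lparr>Src = cmp (Src d) (Src c), Tgt = cmp (Tgt d) (Tgt c),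
     At = (\<lambda>x\<in>Ob A. At d (FO (Tgt c) x) \<odot>\<^bsub>C\<^esub> FA (Src d) (At c x))\<rparr>"


section \<open>Categories enriched over an oplax monoidal category\<close>

text \<open>\<open>HO M x y\<close> is \<open>[x, y]\<close> and \<open>HA M f g\<close> is \<open>[f, g] : [x, y] \<rightarrow> [x', y']\<close> for
  \<open>f : x' \<rightarrow> x\<close> and \<open>g : y \<rightarrow> y'\<close>; \<open>mu M x y z\<close> is \<open>\<mu>\<^bsub>x,y,z\<^esub>\<close>.\<close>

record ('o, 'a, 'vo, 'va) ecat = "('o, 'a) cat" +
  HO  :: "'o \<Rightarrow> 'o \<Rightarrow> 'vo"
  HA  :: "'a \<Rightarrow> 'a \<Rightarrow> 'va"
  eta :: "'o \<Rightarrow> 'va"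
  mu  :: "'o \<Rightarrow> 'o \<Rightarrow> 'o \<Rightarrow> 'va"

locale enriched_category = category M + H: bifunctor "opcat M" M V "HO M" "HA M"
  for V :: "('vo, 'va, 'z) oplax_scheme" and M :: "('o, 'a, 'vo, 'va) ecat" +
  assumes eta_hom: "x \<in> Ob M \<Longrightarrow> eta M x \<in> hom V (om V []) (HO M x x)"
    and eta_extranatural: "f \<in> hom M x y \<Longrightarrow>
        HA M (Idn M x) f \<odot>\<^bsub>V\<^esub> eta M x = HA M f (Idn M y) \<odot>\<^bsub>V\<^esub> eta M y"
    and mu_hom: "x \<in> Ob M \<Longrightarrow> y \<in> Ob M \<Longrightarrow> z \<in> Ob M \<Longrightarrow>
        mu M x y z \<in> hom V (om V [HO M y z, HO M x y]) (HO M x z)"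
    and mu_natural: "f \<in> hom M x' x \<Longrightarrow> y \<in> Ob M \<Longrightarrow> g \<in> hom M z z' \<Longrightarrow>
        mu M x' y z' \<odot>\<^bsub>V\<^esub> omA V [HA M (Idn M y) g, HA M f (Idn M y)]
          = HA M f g \<odot>\<^bsub>V\<^esub> mu M x y z"
    and mu_extranatural: "x \<in> Ob M \<Longrightarrow> h \<in> hom M y y' \<Longrightarrow> z \<in> Ob M \<Longrightarrow>
        mu M x y z \<odot>\<^bsub>V\<^esub> omA V [HA M h (Idn M z), Idn V (HO M x y)]
          = mu M x y' z \<odot>\<^bsub>V\<^esub> omA V [Idn V (HO M y' z), HA M (Idn M x) h]"
    and mu_assoc: "w \<in> Ob M \<Longrightarrow> x \<in> Ob M \<Longrightarrow> y \<in> Ob M \<Longrightarrow> z \<in> Ob M \<Longrightarrow>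
        mu M w x z \<odot>\<^bsub>V\<^esub> omA V [mu M x y z, Idn V (HO M w x)]
            \<odot>\<^bsub>V\<^esub> ins V [] [HO M y z, HO M x y] [HO M w x]
          = mu M w y z \<odot>\<^bsub>V\<^esub> omA V [Idn V (HO M y z), mu M w x y]
            \<odot>\<^bsub>V\<^esub> ins V [HO M y z] [HO M x y, HO M w x] []"
    and mu_eta_left: "x \<in> Ob M \<Longrightarrow> y \<in> Ob M \<Longrightarrow>
        mu M x y y \<odot>\<^bsub>V\<^esub> omA V [eta M y, Idn V (HO M x y)] \<odot>\<^bsub>V\<^esub> ins V [] [] [HO M x y]
          = cou V (HO M x y)"
    and mu_eta_right: "x \<in> Ob M \<Longrightarrow> y \<in> Ob M \<Longrightarrow>
        mu M x x y \<odot>\<^bsub>V\<^esub> omA V [Idn V (HO M x y), eta M x] \<odot>\<^bsub>V\<^esub> ins V [HO M x y] [] []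
          = cou V (HO M x y)"

record ('o, 'a, 'va) efun = "('o, 'a) func" +
  FH :: "'o \<Rightarrow> 'o \<Rightarrow> 'va"

locale enriched_functor = is_functor B C "FO F" "FA F"
  for V :: "('vo, 'va, 'z) oplax_scheme" and B C :: "('o, 'a, 'vo, 'va) ecat"
    and F :: "('o, 'a, 'va) efun" +
  assumes FO_ext: "FO F \<in> extensional (Ob B)"
    and FA_ext: "FA F \<in> extensional (Ar B)"
    and FH_ext: "\<not> (x \<in> Ob B \<and> y \<in> Ob B) \<Longrightarrow> FH F x y = undefined"
    and FH_hom: "x \<in> Ob B \<Longrightarrow> y \<in> Ob B \<Longrightarrow>
        FH F x y \<in> hom V (HO B x y) (HO C (FO F x) (FO F y))"
    and FH_natural: "f \<in> hom B x' x \<Longrightarrow> g \<in> hom B y y' \<Longrightarrow>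
        FH F x' y' \<odot>\<^bsub>V\<^esub> HA B f g = HA C (FA F f) (FA F g) \<odot>\<^bsub>V\<^esub> FH F x y"
    and FH_eta: "x \<in> Ob B \<Longrightarrow> FH F x x \<odot>\<^bsub>V\<^esub> eta B x = eta C (FO F x)"
    and FH_mu: "x \<in> Ob B \<Longrightarrow> y \<in> Ob B \<Longrightarrow> z \<in> Ob B \<Longrightarrow>
        FH F x z \<odot>\<^bsub>V\<^esub> mu B x y z
          = mu C (FO F x) (FO F y) (FO F z) \<odot>\<^bsub>V\<^esub> omA V [FH F y z, FH F x y]"

definition enriched_nat ::
  "('vo, 'va, 'z) oplax_scheme \<Rightarrow> ('o, 'a, 'vo, 'va) ecat \<Rightarrow> ('o, 'a, 'vo, 'va) ecat \<Rightarrow>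
   ('o, 'a, 'va) efun \<Rightarrow> ('o, 'a, 'va) efun \<Rightarrow> ('o \<Rightarrow> 'a) \<Rightarrow> bool" where
  "enriched_nat V B C F G t \<longleftrightarrow> (\<forall>x \<in> Ob B. \<forall>y \<in> Ob B.
     HA C (Idn C (FO F x)) (t y) \<odot>\<^bsub>V\<^esub> FH F x y
       = HA C (t x) (Idn C (FO G y)) \<odot>\<^bsub>V\<^esub> FH G x y)"

definition efun_id ::
  "('vo, 'va, 'z) oplax_scheme \<Rightarrow> ('o, 'a, 'vo, 'va) ecat \<Rightarrow> ('o, 'a, 'va) efun" where
  "efun_id V A = \<lparr>FO = (\<lambda>x\<in>Ob A. x), FA = (\<lambda>f\<in>Ar A. f),
     FH = (\<lambda>x y. if x \<in> Ob A \<and> y \<in> Ob A then Idn V (HO A x y) else undefined)\<rparr>"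

definition efun_comp ::
  "('vo, 'va, 'z) oplax_scheme \<Rightarrow> ('o, 'a, 'vo, 'va) ecat \<Rightarrow>
   ('o, 'a, 'va) efun \<Rightarrow> ('o, 'a, 'va) efun \<Rightarrow> ('o, 'a, 'va) efun" where
  "efun_comp V A G F = \<lparr>FO = (\<lambda>x\<in>Ob A. FO G (FO F x)), FA = (\<lambda>f\<in>Ar A. FA G (FA F f)),
     FH = (\<lambda>x y. if x \<in> Ob A \<and> y \<in> Ob A
                 then FH G (FO F x) (FO F y) \<odot>\<^bsub>V\<^esub> FH F x y else undefined)\<rparr>"

definition Cat_enr ::
  "('vo, 'va, 'z) oplax_scheme \<Rightarrow>
   (('o, 'a, 'vo, 'va) ecat, ('o, 'a, 'va) efun, (('o, 'a, 'va) efun, 'o, 'a) cell) two_cat" where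
  "Cat_enr V = \<lparr>
     Ob0 = {M. enriched_category V M},
     HomC = (\<lambda>A B. cell_cat A B {F. enriched_functor V A B F} (enriched_nat V A B)),
     Id1 = efun_id V,
     Cmp1 = (\<lambda>A B C. efun_comp V A),
     Cmp2 = (\<lambda>A B C. cell_hcomp A C (efun_comp V A))\<rparr>"


section \<open>\<open>\<V>\<close>-\<open>\<delta>\<close>modules\<close>

text \<open>The values \<open>R\<^sup>n(a\<^sub>1, \<dots>, a\<^sub>n, x; y)\<close> are the sets \<open>RS M [a\<^sub>1, \<dots>, a\<^sub>n] x y\<close> with elements in the
  type \<open>'r\<close>. For \<open>u\<^sub>i : a\<^sub>i' \<rightarrow> a\<^sub>i\<close>, \<open>f : x' \<rightarrow> x\<close>, \<open>g : y \<rightarrow> y'\<close>, functoriality is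
  \<open>RA M [u\<^sub>1, \<dots>, u\<^sub>n] f g : R\<^sup>n(a, x; y) \<rightarrow> R\<^sup>n(a', x'; y')\<close>. The structure maps are

  \<^item> \<open>al M as bs cs x y : R(as, \<omega>(bs), cs, x; y) \<rightarrow> R(as, bs, cs, x; y)\<close>,
  \<^item> \<open>be M as bs x m y : R(as, m; y) \<times> R(bs, x; m) \<rightarrow> R(as, bs, x; y)\<close>,
  \<^item> \<open>io M f \<in> R\<^sup>0(x; y)\<close> for \<open>f : x \<rightarrow> y\<close>.\<close>

record ('o, 'a, 'vo, 'va, 'r) dmod = "('o, 'a) cat" +
  RS :: "'vo list \<Rightarrow> 'o \<Rightarrow> 'o \<Rightarrow> 'r set"
  RA :: "'va list \<Rightarrow> 'a \<Rightarrow> 'a \<Rightarrow> 'r \<Rightarrow> 'r"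
  al :: "'vo list \<Rightarrow> 'vo list \<Rightarrow> 'vo list \<Rightarrow> 'o \<Rightarrow> 'o \<Rightarrow> 'r \<Rightarrow> 'r"
  be :: "'vo list \<Rightarrow> 'vo list \<Rightarrow> 'o \<Rightarrow> 'o \<Rightarrow> 'o \<Rightarrow> 'r \<Rightarrow> 'r \<Rightarrow> 'r"
  io :: "'a \<Rightarrow> 'r"

locale delta_module = category M
  for V :: "('vo, 'va, 'z) oplax_scheme" and M :: "('o, 'a, 'vo, 'va, 'r) dmod" +
  assumes RA_in: "us \<in> lists (Ar V) \<Longrightarrow> f \<in> Ar M \<Longrightarrow> g \<in> Ar M \<Longrightarrow>
        r \<in> RS M (map (Cod V) us) (Cod M f) (Dom M g) \<Longrightarrow>
        RA M us f g r \<in> RS M (map (Dom V) us) (Dom M f) (Cod M g)"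
    and RA_Idn: "as \<in> lists (Ob V) \<Longrightarrow> x \<in> Ob M \<Longrightarrow> y \<in> Ob M \<Longrightarrow> r \<in> RS M as x y \<Longrightarrow>
        RA M (ids V as) (Idn M x) (Idn M y) r = r"
    and RA_Cmp: "us \<in> lists (Ar V) \<Longrightarrow> us' \<in> lists (Ar V) \<Longrightarrow>
        map (Dom V) us = map (Cod V) us' \<Longrightarrow>
        f \<in> Ar M \<Longrightarrow> f' \<in> Ar M \<Longrightarrow> Dom M f = Cod M f' \<Longrightarrow>
        g \<in> Ar M \<Longrightarrow> g' \<in> Ar M \<Longrightarrow> Dom M g' = Cod M g \<Longrightarrow>
        r \<in> RS M (map (Cod V) us) (Cod M f) (Dom M g) \<Longrightarrow>
        RA M (map2 (Cmp V) us us') (f \<odot>\<^bsub>M\<^esub> f') (g' \<odot>\<^bsub>M\<^esub> g) r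
          = RA M us' f' g' (RA M us f g r)"
    and al_in: "as \<in> lists (Ob V) \<Longrightarrow> bs \<in> lists (Ob V) \<Longrightarrow> cs \<in> lists (Ob V) \<Longrightarrow>
        x \<in> Ob M \<Longrightarrow> y \<in> Ob M \<Longrightarrow> r \<in> RS M (as @ [om V bs] @ cs) x y \<Longrightarrow>
        al M as bs cs x y r \<in> RS M (as @ bs @ cs) x y"
    and al_natural: "us \<in> lists (Ar V) \<Longrightarrow> vs \<in> lists (Ar V) \<Longrightarrow> ws \<in> lists (Ar V) \<Longrightarrow>
        f \<in> Ar M \<Longrightarrow> g \<in> Ar M \<Longrightarrow>
        r \<in> RS M (map (Cod V) us @ [om V (map (Cod V) vs)] @ map (Cod V) ws)
               (Cod M f) (Dom M g) \<Longrightarrow>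
        al M (map (Dom V) us) (map (Dom V) vs) (map (Dom V) ws) (Dom M f) (Cod M g)
            (RA M (us @ [omA V vs] @ ws) f g r)
          = RA M (us @ vs @ ws) f g
            (al M (map (Cod V) us) (map (Cod V) vs) (map (Cod V) ws) (Cod M f) (Dom M g) r)"
    and be_in: "as \<in> lists (Ob V) \<Longrightarrow> bs \<in> lists (Ob V) \<Longrightarrow>
        x \<in> Ob M \<Longrightarrow> m \<in> Ob M \<Longrightarrow> y \<in> Ob M \<Longrightarrow>
        r \<in> RS M as m y \<Longrightarrow> s \<in> RS M bs x m \<Longrightarrow> be M as bs x m y r s \<in> RS M (as @ bs) x y"
    and be_natural: "us \<in> lists (Ar V) \<Longrightarrow> vs \<in> lists (Ar V) \<Longrightarrow>
        f \<in> Ar M \<Longrightarrow> m \<in> Ob M \<Longrightarrow> g \<in> Ar M \<Longrightarrow>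
        r \<in> RS M (map (Cod V) us) m (Dom M g) \<Longrightarrow> s \<in> RS M (map (Cod V) vs) (Cod M f) m \<Longrightarrow>
        be M (map (Dom V) us) (map (Dom V) vs) (Dom M f) m (Cod M g)
            (RA M us (Idn M m) g r) (RA M vs f (Idn M m) s)
          = RA M (us @ vs) f g
            (be M (map (Cod V) us) (map (Cod V) vs) (Cod M f) m (Dom M g) r s)"
    and be_extranatural: "as \<in> lists (Ob V) \<Longrightarrow> bs \<in> lists (Ob V) \<Longrightarrow>
        x \<in> Ob M \<Longrightarrow> y \<in> Ob M \<Longrightarrow> h \<in> hom M m m' \<Longrightarrow>
        r \<in> RS M as m' y \<Longrightarrow> s \<in> RS M bs x m \<Longrightarrow>
        be M as bs x m y (RA M (ids V as) h (Idn M y) r) s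
          = be M as bs x m' y r (RA M (ids V bs) (Idn M x) h s)"
    and io_in: "f \<in> Ar M \<Longrightarrow> io M f \<in> RS M [] (Dom M f) (Cod M f)"
    and io_natural: "f \<in> Ar M \<Longrightarrow> k \<in> Ar M \<Longrightarrow> g \<in> Ar M \<Longrightarrow>
        Cod M f = Dom M k \<Longrightarrow> Cod M k = Dom M g \<Longrightarrow>
        io M (g \<odot>\<^bsub>M\<^esub> k \<odot>\<^bsub>M\<^esub> f) = RA M [] f g (io M k)"
    and be_io_left: "bs \<in> lists (Ob V) \<Longrightarrow> x \<in> Ob M \<Longrightarrow> g \<in> hom M m y \<Longrightarrow> r \<in> RS M bs x m \<Longrightarrow>
        be M [] bs x m y (io M g) r = RA M (ids V bs) (Idn M x) g r"
    and be_io_right: "as \<in> lists (Ob V) \<Longrightarrow> f \<in> hom M x m \<Longrightarrow> y \<in> Ob M \<Longrightarrow> r \<in> RS M as m y \<Longrightarrow>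
        be M as [] x m y r (io M f) = RA M (ids V as) f (Idn M y) r"
    and al_cou: "as \<in> lists (Ob V) \<Longrightarrow> v \<in> Ob V \<Longrightarrow> cs \<in> lists (Ob V) \<Longrightarrow>
        x \<in> Ob M \<Longrightarrow> y \<in> Ob M \<Longrightarrow> r \<in> RS M (as @ [v] @ cs) x y \<Longrightarrow>
        al M as [v] cs x y
          (RA M (ids V as @ [cou V v] @ ids V cs) (Idn M x) (Idn M y) r) = r"
    and al_parallel: "as \<in> lists (Ob V) \<Longrightarrow> bs \<in> lists (Ob V) \<Longrightarrow> cs \<in> lists (Ob V) \<Longrightarrow>
        ds \<in> lists (Ob V) \<Longrightarrow> es \<in> lists (Ob V) \<Longrightarrow> x \<in> Ob M \<Longrightarrow> y \<in> Ob M \<Longrightarrow>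
        r \<in> RS M (as @ [om V bs] @ cs @ [om V ds] @ es) x y \<Longrightarrow>
        al M as bs (cs @ ds @ es) x y (al M (as @ [om V bs] @ cs) ds es x y r)
          = al M (as @ bs @ cs) ds es x y (al M as bs (cs @ [om V ds] @ es) x y r)"
    and al_be_left: "as \<in> lists (Ob V) \<Longrightarrow> bs \<in> lists (Ob V) \<Longrightarrow> cs \<in> lists (Ob V) \<Longrightarrow>
        ds \<in> lists (Ob V) \<Longrightarrow> x \<in> Ob M \<Longrightarrow> m \<in> Ob M \<Longrightarrow> y \<in> Ob M \<Longrightarrow>
        r \<in> RS M (as @ [om V bs] @ cs) m y \<Longrightarrow> s \<in> RS M ds x m \<Longrightarrow>
        be M (as @ bs @ cs) ds x m y (al M as bs cs m y r) s
          = al M as bs (cs @ ds) x y (be M (as @ [om V bs] @ cs) ds x m y r s)"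
    and al_be_right: "as \<in> lists (Ob V) \<Longrightarrow> bs \<in> lists (Ob V) \<Longrightarrow> cs \<in> lists (Ob V) \<Longrightarrow>
        ds \<in> lists (Ob V) \<Longrightarrow> x \<in> Ob M \<Longrightarrow> m \<in> Ob M \<Longrightarrow> y \<in> Ob M \<Longrightarrow>
        r \<in> RS M as m y \<Longrightarrow> s \<in> RS M (bs @ [om V cs] @ ds) x m \<Longrightarrow>
        be M as (bs @ cs @ ds) x m y r (al M bs cs ds x m s)
          = al M (as @ bs) cs ds x y (be M as (bs @ [om V cs] @ ds) x m y r s)"
    and al_nested: "as \<in> lists (Ob V) \<Longrightarrow> bs \<in> lists (Ob V) \<Longrightarrow> cs \<in> lists (Ob V) \<Longrightarrow>
        ds \<in> lists (Ob V) \<Longrightarrow> es \<in> lists (Ob V) \<Longrightarrow> x \<in> Ob M \<Longrightarrow> y \<in> Ob M \<Longrightarrow>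
        r \<in> RS M (as @ [om V (bs @ [om V cs] @ ds)] @ es) x y \<Longrightarrow>
        al M (as @ bs) cs (ds @ es) x y (al M as (bs @ [om V cs] @ ds) es x y r)
          = al M as (bs @ cs @ ds) es x y
            (RA M (ids V as @ [ins V bs cs ds] @ ids V es) (Idn M x) (Idn M y) r)"
    and be_assoc: "as \<in> lists (Ob V) \<Longrightarrow> bs \<in> lists (Ob V) \<Longrightarrow> cs \<in> lists (Ob V) \<Longrightarrow>
        x \<in> Ob M \<Longrightarrow> n \<in> Ob M \<Longrightarrow> m \<in> Ob M \<Longrightarrow> y \<in> Ob M \<Longrightarrow>
        r \<in> RS M as m y \<Longrightarrow> s \<in> RS M bs n m \<Longrightarrow> t \<in> RS M cs x n \<Longrightarrow>
        be M as (bs @ cs) x m y r (be M bs cs x n m s t)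
          = be M (as @ bs) cs x n y (be M as bs n m y r s) t"

definition right_representable ::
  "('vo, 'va, 'z) oplax_scheme \<Rightarrow> ('o, 'a, 'vo, 'va, 'r) dmod \<Rightarrow> bool" where
  "right_representable V M \<longleftrightarrow>
     (\<exists>(Ho :: 'o \<Rightarrow> 'o \<Rightarrow> 'vo) (Ha :: 'a \<Rightarrow> 'a \<Rightarrow> 'va)
       (\<phi> :: 'vo \<Rightarrow> 'o \<Rightarrow> 'o \<Rightarrow> 'va \<Rightarrow> 'r).
        bifunctor (opcat M) M V Ho Ha \<and>
        (\<forall>a \<in> Ob V. \<forall>x \<in> Ob M. \<forall>y \<in> Ob M.
           bij_betw (\<phi> a x y) (hom V (om V [a]) (Ho x y)) (RS M [a] x y)) \<and>
        (\<forall>u \<in> Ar V. \<forall>f \<in> Ar M. \<forall>g \<in> Ar M.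
           \<forall>k \<in> hom V (om V [Cod V u]) (Ho (Cod M f) (Dom M g)).
             \<phi> (Dom V u) (Dom M f) (Cod M g) (Ha f g \<odot>\<^bsub>V\<^esub> k \<odot>\<^bsub>V\<^esub> omA V [u])
               = RA M [u] f g (\<phi> (Cod V u) (Cod M f) (Dom M g) k)) \<and>
        (\<forall>as \<in> lists (Ob V). \<forall>x \<in> Ob M. \<forall>y \<in> Ob M.
           bij_betw (\<lambda>k. al M [] as [] x y (\<phi> (om V as) x y (k \<odot>\<^bsub>V\<^esub> cou V (om V as))))
             (hom V (om V as) (Ho x y)) (RS M as x y)))"

record ('o, 'a, 'vo, 'r) dfun = "('o, 'a) func" +
  FR :: "'vo list \<Rightarrow> 'o \<Rightarrow> 'o \<Rightarrow> 'r \<Rightarrow> 'r"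

locale oplax_functor = is_functor M N "FO F" "FA F"
  for V :: "('vo, 'va, 'z) oplax_scheme" and M N :: "('o, 'a, 'vo, 'va, 'r) dmod"
    and F :: "('o, 'a, 'vo, 'r) dfun" +
  assumes FO_ext: "FO F \<in> extensional (Ob M)"
    and FA_ext: "FA F \<in> extensional (Ar M)"
    and FR_ext: "\<not> (as \<in> lists (Ob V) \<and> x \<in> Ob M \<and> y \<in> Ob M \<and> r \<in> RS M as x y) \<Longrightarrow>
        FR F as x y r = undefined"
    and FR_in: "as \<in> lists (Ob V) \<Longrightarrow> x \<in> Ob M \<Longrightarrow> y \<in> Ob M \<Longrightarrow> r \<in> RS M as x y \<Longrightarrow>
        FR F as x y r \<in> RS N as (FO F x) (FO F y)"
    and FR_natural: "us \<in> lists (Ar V) \<Longrightarrow> f \<in> Ar M \<Longrightarrow> g \<in> Ar M \<Longrightarrow>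
        r \<in> RS M (map (Cod V) us) (Cod M f) (Dom M g) \<Longrightarrow>
        FR F (map (Dom V) us) (Dom M f) (Cod M g) (RA M us f g r)
          = RA N us (FA F f) (FA F g) (FR F (map (Cod V) us) (Cod M f) (Dom M g) r)"
    and FR_io: "f \<in> Ar M \<Longrightarrow> FR F [] (Dom M f) (Cod M f) (io M f) = io N (FA F f)"
    and FR_al: "as \<in> lists (Ob V) \<Longrightarrow> bs \<in> lists (Ob V) \<Longrightarrow> cs \<in> lists (Ob V) \<Longrightarrow>
        x \<in> Ob M \<Longrightarrow> y \<in> Ob M \<Longrightarrow> r \<in> RS M (as @ [om V bs] @ cs) x y \<Longrightarrow>
        FR F (as @ bs @ cs) x y (al M as bs cs x y r)
          = al N as bs cs (FO F x) (FO F y) (FR F (as @ [om V bs] @ cs) x y r)"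
    and FR_be: "as \<in> lists (Ob V) \<Longrightarrow> bs \<in> lists (Ob V) \<Longrightarrow>
        x \<in> Ob M \<Longrightarrow> m \<in> Ob M \<Longrightarrow> y \<in> Ob M \<Longrightarrow> r \<in> RS M as m y \<Longrightarrow> s \<in> RS M bs x m \<Longrightarrow>
        FR F (as @ bs) x y (be M as bs x m y r s)
          = be N as bs (FO F x) (FO F m) (FO F y) (FR F as m y r) (FR F bs x m s)"

definition delta_nat ::
  "('vo, 'va, 'z) oplax_scheme \<Rightarrow> ('o, 'a, 'vo, 'va, 'r) dmod \<Rightarrow> ('o, 'a, 'vo, 'va, 'r) dmod \<Rightarrow>
   ('o, 'a, 'vo, 'r) dfun \<Rightarrow> ('o, 'a, 'vo, 'r) dfun \<Rightarrow> ('o \<Rightarrow> 'a) \<Rightarrow> bool" where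
  "delta_nat V M N F G t \<longleftrightarrow>
     (\<forall>as \<in> lists (Ob V). \<forall>x \<in> Ob M. \<forall>y \<in> Ob M. \<forall>r \<in> RS M as x y.
        RA N (ids V as) (Idn N (FO F x)) (t y) (FR F as x y r)
          = RA N (ids V as) (t x) (Idn N (FO G y)) (FR G as x y r))"

definition dfun_id ::
  "('vo, 'va, 'z) oplax_scheme \<Rightarrow> ('o, 'a, 'vo, 'va, 'r) dmod \<Rightarrow> ('o, 'a, 'vo, 'r) dfun" where
  "dfun_id V M = \<lparr>FO = (\<lambda>x\<in>Ob M. x), FA = (\<lambda>f\<in>Ar M. f),
     FR = (\<lambda>as x y r. if as \<in> lists (Ob V) \<and> x \<in> Ob M \<and> y \<in> Ob M \<and> r \<in> RS M as x y
                      then r else undefined)\<rparr>"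

definition dfun_comp ::
  "('vo, 'va, 'z) oplax_scheme \<Rightarrow> ('o, 'a, 'vo, 'va, 'r) dmod \<Rightarrow>
   ('o, 'a, 'vo, 'r) dfun \<Rightarrow> ('o, 'a, 'vo, 'r) dfun \<Rightarrow> ('o, 'a, 'vo, 'r) dfun" where
  "dfun_comp V M G F = \<lparr>FO = (\<lambda>x\<in>Ob M. FO G (FO F x)), FA = (\<lambda>f\<in>Ar M. FA G (FA F f)),
     FR = (\<lambda>as x y r. if as \<in> lists (Ob V) \<and> x \<in> Ob M \<and> y \<in> Ob M \<and> r \<in> RS M as x y
                      then FR G as (FO F x) (FO F y) (FR F as x y r) else undefined)\<rparr>"

definition Delta_mod ::
  "('vo, 'va, 'z) oplax_scheme \<Rightarrow>
   (('o, 'a, 'vo, 'va, 'r) dmod, ('o, 'a, 'vo, 'r) dfun,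
    (('o, 'a, 'vo, 'r) dfun, 'o, 'a) cell) two_cat" where
  "Delta_mod V = \<lparr>
     Ob0 = {M. delta_module V M},
     HomC = (\<lambda>M N. cell_cat M N {F. oplax_functor V M N F} (delta_nat V M N)),
     Id1 = dfun_id V,
     Cmp1 = (\<lambda>M N L. dfun_comp V M),
     Cmp2 = (\<lambda>M N L. cell_hcomp M L (dfun_comp V M))\<rparr>"

definition Rep_delta_mod ::
  "('vo, 'va, 'z) oplax_scheme \<Rightarrow>
   (('o, 'a, 'vo, 'va, 'r) dmod, ('o, 'a, 'vo, 'r) dfun,
    (('o, 'a, 'vo, 'r) dfun, 'o, 'a) cell) two_cat" where
  "Rep_delta_mod V = full_sub (Delta_mod V) (right_representable V)"


section \<open>The 2-functor from enriched categories to \<open>\<V>\<close>-\<open>\<delta>\<close>modules\<close>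

text \<open>Since \<open>R\<^sup>n\<^sup>+\<^sup>1(\<^bold>a, x; y) = \<V>(\<omega>\<^sup>n(\<^bold>a), [x, y])\<close>, the type \<open>'va\<close> of arrows of \<open>\<V>\<close> also provides the
  elements of the sets \<open>R\<^sup>n\<close>: it plays the role of the universe of small sets, and contains
  all hom-sets of \<open>\<V>\<close>.\<close>

definition Phi_ob ::
  "('vo, 'va, 'z) oplax_scheme \<Rightarrow> ('o, 'a, 'vo, 'va) ecat \<Rightarrow> ('o, 'a, 'vo, 'va, 'va) dmod" where
  "Phi_ob V M = \<lparr>
     Ob = Ob M, Ar = Ar M, Dom = Dom M, Cod = Cod M, Idn = Idn M, Cmp = Cmp M,
     RS = (\<lambda>as x y. hom V (om V as) (HO M x y)),
     RA = (\<lambda>us f g r. HA M f g \<odot>\<^bsub>V\<^esub> r \<odot>\<^bsub>V\<^esub> omA V us),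
     al = (\<lambda>as bs cs x y r. r \<odot>\<^bsub>V\<^esub> ins V as bs cs),
     be = (\<lambda>as bs x m y r s.
             mu M x m y \<odot>\<^bsub>V\<^esub> omA V [r, s] \<odot>\<^bsub>V\<^esub> ins V [om V as] bs [] \<odot>\<^bsub>V\<^esub> ins V [] as bs),
     io = (\<lambda>f. HA M (Idn M (Dom M f)) f \<odot>\<^bsub>V\<^esub> eta M (Dom M f))\<rparr>"

definition Phi_1 ::
  "('vo, 'va, 'z) oplax_scheme \<Rightarrow> ('o, 'a, 'vo, 'va) ecat \<Rightarrow> ('o, 'a, 'va) efun \<Rightarrow>
   ('o, 'a, 'vo, 'va) dfun" where
  "Phi_1 V A F = \<lparr>FO = FO F, FA = FA F,
     FR = (\<lambda>as x y r. if as \<in> lists (Ob V) \<and> x \<in> Ob A \<and> y \<in> Ob A \<and> r \<in> hom V (om V as) (HO A x y)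
                      then FH F x y \<odot>\<^bsub>V\<^esub> r else undefined)\<rparr>"

definition Phi ::
  "('vo, 'va, 'z) oplax_scheme \<Rightarrow>
   (('o, 'a, 'vo, 'va) ecat, ('o, 'a, 'va) efun, (('o, 'a, 'va) efun, 'o, 'a) cell,
    ('o, 'a, 'vo, 'va, 'va) dmod, ('o, 'a, 'vo, 'va) dfun,
    (('o, 'a, 'vo, 'va) dfun, 'o, 'a) cell) two_func" where
  "Phi V = \<lparr>
     P0 = Phi_ob V,
     P1 = (\<lambda>A B. Phi_1 V A),
     P2 = (\<lambda>A B c. \<lparr>Src = Phi_1 V A (Src c), Tgt = Phi_1 V A (Tgt c), At = At c\<rparr>)\<rparr>"

end

(* A 2-functor that is bijective on 1-cells and 2-cells between any two objects, and hits every
   object up to a strictly invertible 1-cell, is a 2-equivalence; it remains to check this for the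
   2-functor at hand.

   Let u = cou [x, y], regarded as an element of V(\<omega>[[x, y]], [x, y]) = R([x, y], x; y). Naturality
   of the counit and the axiom cou_outer show that every element r of V(\<omega>(as), [x, y]) arises from
   u by restricting along \<omega>(r) and applying \<alpha>. Hence an oplax functor is determined by the images
   of the elements u, and since the counits are invertible, the image of u has the form
   F_{x,y} o cou for a unique F_{x,y}; the axioms for F_{x,y} are those of the oplax functor
   evaluated at universal elements.

   For a representable module M the maps \<phi>^p, called \<psi> below, are compatible with all R-actions
   and with \<alpha>. So one can define \<eta> by \<psi>(\<eta>_x) = \<iota>(1_x) and \<mu> by \<psi>(\<mu>) = \<beta>(u, u), and the same
   universality argument gives the formula for \<beta> in terms of \<mu>. The axioms of an enriched category
   then follow from those of M because \<psi> is injective. *)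

theory Submission
  imports Defs
begin

section \<open>Categories\<close>

text \<open>The difficulty is that the universal element lives over \<open>om V [HO M x y]\<close>
  and not over \<open>HO M x y\<close>. What an oplax functor or a representation yields is
  therefore always seen through a counit, and equations between elements become equations between
  arrows only once that counit has been cancelled. The same mismatch appears in \<beta>, whose
  formula packs both argument lists into blocks before \<mu> can be applied. The packing map
  \<open>split\<close> gets its own calculus, and the decisive identity is \<open>split_cou\<close>:
  on two singleton blocks, packing followed by both counits is the identity, so that \<beta> of two
  universal elements is \<mu> itself, with no insertion left over. On objects, strictness is
  available because the enriched category built from a module keeps the underlying category, and the
  comparison with the module is a family of bijections over the identity functor. This is why a
  strict inverse 1-cell exists, and why the inverse 2-functor can be defined by unique lifting of
  conjugates.\<close>

context category
begin

lemma Cmp_Ar [simp]: "f \<in> Ar C \<Longrightarrow> g \<in> Ar C \<Longrightarrow> Cod C f = Dom C g \<Longrightarrow> g \<odot> f \<in> Ar C"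
  and Dom_Cmp [simp]: "f \<in> Ar C \<Longrightarrow> g \<in> Ar C \<Longrightarrow> Cod C f = Dom C g \<Longrightarrow> Dom C (g \<odot> f) = Dom C f"
  and Cod_Cmp [simp]: "f \<in> Ar C \<Longrightarrow> g \<in> Ar C \<Longrightarrow> Cod C f = Dom C g \<Longrightarrow> Cod C (g \<odot> f) = Cod C g"
  using Cmp_hom[of f "Dom C f" "Cod C f" g "Cod C g"] by (auto simp: hom_def)

lemma Idn_Ar [simp]: "x \<in> Ob C \<Longrightarrow> Idn C x \<in> Ar C"
  and Dom_Idn [simp]: "x \<in> Ob C \<Longrightarrow> Dom C (Idn C x) = x"
  and Cod_Idn [simp]: "x \<in> Ob C \<Longrightarrow> Cod C (Idn C x) = x"
  using Idn_hom[of x] by (auto simp: hom_def)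

lemma Idn_Cmp [simp]: "f \<in> Ar C \<Longrightarrow> Cod C f = x \<Longrightarrow> Idn C x \<odot> f = f"
  and Cmp_Idn [simp]: "f \<in> Ar C \<Longrightarrow> Dom C f = x \<Longrightarrow> f \<odot> Idn C x = f"
  using Idn_left[of f] Idn_right[of f] by (auto simp: hom_def)

lemma Cmp_assoc' [simp]:
  "f \<in> Ar C \<Longrightarrow> g \<in> Ar C \<Longrightarrow> h \<in> Ar C \<Longrightarrow> Cod C f = Dom C g \<Longrightarrow> Cod C g = Dom C h \<Longrightarrow>
    (h \<odot> g) \<odot> f = h \<odot> g \<odot> f"
  using Cmp_assoc[of f "Dom C f" "Cod C f" g "Cod C g" h "Cod C h"] by (auto simp: hom_def)

declare Dom_in [simp] Cod_in [simp]

end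

lemma (in is_functor) Fa_Ar [simp]: "f \<in> Ar C \<Longrightarrow> Fa f \<in> Ar D"
  and Dom_Fa [simp]: "f \<in> Ar C \<Longrightarrow> Dom D (Fa f) = Fo (Dom C f)"
  and Cod_Fa [simp]: "f \<in> Ar C \<Longrightarrow> Cod D (Fa f) = Fo (Cod C f)"
  using Fa_hom[of f] by (auto simp: hom_def)

lemma (in bifunctor) Fa_Ar [simp]: "f \<in> Ar C \<Longrightarrow> g \<in> Ar D \<Longrightarrow> Fa f g \<in> Ar E"
  and Dom_Fa [simp]: "f \<in> Ar C \<Longrightarrow> g \<in> Ar D \<Longrightarrow> Dom E (Fa f g) = Fo (Dom C f) (Dom D g)"
  and Cod_Fa [simp]: "f \<in> Ar C \<Longrightarrow> g \<in> Ar D \<Longrightarrow> Cod E (Fa f g) = Fo (Cod C f) (Cod D g)"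
  using Fa_hom[of f g] by (auto simp: hom_def)

section \<open>Strict 2-categories\<close>

context two_category
begin

abbreviation Id2 where "Id2 A B u \<equiv> Idn (HomC T A B) u"

lemma Cmp1_in [simp]:
  assumes "A \<in> Ob0 T" "B \<in> Ob0 T" "C \<in> Ob0 T" "u \<in> Ob (HomC T A B)" "v \<in> Ob (HomC T B C)"
  shows "Cmp1 T A B C v u \<in> Ob (HomC T A C)"
  using bifunctor.Fo_in[OF Cmp_bifunctor] assms by simp

lemma Cmp2_in [simp]:
  assumes "A \<in> Ob0 T" "B \<in> Ob0 T" "C \<in> Ob0 T" "a \<in> Ar (HomC T A B)" "b \<in> Ar (HomC T B C)"
  shows "Cmp2 T A B C b a \<in> Ar (HomC T A C)"
    and "Dom (HomC T A C) (Cmp2 T A B C b a)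
      = Cmp1 T A B C (Dom (HomC T B C) b) (Dom (HomC T A B) a)"
    and "Cod (HomC T A C) (Cmp2 T A B C b a)
      = Cmp1 T A B C (Cod (HomC T B C) b) (Cod (HomC T A B) a)"
  using bifunctor.Fa_Ar[OF Cmp_bifunctor] bifunctor.Dom_Fa[OF Cmp_bifunctor]
    bifunctor.Cod_Fa[OF Cmp_bifunctor] assms by simp_all

lemma Cmp2_Id2 [simp]:
  assumes "A \<in> Ob0 T" "B \<in> Ob0 T" "C \<in> Ob0 T" "u \<in> Ob (HomC T A B)" "v \<in> Ob (HomC T B C)"
  shows "Cmp2 T A B C (Id2 B C v) (Id2 A B u) = Id2 A C (Cmp1 T A B C v u)"
  using bifunctor.Fa_Idn[OF Cmp_bifunctor] assms by simp

lemma Id2_in [simp]: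
  assumes "A \<in> Ob0 T" "B \<in> Ob0 T" "u \<in> Ob (HomC T A B)"
  shows "Id2 A B u \<in> Ar (HomC T A B)"
    "Dom (HomC T A B) (Id2 A B u) = u" "Cod (HomC T A B) (Id2 A B u) = u"
  using category.Idn_Ar[OF hom_category] category.Dom_Idn[OF hom_category]
    category.Cod_Idn[OF hom_category] assms by simp_all

lemma Dom2_in [simp]:
  assumes "A \<in> Ob0 T" "B \<in> Ob0 T" "a \<in> Ar (HomC T A B)"
  shows "Dom (HomC T A B) a \<in> Ob (HomC T A B)" "Cod (HomC T A B) a \<in> Ob (HomC T A B)"
  using category.Dom_in[OF hom_category] category.Cod_in[OF hom_category] assms by simp_all

declare Id1_in [simp] Cmp1_left [simp] Cmp1_right [simp] Cmp1_assoc [simp]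
  Cmp2_left [simp] Cmp2_right [simp] Cmp2_assoc [simp]

lemma Cmp1_cancel:
  assumes "A \<in> Ob0 T" "B \<in> Ob0 T" "C \<in> Ob0 T" "u \<in> Ob (HomC T A B)"
    "v \<in> Ob (HomC T B C)" "w \<in> Ob (HomC T C B)" "Cmp1 T B C B w v = Id1 T B"
  shows "Cmp1 T A C B w (Cmp1 T A B C v u) = u"
  using assms Cmp1_assoc[of A B C B u v w] by simp

lemma Cmp2_cancel:
  assumes "A \<in> Ob0 T" "B \<in> Ob0 T" "C \<in> Ob0 T" "a \<in> Ar (HomC T A B)"
    "v \<in> Ob (HomC T B C)" "w \<in> Ob (HomC T C B)" "Cmp1 T B C B w v = Id1 T B"
  shows "Cmp2 T A C B (Id2 C B w) (Cmp2 T A B C (Id2 B C v) a) = a"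
  using assms Cmp2_assoc[of A B C B a "Id2 B C v" "Id2 C B w"] by simp

lemma Cmp2_interchange:
  assumes "A \<in> Ob0 T" "B \<in> Ob0 T" "C \<in> Ob0 T"
    "a \<in> Ar (HomC T A B)" "a' \<in> Ar (HomC T A B)"
    "Dom (HomC T A B) a' = Cod (HomC T A B) a"
    "b \<in> Ar (HomC T B C)" "b' \<in> Ar (HomC T B C)"
    "Dom (HomC T B C) b' = Cod (HomC T B C) b"
  shows "Cmp2 T A B C (b' \<odot>\<^bsub>HomC T B C\<^esub> b) (a' \<odot>\<^bsub>HomC T A B\<^esub> a)
    = Cmp2 T A B C b' a' \<odot>\<^bsub>HomC T A C\<^esub> Cmp2 T A B C b a"
  using bifunctor.Fa_Cmp[OF Cmp_bifunctor] assms by simp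

lemma Cmp2_whisker_left:
  assumes "A \<in> Ob0 T" "B \<in> Ob0 T" "C \<in> Ob0 T"
    "a \<in> Ar (HomC T A B)" "a' \<in> Ar (HomC T A B)"
    "Dom (HomC T A B) a' = Cod (HomC T A B) a" "v \<in> Ob (HomC T B C)"
  shows "Cmp2 T A B C (Id2 B C v) (a' \<odot>\<^bsub>HomC T A B\<^esub> a)
    = Cmp2 T A B C (Id2 B C v) a' \<odot>\<^bsub>HomC T A C\<^esub> Cmp2 T A B C (Id2 B C v) a"
proof -
  \<comment> \<open>Supplies that the identity 2-cell of \<open>v\<close> is its own vertical
    composite, so that interchange specialises to whiskering.\<close>
  interpret category "HomC T B C" using assms hom_category by blast
  show ?thesis using assms Cmp2_interchange[of A B C a a' "Id2 B C v" "Id2 B C v"] by simp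
qed

lemma Cmp2_whisker_right:
  assumes "A \<in> Ob0 T" "B \<in> Ob0 T" "C \<in> Ob0 T" "u \<in> Ob (HomC T A B)"
    "b \<in> Ar (HomC T B C)" "b' \<in> Ar (HomC T B C)"
    "Dom (HomC T B C) b' = Cod (HomC T B C) b"
  shows "Cmp2 T A B C (b' \<odot>\<^bsub>HomC T B C\<^esub> b) (Id2 A B u)
    = Cmp2 T A B C b' (Id2 A B u) \<odot>\<^bsub>HomC T A C\<^esub> Cmp2 T A B C b (Id2 A B u)"
proof -
  interpret category "HomC T A B" using assms hom_category by blast
  show ?thesis using assms Cmp2_interchange[of A B C "Id2 A B u" "Id2 A B u" b b'] by simp
qed

end

text \<open>Every axiom is quantified over \<open>Ob0\<close> and the remaining fields are
  untouched, so shrinking \<open>Ob0\<close> preserves each of them.\<close>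

lemma two_category_full_sub:
  assumes "two_category T"
  shows "two_category (full_sub T P)"
  using assms unfolding two_category_def full_sub_def by simp

context two_functor
begin

lemma P1_in [simp]: "A \<in> Ob0 S \<Longrightarrow> B \<in> Ob0 S \<Longrightarrow> u \<in> Ob (HomC S A B) \<Longrightarrow>
    P1 P A B u \<in> Ob (HomC T (P0 P A) (P0 P B))"
  using is_functor.Fo_in[OF P_functor] by simp

lemma P2_in [simp]:
  assumes "A \<in> Ob0 S" "B \<in> Ob0 S" "a \<in> Ar (HomC S A B)"
  shows "P2 P A B a \<in> Ar (HomC T (P0 P A) (P0 P B))"
    and "Dom (HomC T (P0 P A) (P0 P B)) (P2 P A B a) = P1 P A B (Dom (HomC S A B) a)"
    and "Cod (HomC T (P0 P A) (P0 P B)) (P2 P A B a) = P1 P A B (Cod (HomC S A B) a)"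
  using is_functor.Fa_Ar[OF P_functor] is_functor.Dom_Fa[OF P_functor]
    is_functor.Cod_Fa[OF P_functor] assms by simp_all

lemma P2_Id2 [simp]:
  assumes "A \<in> Ob0 S" "B \<in> Ob0 S" "u \<in> Ob (HomC S A B)"
  shows "P2 P A B (S.Id2 A B u) = T.Id2 (P0 P A) (P0 P B) (P1 P A B u)"
  using is_functor.Fa_Idn[OF P_functor] assms by simp

lemma P2_Cmp [simp]:
  assumes "A \<in> Ob0 S" "B \<in> Ob0 S" "a \<in> Ar (HomC S A B)" "b \<in> Ar (HomC S A B)"
    "Cod (HomC S A B) a = Dom (HomC S A B) b"
  shows "P2 P A B (b \<odot>\<^bsub>HomC S A B\<^esub> a) = P2 P A B b \<odot>\<^bsub>HomC T (P0 P A) (P0 P B)\<^esub> P2 P A B a"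
  using is_functor.Fa_Cmp[OF P_functor] assms by simp

declare P0_in [simp] P1_Id1 [simp] P1_Cmp1 [simp] P2_Cmp2 [simp]

end

section \<open>Lifting along a 2-functor that is bijective on 1-cells and 2-cells\<close>

locale two_functor_local_iso = two_functor +
  assumes P1_bij: "A \<in> Ob0 S \<Longrightarrow> B \<in> Ob0 S \<Longrightarrow>
      bij_betw (P1 P A B) (Ob (HomC S A B)) (Ob (HomC T (P0 P A) (P0 P B)))"
    and P2_bij: "A \<in> Ob0 S \<Longrightarrow> B \<in> Ob0 S \<Longrightarrow>
      bij_betw (P2 P A B) (Ar (HomC S A B)) (Ar (HomC T (P0 P A) (P0 P B)))"
begin

definition inv1 where "inv1 A B = inv_into (Ob (HomC S A B)) (P1 P A B)"
definition inv2 where "inv2 A B = inv_into (Ar (HomC S A B)) (P2 P A B)"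

lemma inv1 [simp]:
  assumes "A \<in> Ob0 S" "B \<in> Ob0 S" "v \<in> Ob (HomC T (P0 P A) (P0 P B))"
  shows "inv1 A B v \<in> Ob (HomC S A B)" "P1 P A B (inv1 A B v) = v"
  using P1_bij[of A B] assms unfolding inv1_def bij_betw_def
  by (auto intro: inv_into_into f_inv_into_f)

lemma inv2 [simp]:
  assumes "A \<in> Ob0 S" "B \<in> Ob0 S" "v \<in> Ar (HomC T (P0 P A) (P0 P B))"
  shows "inv2 A B v \<in> Ar (HomC S A B)" "P2 P A B (inv2 A B v) = v"
  using P2_bij[of A B] assms unfolding inv2_def bij_betw_def
  by (auto intro: inv_into_into f_inv_into_f)

lemma P1_eqI:
  assumes "A \<in> Ob0 S" "B \<in> Ob0 S" "u \<in> Ob (HomC S A B)" "v \<in> Ob (HomC S A B)"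
    "P1 P A B u = P1 P A B v"
  shows "u = v"
  using P1_bij[of A B] assms unfolding bij_betw_def inj_on_def by blast

lemma P2_eqI:
  assumes "A \<in> Ob0 S" "B \<in> Ob0 S" "u \<in> Ar (HomC S A B)" "v \<in> Ar (HomC S A B)"
    "P2 P A B u = P2 P A B v"
  shows "u = v"
  using P2_bij[of A B] assms unfolding bij_betw_def inj_on_def by blast

text \<open>Let \<open>t B\<close> be a strictly invertible 1-cell from some
  \<open>P0 P (q B)\<close> to \<open>B\<close>, with inverse \<open>s B\<close>. The inverse
  2-functor sends a cell of \<open>T\<close> to the unique cell of \<open>S\<close> lying over its
  conjugate by \<open>s\<close> and \<open>t\<close>. As \<open>P\<close> is injective on 1-cells
  and 2-cells, every law for it may be checked after applying \<open>P\<close>, where adjacent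
  \<open>t\<close> and \<open>s\<close> cancel.\<close>

lemma two_equivalenceI:
  assumes ess: "\<And>B. B \<in> Ob0 T \<Longrightarrow>
    \<exists>A \<in> Ob0 S. \<exists>u \<in> Ob (HomC T (P0 P A) B). invertible1 T (P0 P A) B u"
  shows "two_equivalence S T P"
proof -
  \<comment> \<open>The membership of \<open>B\<close> sits inside the existential statement, so
    that choice yields total functions \<open>q\<close>, \<open>t\<close> and
    \<open>s\<close>.\<close>
  have "\<forall>B. \<exists>A u v. B \<in> Ob0 T \<longrightarrow> A \<in> Ob0 S \<and> u \<in> Ob (HomC T (P0 P A) B) \<and>
      v \<in> Ob (HomC T B (P0 P A)) \<and> Cmp1 T (P0 P A) B (P0 P A) v u = Id1 T (P0 P A) \<and>
      Cmp1 T B (P0 P A) B u v = Id1 T B"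
    using ess unfolding invertible1_def by blast
  then obtain q t s where qts: "\<And>B. B \<in> Ob0 T \<Longrightarrow> q B \<in> Ob0 S \<and> t B \<in> Ob (HomC T (P0 P (q B)) B) \<and>
      s B \<in> Ob (HomC T B (P0 P (q B))) \<and>
      Cmp1 T (P0 P (q B)) B (P0 P (q B)) (s B) (t B) = Id1 T (P0 P (q B)) \<and>
      Cmp1 T B (P0 P (q B)) B (t B) (s B) = Id1 T B"
    by metis
  have [simp]: "q B \<in> Ob0 S" "t B \<in> Ob (HomC T (P0 P (q B)) B)" "s B \<in> Ob (HomC T B (P0 P (q B)))"
    and st: "Cmp1 T (P0 P (q B)) B (P0 P (q B)) (s B) (t B) = Id1 T (P0 P (q B))"
    and ts: "Cmp1 T B (P0 P (q B)) B (t B) (s B) = Id1 T B" if "B \<in> Ob0 T" for B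
    using qts[OF that] by blast+
  have st1 [simp]: "Cmp1 T D B (P0 P (q B)) (s B) (Cmp1 T D (P0 P (q B)) B (t B) u) = u"
    if "B \<in> Ob0 T" "D \<in> Ob0 T" "u \<in> Ob (HomC T D (P0 P (q B)))" for B D u
    using that T.Cmp1_cancel[of D "P0 P (q B)" B u "t B" "s B"] st by simp
  have ts1 [simp]: "Cmp1 T D (P0 P (q B)) B (t B) (Cmp1 T D B (P0 P (q B)) (s B) u) = u"
    if "B \<in> Ob0 T" "D \<in> Ob0 T" "u \<in> Ob (HomC T D B)" for B D u
    using that T.Cmp1_cancel[of D B "P0 P (q B)" u "s B" "t B"] ts by simp
  have st2 [simp]: "Cmp2 T D B (P0 P (q B)) (T.Id2 B (P0 P (q B)) (s B))
      (Cmp2 T D (P0 P (q B)) B (T.Id2 (P0 P (q B)) B (t B)) a) = a"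
    if "B \<in> Ob0 T" "D \<in> Ob0 T" "a \<in> Ar (HomC T D (P0 P (q B)))" for B D a
    using that T.Cmp2_cancel[of D "P0 P (q B)" B a "t B" "s B"] st by simp
  have ts2 [simp]: "Cmp2 T D (P0 P (q B)) B (T.Id2 (P0 P (q B)) B (t B))
      (Cmp2 T D B (P0 P (q B)) (T.Id2 B (P0 P (q B)) (s B)) a) = a"
    if "B \<in> Ob0 T" "D \<in> Ob0 T" "a \<in> Ar (HomC T D B)" for B D a
    using that T.Cmp2_cancel[of D B "P0 P (q B)" a "s B" "t B"] ts by simp
  \<comment> \<open>Conjugation: from \<open>P0 P (q B)\<close> along \<open>t B\<close> to
    \<open>B\<close>, then the given cell, then back along \<open>s B'\<close>. The result lies
    between images of \<open>P\<close>, so \<open>inv1\<close> and \<open>inv2\<close> can lift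
    it.\<close>
  define c1 where "c1 B B' v = Cmp1 T (P0 P (q B)) B' (P0 P (q B')) (s B')
      (Cmp1 T (P0 P (q B)) B B' v (t B))" for B B' v
  define c2 where "c2 B B' b = Cmp2 T (P0 P (q B)) B' (P0 P (q B')) (T.Id2 B' (P0 P (q B')) (s B'))
      (Cmp2 T (P0 P (q B)) B B' b (T.Id2 (P0 P (q B)) B (t B)))" for B B' b
  define Q where "Q = \<lparr>P0 = q, P1 = (\<lambda>B B' v. inv1 (q B) (q B') (c1 B B' v)),
      P2 = (\<lambda>B B' b. inv2 (q B) (q B') (c2 B B' b))\<rparr>"
  have [simp]: "P0 Q = q" by (simp add: Q_def)
  have c1_in [simp]: "c1 B B' v \<in> Ob (HomC T (P0 P (q B)) (P0 P (q B')))"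
    if "B \<in> Ob0 T" "B' \<in> Ob0 T" "v \<in> Ob (HomC T B B')" for B B' v
    using that by (simp add: c1_def)
  have c2_in [simp]: "c2 B B' b \<in> Ar (HomC T (P0 P (q B)) (P0 P (q B')))"
      "Dom (HomC T (P0 P (q B)) (P0 P (q B'))) (c2 B B' b) = c1 B B' (Dom (HomC T B B') b)"
      "Cod (HomC T (P0 P (q B)) (P0 P (q B'))) (c2 B B' b) = c1 B B' (Cod (HomC T B B') b)"
    if "B \<in> Ob0 T" "B' \<in> Ob0 T" "b \<in> Ar (HomC T B B')" for B B' b
    using that by (simp_all add: c1_def c2_def)
  have Q1 [simp]: "P1 Q B B' v \<in> Ob (HomC S (q B) (q B'))"
      "P1 P (q B) (q B') (P1 Q B B' v) = c1 B B' v"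
    if "B \<in> Ob0 T" "B' \<in> Ob0 T" "v \<in> Ob (HomC T B B')" for B B' v
    using that by (simp_all add: Q_def)
  have Q2 [simp]: "P2 Q B B' b \<in> Ar (HomC S (q B) (q B'))"
      "P2 P (q B) (q B') (P2 Q B B' b) = c2 B B' b"
    if "B \<in> Ob0 T" "B' \<in> Ob0 T" "b \<in> Ar (HomC T B B')" for B B' b
    using that by (simp_all add: Q_def)
  \<comment> \<open>The endpoints of a lifted 2-cell are known only through their images, so they
    are identified by injectivity of \<open>P1\<close>.\<close>
  have Q2D [simp]: "Dom (HomC S (q B) (q B')) (P2 Q B B' b) = P1 Q B B' (Dom (HomC T B B') b)"
      "Cod (HomC S (q B) (q B')) (P2 Q B B' b) = P1 Q B B' (Cod (HomC T B B') b)"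
    if "B \<in> Ob0 T" "B' \<in> Ob0 T" "b \<in> Ar (HomC T B B')" for B B' b
    using that P2_in(2,3)[of "q B" "q B'" "P2 Q B B' b"]
    by (auto intro!: P1_eqI[of "q B" "q B'"])
  have Q: "two_functor T S Q"
  proof (intro two_functor.intro two_functor_axioms.intro)
    show "two_category T" "two_category S"
      using T.two_category_axioms S.two_category_axioms .
    fix B assume B: "B \<in> Ob0 T"
    show "P0 Q B \<in> Ob0 S" using B by simp
    show "P1 Q B B (Id1 T B) = Id1 S (P0 Q B)"
      using B by (auto intro!: P1_eqI[of "q B" "q B"] simp: c1_def st)
    fix B' assume B': "B' \<in> Ob0 T"
    show "is_functor (HomC T B B') (HomC S (P0 Q B) (P0 Q B')) (P1 Q B B') (P2 Q B B')"
    proof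
      interpret H: category "HomC T B B'" using B B' T.hom_category by blast
      interpret K: category "HomC S (q B) (q B')" using B B' S.hom_category by simp
      fix v assume v: "v \<in> Ob (HomC T B B')"
      show "P1 Q B B' v \<in> Ob (HomC S (P0 Q B) (P0 Q B'))" using B B' v by simp
      show "P2 Q B B' (T.Id2 B B' v) = S.Id2 (P0 Q B) (P0 Q B') (P1 Q B B' v)"
        using B B' v by (auto intro!: P2_eqI[of "q B" "q B'"] simp: c2_def c1_def)
    next
      fix a assume a: "a \<in> Ar (HomC T B B')"
      show "P2 Q B B' a \<in> hom (HomC S (P0 Q B) (P0 Q B')) (P1 Q B B' (Dom (HomC T B B') a))
          (P1 Q B B' (Cod (HomC T B B') a))"
        using B B' a by (simp add: hom_def)
      interpret H: category "HomC T B B'" using B B' T.hom_category by blast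
      interpret K: category "HomC S (q B) (q B')" using B B' S.hom_category by simp
      fix b assume b: "b \<in> Ar (HomC T B B')" "Dom (HomC T B B') b = Cod (HomC T B B') a"
      show "P2 Q B B' (b \<odot>\<^bsub>HomC T B B'\<^esub> a)
          = P2 Q B B' b \<odot>\<^bsub>HomC S (P0 Q B) (P0 Q B')\<^esub> P2 Q B B' a"
        using B B' a b
        by (auto intro!: P2_eqI[of "q B" "q B'"]
            simp: c2_def T.Cmp2_whisker_left T.Cmp2_whisker_right)
    qed
    fix C assume C: "C \<in> Ob0 T"
    {
      fix u v assume "u \<in> Ob (HomC T B B')" "v \<in> Ob (HomC T B' C)"
      then show "P1 Q B C (Cmp1 T B B' C v u)
          = Cmp1 S (P0 Q B) (P0 Q B') (P0 Q C) (P1 Q B' C v) (P1 Q B B' u)"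
        using B B' C by (auto intro!: P1_eqI[of "q B" "q C"] simp: c1_def)
    next
      fix a b assume "a \<in> Ar (HomC T B B')" "b \<in> Ar (HomC T B' C)"
      then show "P2 Q B C (Cmp2 T B B' C b a)
          = Cmp2 S (P0 Q B) (P0 Q B') (P0 Q C) (P2 Q B' C b) (P2 Q B B' a)"
        using B B' C by (auto intro!: P2_eqI[of "q B" "q C"] simp: c2_def)
    }
  qed
  \<comment> \<open>\<open>q (P0 P A)\<close> need not be \<open>A\<close>; the unit component is
    the lift of the isomorphism \<open>s (P0 P A)\<close>, and its inverse is the lift of
    \<open>t (P0 P A)\<close>.\<close>
  define \<sigma> where "\<sigma> A = inv1 A (q (P0 P A)) (s (P0 P A))" for A
  have \<sigma> [simp]: "\<sigma> A \<in> Ob (HomC S A (q (P0 P A)))" "P1 P A (q (P0 P A)) (\<sigma> A) = s (P0 P A)"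
    if "A \<in> Ob0 S" for A
    using that by (simp_all add: \<sigma>_def)
  have "two_natural_iso S S two_id (two_comp Q P) \<sigma>"
    unfolding two_natural_iso_def two_natural_def
  proof (intro conjI ballI)
    fix A assume A: "A \<in> Ob0 S"
    show "\<sigma> A \<in> Ob (HomC S (P0 two_id A) (P0 (two_comp Q P) A))"
      using A by (simp add: two_id_def two_comp_def)
    show "invertible1 S (P0 two_id A) (P0 (two_comp Q P) A) (\<sigma> A)"
      unfolding invertible1_def two_id_def two_comp_def
      by (rule bexI[of _ "inv1 (q (P0 P A)) A (t (P0 P A))"])
        (use A in \<open>auto intro: P1_eqI[of A A] P1_eqI[of "q (P0 P A)" "q (P0 P A)"] simp: st ts\<close>)
    fix B assume B: "B \<in> Ob0 S"
    {
      fix u assume u: "u \<in> Ob (HomC S A B)"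
      show "Cmp1 S (P0 two_id A) (P0 two_id B) (P0 (two_comp Q P) B) (\<sigma> B) (P1 two_id A B u)
          = Cmp1 S (P0 two_id A) (P0 (two_comp Q P) A) (P0 (two_comp Q P) B)
            (P1 (two_comp Q P) A B u) (\<sigma> A)"
        using A B u by (auto intro!: P1_eqI[of A "q (P0 P B)"]
            simp: two_id_def two_comp_def c1_def ts)
    next
      fix a assume a: "a \<in> Ar (HomC S A B)"
      show "Cmp2 S (P0 two_id A) (P0 two_id B) (P0 (two_comp Q P) B)
            (S.Id2 (P0 two_id B) (P0 (two_comp Q P) B) (\<sigma> B)) (P2 two_id A B a)
          = Cmp2 S (P0 two_id A) (P0 (two_comp Q P) A) (P0 (two_comp Q P) B)
            (P2 (two_comp Q P) A B a) (S.Id2 (P0 two_id A) (P0 (two_comp Q P) A) (\<sigma> A))"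
        using A B a by (auto intro!: P2_eqI[of A "q (P0 P B)"]
            simp: two_id_def two_comp_def c2_def ts)
    }
  qed
  \<comment> \<open>In \<open>T\<close> nothing has to be lifted: \<open>t\<close> is itself
    natural, since \<open>t B\<close> cancels the \<open>s B\<close> at the end of the
    conjugate.\<close>
  moreover have "two_natural_iso T T (two_comp P Q) two_id t"
    unfolding two_natural_iso_def two_natural_def
  proof (intro conjI ballI)
    fix A assume A: "A \<in> Ob0 T"
    show "t A \<in> Ob (HomC T (P0 (two_comp P Q) A) (P0 two_id A))"
      using A by (simp add: two_id_def two_comp_def)
    show "invertible1 T (P0 (two_comp P Q) A) (P0 two_id A) (t A)"
      unfolding invertible1_def two_id_def two_comp_def
      by (rule bexI[of _ "s A"]) (use A in \<open>auto simp: st ts\<close>)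
    fix B assume B: "B \<in> Ob0 T"
    {
      fix u assume u: "u \<in> Ob (HomC T A B)"
      show "Cmp1 T (P0 (two_comp P Q) A) (P0 (two_comp P Q) B) (P0 two_id B) (t B)
            (P1 (two_comp P Q) A B u)
          = Cmp1 T (P0 (two_comp P Q) A) (P0 two_id A) (P0 two_id B) (P1 two_id A B u) (t A)"
        using A B u by (auto simp: two_id_def two_comp_def c1_def ts)
    next
      fix a assume a: "a \<in> Ar (HomC T A B)"
      show "Cmp2 T (P0 (two_comp P Q) A) (P0 (two_comp P Q) B) (P0 two_id B)
            (T.Id2 (P0 (two_comp P Q) B) (P0 two_id B) (t B)) (P2 (two_comp P Q) A B a)
          = Cmp2 T (P0 (two_comp P Q) A) (P0 two_id A) (P0 two_id B)
            (P2 two_id A B a) (T.Id2 (P0 (two_comp P Q) A) (P0 two_id A) (t A))"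
        using A B a by (auto simp: two_id_def two_comp_def c2_def ts)
    }
  qed
  ultimately show ?thesis
    unfolding two_equivalence_def using two_functor_axioms Q by blast
qed

end

section \<open>2-categories of categories with extra structure\<close>

text \<open>Enriched categories and \<delta>-modules give 2-categories by the same argument: 1-cells
  are functors with data, and 2-cells are natural transformations subject to a condition
  \<open>Y\<close>. Isolated here is what depends on the data, namely closure of \<open>X\<close>
  and \<open>Y\<close> under the operations and the strict laws for 1-cells; the laws for 2-cells
  follow from their components.\<close>

locale cells =
  fixes Obs :: "('o, 'a, 'z) cat_scheme set"
    and X :: "('o, 'a, 'z) cat_scheme \<Rightarrow> ('o, 'a, 'z) cat_scheme \<Rightarrow> ('o, 'a, 'f) func_scheme set"
    and Y :: "('o, 'a, 'z) cat_scheme \<Rightarrow> ('o, 'a, 'z) cat_scheme \<Rightarrow>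
      ('o, 'a, 'f) func_scheme \<Rightarrow> ('o, 'a, 'f) func_scheme \<Rightarrow> ('o \<Rightarrow> 'a) \<Rightarrow> bool"
    and idf :: "('o, 'a, 'z) cat_scheme \<Rightarrow> ('o, 'a, 'f) func_scheme"
    and cmp :: "('o, 'a, 'z) cat_scheme \<Rightarrow>
      ('o, 'a, 'f) func_scheme \<Rightarrow> ('o, 'a, 'f) func_scheme \<Rightarrow> ('o, 'a, 'f) func_scheme"
  assumes Obs_category: "A \<in> Obs \<Longrightarrow> category A"
    and X_functor: "A \<in> Obs \<Longrightarrow> B \<in> Obs \<Longrightarrow> F \<in> X A B \<Longrightarrow> is_functor A B (FO F) (FA F)"
    and idf_in: "A \<in> Obs \<Longrightarrow> idf A \<in> X A A"
    and FO_idf: "FO (idf A) = (\<lambda>x\<in>Ob A. x)"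
    and FA_idf: "FA (idf A) = (\<lambda>f\<in>Ar A. f)"
    and cmp_in: "A \<in> Obs \<Longrightarrow> B \<in> Obs \<Longrightarrow> C \<in> Obs \<Longrightarrow> F \<in> X A B \<Longrightarrow> G \<in> X B C \<Longrightarrow>
      cmp A G F \<in> X A C"
    and FO_cmp: "FO (cmp A G F) = (\<lambda>x\<in>Ob A. FO G (FO F x))"
    and FA_cmp: "FA (cmp A G F) = (\<lambda>f\<in>Ar A. FA G (FA F f))"
    and cmp_left: "A \<in> Obs \<Longrightarrow> B \<in> Obs \<Longrightarrow> F \<in> X A B \<Longrightarrow> cmp A (idf B) F = F"
    and cmp_right: "A \<in> Obs \<Longrightarrow> B \<in> Obs \<Longrightarrow> F \<in> X A B \<Longrightarrow> cmp A F (idf A) = F"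
    and cmp_assoc: "A \<in> Obs \<Longrightarrow> B \<in> Obs \<Longrightarrow> C \<in> Obs \<Longrightarrow> D \<in> Obs \<Longrightarrow>
      F \<in> X A B \<Longrightarrow> G \<in> X B C \<Longrightarrow> H \<in> X C D \<Longrightarrow>
      cmp A (cmp B H G) F = cmp A H (cmp A G F)"
    and Y_id: "A \<in> Obs \<Longrightarrow> B \<in> Obs \<Longrightarrow> F \<in> X A B \<Longrightarrow> Y A B F F (\<lambda>x\<in>Ob A. Idn B (FO F x))"
    and Y_vert: "A \<in> Obs \<Longrightarrow> B \<in> Obs \<Longrightarrow> F \<in> X A B \<Longrightarrow> G \<in> X A B \<Longrightarrow> H \<in> X A B \<Longrightarrow>
      is_natural A B F G s \<Longrightarrow> Y A B F G s \<Longrightarrow> is_natural A B G H t \<Longrightarrow> Y A B G H t \<Longrightarrow>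
      Y A B F H (\<lambda>x\<in>Ob A. t x \<odot>\<^bsub>B\<^esub> s x)"
    and Y_horiz: "A \<in> Obs \<Longrightarrow> B \<in> Obs \<Longrightarrow> C \<in> Obs \<Longrightarrow> F \<in> X A B \<Longrightarrow> F' \<in> X A B \<Longrightarrow>
      G \<in> X B C \<Longrightarrow> G' \<in> X B C \<Longrightarrow>
      is_natural A B F F' s \<Longrightarrow> Y A B F F' s \<Longrightarrow> is_natural B C G G' t \<Longrightarrow> Y B C G G' t \<Longrightarrow>
      Y A C (cmp A G F) (cmp A G' F') (\<lambda>x\<in>Ob A. t (FO F' x) \<odot>\<^bsub>C\<^esub> FA G (s x))"
begin

definition cell_two_cat where
  "cell_two_cat = \<lparr>Ob0 = Obs, HomC = (\<lambda>A B. cell_cat A B (X A B) (Y A B)),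
     Id1 = idf, Cmp1 = (\<lambda>A B C. cmp A), Cmp2 = (\<lambda>A B C. cell_hcomp A C (cmp A))\<rparr>"

lemma natural_vert:
  assumes "A \<in> Obs" "B \<in> Obs" "F \<in> X A B" "G \<in> X A B" "H \<in> X A B"
    "is_natural A B F G s" "is_natural A B G H t"
  shows "is_natural A B F H (\<lambda>x\<in>Ob A. t x \<odot>\<^bsub>B\<^esub> s x)"
proof -
  interpret A: category A using assms Obs_category by blast
  interpret B: category B using assms Obs_category by blast
  interpret F: is_functor A B "FO F" "FA F" using assms X_functor by blast
  interpret G: is_functor A B "FO G" "FA G" using assms X_functor by blast
  interpret H: is_functor A B "FO H" "FA H" using assms X_functor by blast
  have s [simp]: "s x \<in> Ar B" "Dom B (s x) = FO F x" "Cod B (s x) = FO G x"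
    and t [simp]: "t x \<in> Ar B" "Dom B (t x) = FO G x" "Cod B (t x) = FO H x" if "x \<in> Ob A" for x
    using assms(6,7) that unfolding is_natural_def hom_def by auto
  have ns: "s (Cod A f) \<odot>\<^bsub>B\<^esub> FA F f = FA G f \<odot>\<^bsub>B\<^esub> s (Dom A f)"
    and nt: "t (Cod A f) \<odot>\<^bsub>B\<^esub> FA G f = FA H f \<odot>\<^bsub>B\<^esub> t (Dom A f)" if "f \<in> Ar A" for f
    using assms(6,7) that unfolding is_natural_def by auto
  have "t (Cod A f) \<odot>\<^bsub>B\<^esub> s (Cod A f) \<odot>\<^bsub>B\<^esub> FA F f
      = FA H f \<odot>\<^bsub>B\<^esub> t (Dom A f) \<odot>\<^bsub>B\<^esub> s (Dom A f)" if "f \<in> Ar A" for f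
  proof -
    have "t (Cod A f) \<odot>\<^bsub>B\<^esub> s (Cod A f) \<odot>\<^bsub>B\<^esub> FA F f
        = (t (Cod A f) \<odot>\<^bsub>B\<^esub> FA G f) \<odot>\<^bsub>B\<^esub> s (Dom A f)"
      using that by (simp add: ns)
    also have "\<dots> = FA H f \<odot>\<^bsub>B\<^esub> t (Dom A f) \<odot>\<^bsub>B\<^esub> s (Dom A f)"
      using that by (simp add: nt)
    finally show ?thesis .
  qed
  then show ?thesis
    unfolding is_natural_def by (simp add: hom_def)
qed

lemma natural_horiz:
  assumes "A \<in> Obs" "B \<in> Obs" "C \<in> Obs" "F \<in> X A B" "F' \<in> X A B" "G \<in> X B C" "G' \<in> X B C"
    "is_natural A B F F' s" "is_natural B C G G' t"
  shows "is_natural A C (cmp A G F) (cmp A G' F') (\<lambda>x\<in>Ob A. t (FO F' x) \<odot>\<^bsub>C\<^esub> FA G (s x))"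
proof -
  interpret A: category A using assms Obs_category by blast
  interpret B: category B using assms Obs_category by blast
  interpret C: category C using assms Obs_category by blast
  interpret F: is_functor A B "FO F" "FA F" using assms X_functor by blast
  interpret F': is_functor A B "FO F'" "FA F'" using assms X_functor by blast
  interpret G: is_functor B C "FO G" "FA G" using assms X_functor by blast
  interpret G': is_functor B C "FO G'" "FA G'" using assms X_functor by blast
  note F.Fo_in [simp] F'.Fo_in [simp]
  have s [simp]: "s x \<in> Ar B" "Dom B (s x) = FO F x" "Cod B (s x) = FO F' x" if "x \<in> Ob A" for x
    using assms(8) that unfolding is_natural_def hom_def by auto
  have t [simp]: "t x \<in> Ar C" "Dom C (t x) = FO G x" "Cod C (t x) = FO G' x" if "x \<in> Ob B" for x
    using assms(9) that unfolding is_natural_def hom_def by auto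
  have ns: "s (Cod A f) \<odot>\<^bsub>B\<^esub> FA F f = FA F' f \<odot>\<^bsub>B\<^esub> s (Dom A f)" if "f \<in> Ar A" for f
    using assms(8) that unfolding is_natural_def by auto
  have nt: "t (Cod B f) \<odot>\<^bsub>C\<^esub> FA G f = FA G' f \<odot>\<^bsub>C\<^esub> t (Dom B f)" if "f \<in> Ar B" for f
    using assms(9) that unfolding is_natural_def by auto
  have "t (FO F' (Cod A f)) \<odot>\<^bsub>C\<^esub> FA G (s (Cod A f)) \<odot>\<^bsub>C\<^esub> FA G (FA F f)
      = FA G' (FA F' f) \<odot>\<^bsub>C\<^esub> t (FO F' (Dom A f)) \<odot>\<^bsub>C\<^esub> FA G (s (Dom A f))" if "f \<in> Ar A" for f
  proof -
    have "t (FO F' (Cod A f)) \<odot>\<^bsub>C\<^esub> FA G (s (Cod A f)) \<odot>\<^bsub>C\<^esub> FA G (FA F f)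
        = t (FO F' (Cod A f)) \<odot>\<^bsub>C\<^esub> FA G (FA F' f) \<odot>\<^bsub>C\<^esub> FA G (s (Dom A f))"
      using that by (simp add: ns flip: G.Fa_Cmp)
    \<comment> \<open>The object is rewritten as a codomain so that naturality of \<open>t\<close>
      applies at the arrow \<open>FA F' f\<close>.\<close>
    also have "\<dots> = (t (Cod B (FA F' f)) \<odot>\<^bsub>C\<^esub> FA G (FA F' f)) \<odot>\<^bsub>C\<^esub> FA G (s (Dom A f))"
      using that by simp
    also have "\<dots> = FA G' (FA F' f) \<odot>\<^bsub>C\<^esub> t (FO F' (Dom A f)) \<odot>\<^bsub>C\<^esub> FA G (s (Dom A f))"
      using that by (simp only: nt F'.Fa_Ar) simp
    finally show ?thesis .
  qed
  then show ?thesis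
    unfolding is_natural_def by (simp add: hom_def FO_cmp FA_cmp)
qed

lemma category_cells:
  assumes "A \<in> Obs" "B \<in> Obs"
  shows "category (cell_cat A B (X A B) (Y A B))" (is "category ?K")
proof -
  interpret A: category A using assms Obs_category by blast
  interpret B: category B using assms Obs_category by blast
  have comp: "At c x \<in> Ar B" "Dom B (At c x) = FO (Src c) x" "Cod B (At c x) = FO (Tgt c) x"
    if "c \<in> Ar ?K" "x \<in> Ob A" for c x
    using that unfolding cell_cat_def is_natural_def hom_def by auto
  show ?thesis
  proof
    fix f assume "f \<in> Ar ?K"
    then show "Dom ?K f \<in> Ob ?K" "Cod ?K f \<in> Ob ?K" by (auto simp: cell_cat_def)
  next
    fix F assume F: "F \<in> Ob ?K"
    then interpret F: is_functor A B "FO F" "FA F"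
      using X_functor[OF assms] by (simp add: cell_cat_def)
    show "Idn ?K F \<in> hom ?K F F"
      using F Y_id[OF assms] by (auto simp: cell_cat_def hom_def is_natural_def F.Fo_in)
  next
    fix f g x y z assume "f \<in> hom ?K x y" "g \<in> hom ?K y z"
    then show "g \<odot>\<^bsub>?K\<^esub> f \<in> hom ?K x z"
      by (auto simp: cell_cat_def hom_def intro!: natural_vert[OF assms, where G = "Tgt f"] Y_vert[OF assms, where G = "Tgt f"])
  next
    fix f x y assume f: "f \<in> hom ?K x y"
    \<comment> \<open>Equality of cells compares \<open>At\<close> on the whole type; extensionality
      settles the arguments outside \<open>Ob A\<close>.\<close>
    have *: "At f v = undefined" if "v \<notin> Ob A" for v
      using f that by (auto simp: cell_cat_def hom_def extensional_def)
    have "f \<in> Ar ?K" using f by (simp add: hom_def)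
    from comp[OF this] show "Idn ?K y \<odot>\<^bsub>?K\<^esub> f = f" "f \<odot>\<^bsub>?K\<^esub> Idn ?K x = f"
      using f * by (auto simp: cell_cat_def hom_def intro!: cell.equality ext)
  next
    fix f g h w x y z assume "f \<in> hom ?K w x" "g \<in> hom ?K x y" "h \<in> hom ?K y z"
    moreover from this have "f \<in> Ar ?K" "g \<in> Ar ?K" "h \<in> Ar ?K" by (simp_all add: hom_def)
    note comp[OF this(1)] comp[OF this(2)] comp[OF this(3)]
    ultimately show "(h \<odot>\<^bsub>?K\<^esub> g) \<odot>\<^bsub>?K\<^esub> f = h \<odot>\<^bsub>?K\<^esub> g \<odot>\<^bsub>?K\<^esub> f"
      by (auto simp: cell_cat_def hom_def intro!: cell.equality ext)
  qed
qed

lemma bifunctor_cells: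
  assumes "A \<in> Obs" "B \<in> Obs" "C \<in> Obs"
  shows "bifunctor (cell_cat B C (X B C) (Y B C)) (cell_cat A B (X A B) (Y A B))
    (cell_cat A C (X A C) (Y A C)) (cmp A) (cell_hcomp A C (cmp A))"
    (is "bifunctor ?K ?L ?M _ _")
proof -
  interpret A: category A using assms Obs_category by blast
  interpret B: category B using assms Obs_category by blast
  interpret C: category C using assms Obs_category by blast
  show ?thesis
  proof
    fix G F assume "G \<in> Ob ?K" "F \<in> Ob ?L"
    then have G: "G \<in> X B C" and F: "F \<in> X A B" by (simp_all add: cell_cat_def)
    show "cmp A G F \<in> Ob ?M" using assms F G cmp_in by (simp add: cell_cat_def)
    interpret F: is_functor A B "FO F" "FA F" using assms F X_functor by blast
    interpret G: is_functor B C "FO G" "FA G" using assms G X_functor by blast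
    show "cell_hcomp A C (cmp A) (Idn ?K G) (Idn ?L F) = Idn ?M (cmp A G F)"
      by (auto simp: cell_cat_def cell_hcomp_def FO_cmp F.Fo_in G.Fo_in G.Fa_Idn
          intro!: cell.equality ext)
  next
    fix d c assume "d \<in> Ar ?K" "c \<in> Ar ?L"
    then show "cell_hcomp A C (cmp A) d c \<in> hom ?M (cmp A (Dom ?K d) (Dom ?L c))
        (cmp A (Cod ?K d) (Cod ?L c))"
      using assms
      by (auto simp: cell_cat_def cell_hcomp_def hom_def cmp_in[OF assms]
          intro!: natural_horiz[OF assms] Y_horiz[OF assms])
  next
    fix d d' c c' assume d: "d \<in> Ar ?K" "d' \<in> Ar ?K" "Dom ?K d' = Cod ?K d"
      and c: "c \<in> Ar ?L" "c' \<in> Ar ?L" "Dom ?L c' = Cod ?L c"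
    from c have cX: "Src c \<in> X A B" "Tgt c \<in> X A B" "Tgt c' \<in> X A B"
      and cN: "is_natural A B (Src c) (Tgt c) (At c)" "is_natural A B (Tgt c) (Tgt c') (At c')"
      by (auto simp: cell_cat_def)
    from d have dX: "Src d \<in> X B C" "Tgt d \<in> X B C" "Tgt d' \<in> X B C"
      and dN: "is_natural B C (Src d) (Tgt d) (At d)" "is_natural B C (Tgt d) (Tgt d') (At d')"
      by (auto simp: cell_cat_def)
    interpret F: is_functor A B "FO (Src c)" "FA (Src c)" using assms cX X_functor by blast
    interpret F': is_functor A B "FO (Tgt c)" "FA (Tgt c)" using assms cX X_functor by blast
    interpret F'': is_functor A B "FO (Tgt c')" "FA (Tgt c')" using assms cX X_functor by blast
    interpret G: is_functor B C "FO (Src d)" "FA (Src d)" using assms dX X_functor by blast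
    interpret G': is_functor B C "FO (Tgt d)" "FA (Tgt d)" using assms dX X_functor by blast
    interpret G'': is_functor B C "FO (Tgt d')" "FA (Tgt d')" using assms dX X_functor by blast
    note F.Fo_in [simp] F'.Fo_in [simp] F''.Fo_in [simp] G.Fo_in [simp] G'.Fo_in [simp]
    have [simp]: "At c x \<in> Ar B" "Dom B (At c x) = FO (Src c) x" "Cod B (At c x) = FO (Tgt c) x"
      "At c' x \<in> Ar B" "Dom B (At c' x) = FO (Tgt c) x" "Cod B (At c' x) = FO (Tgt c') x"
      if "x \<in> Ob A" for x
      using that cN unfolding is_natural_def hom_def by auto
    have [simp]: "At d x \<in> Ar C" "Dom C (At d x) = FO (Src d) x" "Cod C (At d x) = FO (Tgt d) x"
      "At d' x \<in> Ar C" "Dom C (At d' x) = FO (Tgt d) x" "Cod C (At d' x) = FO (Tgt d') x"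
      if "x \<in> Ob B" for x
      using that dN unfolding is_natural_def hom_def by auto
    have nat: "At d (Cod B f) \<odot>\<^bsub>C\<^esub> FA (Src d) f = FA (Tgt d) f \<odot>\<^bsub>C\<^esub> At d (Dom B f)"
      if "f \<in> Ar B" for f
      using that dN unfolding is_natural_def by auto
    \<comment> \<open>The one use of naturality in the interchange law: \<open>At d\<close> is moved
      past the component of \<open>c'\<close>.\<close>
    have *: "At d (FO (Tgt c') x) \<odot>\<^bsub>C\<^esub> FA (Src d) (At c' x) \<odot>\<^bsub>C\<^esub> FA (Src d) (At c x)
        = FA (Tgt d) (At c' x) \<odot>\<^bsub>C\<^esub> At d (FO (Tgt c) x) \<odot>\<^bsub>C\<^esub> FA (Src d) (At c x)"
      if x: "x \<in> Ob A" for x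
    proof -
      have "(At d (FO (Tgt c') x) \<odot>\<^bsub>C\<^esub> FA (Src d) (At c' x)) \<odot>\<^bsub>C\<^esub> FA (Src d) (At c x)
          = (FA (Tgt d) (At c' x) \<odot>\<^bsub>C\<^esub> At d (FO (Tgt c) x)) \<odot>\<^bsub>C\<^esub> FA (Src d) (At c x)"
        using x nat[of "At c' x"] by simp
      then show ?thesis using x by simp
    qed
    show "cell_hcomp A C (cmp A) (d' \<odot>\<^bsub>?K\<^esub> d) (c' \<odot>\<^bsub>?L\<^esub> c)
        = cell_hcomp A C (cmp A) d' c' \<odot>\<^bsub>?M\<^esub> cell_hcomp A C (cmp A) d c"
      using * d(3) c(3)
      by (auto simp: cell_cat_def cell_hcomp_def G.Fa_Cmp intro!: cell.equality ext)
  qed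
qed

lemma two_category_cells: "two_category cell_two_cat"
proof (rule two_category.intro)
  fix A assume "A \<in> Ob0 cell_two_cat"
  then show "Id1 cell_two_cat A \<in> Ob (HomC cell_two_cat A A)" using idf_in by (simp add: cell_two_cat_def cell_cat_def)
next
  fix A B assume A: "A \<in> Ob0 cell_two_cat" and B: "B \<in> Ob0 cell_two_cat"
  then have AO: "A \<in> Obs" "B \<in> Obs" by (simp_all add: cell_two_cat_def)
  then interpret A: category A using Obs_category by blast
  interpret B: category B using AO Obs_category by blast
  show "category (HomC cell_two_cat A B)" using AO category_cells by (simp add: cell_two_cat_def)
  fix u assume u: "u \<in> Ob (HomC cell_two_cat A B)"
  then show "Cmp1 cell_two_cat A B B (Id1 cell_two_cat B) u = u" "Cmp1 cell_two_cat A A B u (Id1 cell_two_cat A) = u"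
    using AO cmp_left cmp_right by (simp_all add: cell_two_cat_def cell_cat_def)
next
  fix A B assume A: "A \<in> Ob0 cell_two_cat" and B: "B \<in> Ob0 cell_two_cat"
  then have AO: "A \<in> Obs" "B \<in> Obs" by (simp_all add: cell_two_cat_def)
  then interpret A: category A using Obs_category by blast
  interpret B: category B using AO Obs_category by blast
  fix a assume a: "a \<in> Ar (HomC cell_two_cat A B)"
  then have aX: "Src a \<in> X A B" "Tgt a \<in> X A B" and aN: "is_natural A B (Src a) (Tgt a) (At a)"
    and ext: "At a \<in> extensional (Ob A)"
    by (auto simp: cell_two_cat_def cell_cat_def)
  interpret F: is_functor A B "FO (Src a)" "FA (Src a)" using AO aX X_functor by blast
  interpret F': is_functor A B "FO (Tgt a)" "FA (Tgt a)" using AO aX X_functor by blast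
  have [simp]: "At a x \<in> Ar B" "Dom B (At a x) = FO (Src a) x" "Cod B (At a x) = FO (Tgt a) x"
    if "x \<in> Ob A" for x
    using that aN unfolding is_natural_def hom_def by auto
  have [simp]: "At a x = undefined" if "x \<notin> Ob A" for x
    using ext that by (auto simp: extensional_def)
  show "Cmp2 cell_two_cat A B B (Idn (HomC cell_two_cat B B) (Id1 cell_two_cat B)) a = a"
    "Cmp2 cell_two_cat A A B a (Idn (HomC cell_two_cat A A) (Id1 cell_two_cat A)) = a"
    using AO aX
    by (auto simp: cell_two_cat_def cell_cat_def cell_hcomp_def FO_idf FA_idf cmp_left cmp_right
        F'.Fo_in F.Fo_in F.Fa_Idn intro!: cell.equality ext)
next
  fix A B C assume "A \<in> Ob0 cell_two_cat" "B \<in> Ob0 cell_two_cat" "C \<in> Ob0 cell_two_cat"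
  then show "bifunctor (HomC cell_two_cat B C) (HomC cell_two_cat A B) (HomC cell_two_cat A C) (Cmp1 cell_two_cat A B C) (Cmp2 cell_two_cat A B C)"
    using bifunctor_cells by (simp add: cell_two_cat_def)
next
  fix A B C D assume "A \<in> Ob0 cell_two_cat" "B \<in> Ob0 cell_two_cat" "C \<in> Ob0 cell_two_cat" "D \<in> Ob0 cell_two_cat"
  then have O: "A \<in> Obs" "B \<in> Obs" "C \<in> Obs" "D \<in> Obs" by (simp_all add: cell_two_cat_def)
  {
    fix u v w assume "u \<in> Ob (HomC cell_two_cat A B)" "v \<in> Ob (HomC cell_two_cat B C)" "w \<in> Ob (HomC cell_two_cat C D)"
    then show "Cmp1 cell_two_cat A B D (Cmp1 cell_two_cat B C D w v) u = Cmp1 cell_two_cat A C D w (Cmp1 cell_two_cat A B C v u)"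
      using O cmp_assoc[OF O] by (simp add: cell_two_cat_def cell_cat_def)
  next
    fix a b c
    assume a: "a \<in> Ar (HomC cell_two_cat A B)" and b: "b \<in> Ar (HomC cell_two_cat B C)" and c: "c \<in> Ar (HomC cell_two_cat C D)"
    then have aX: "Src a \<in> X A B" "Tgt a \<in> X A B" and aN: "is_natural A B (Src a) (Tgt a) (At a)"
      and bX: "Src b \<in> X B C" "Tgt b \<in> X B C" and bN: "is_natural B C (Src b) (Tgt b) (At b)"
      and cX: "Src c \<in> X C D" "Tgt c \<in> X C D" and cN: "is_natural C D (Src c) (Tgt c) (At c)"
      by (auto simp: cell_two_cat_def cell_cat_def)
    interpret A: category A using O Obs_category by blast
    interpret B: category B using O Obs_category by blast
    interpret C: category C using O Obs_category by blast
    interpret D: category D using O Obs_category by blast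
    interpret F: is_functor A B "FO (Src a)" "FA (Src a)" using O aX X_functor by blast
    interpret F': is_functor A B "FO (Tgt a)" "FA (Tgt a)" using O aX X_functor by blast
    interpret G: is_functor B C "FO (Src b)" "FA (Src b)" using O bX X_functor by blast
    interpret G': is_functor B C "FO (Tgt b)" "FA (Tgt b)" using O bX X_functor by blast
    interpret H: is_functor C D "FO (Src c)" "FA (Src c)" using O cX X_functor by blast
    interpret H': is_functor C D "FO (Tgt c)" "FA (Tgt c)" using O cX X_functor by blast
    have [simp]: "At a x \<in> Ar B" "Dom B (At a x) = FO (Src a) x" "Cod B (At a x) = FO (Tgt a) x"
      if "x \<in> Ob A" for x
      using that aN unfolding is_natural_def hom_def by auto
    have [simp]: "At b x \<in> Ar C" "Dom C (At b x) = FO (Src b) x" "Cod C (At b x) = FO (Tgt b) x"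
      if "x \<in> Ob B" for x
      using that bN unfolding is_natural_def hom_def by auto
    have [simp]: "At c x \<in> Ar D" "Dom D (At c x) = FO (Src c) x" "Cod D (At c x) = FO (Tgt c) x"
      if "x \<in> Ob C" for x
      using that cN unfolding is_natural_def hom_def by auto
    \<comment> \<open>The components agree once the functor underlying the source of
      \<open>c\<close> is distributed over the inner horizontal composite.\<close>
    show "Cmp2 cell_two_cat A B D (Cmp2 cell_two_cat B C D c b) a = Cmp2 cell_two_cat A C D c (Cmp2 cell_two_cat A B C b a)"
      using O aX bX cX cmp_assoc[OF O]
      by (auto simp: cell_two_cat_def cell_cat_def cell_hcomp_def F.Fo_in F'.Fo_in G.Fo_in G'.Fo_in
          FO_cmp FA_cmp H.Fa_Cmp intro!: cell.equality ext)
  }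
qed

end

section \<open>Oplax monoidal categories\<close>

context category
begin

text \<open>Composites are kept bracketed to the right, which hides \<open>g \<odot> f\<close>
  inside \<open>g \<odot> f \<odot> r\<close>. This turns an equation for a composite into a rewrite
  rule that works in front of a tail \<open>r\<close>.\<close>

lemma Cmp_reassoc:
  assumes "g \<odot> f = h" "f \<in> Ar C" "g \<in> Ar C" "r \<in> Ar C" "Cod C r = Dom C f" "Cod C f = Dom C g"
  shows "g \<odot> f \<odot> r = h \<odot> r"
  using assms Cmp_assoc' by metis

lemma lists_Idn [simp]: "as \<in> lists (Ob C) \<Longrightarrow> ids C as \<in> lists (Ar C)"
  and lists_Dom [simp]: "us \<in> lists (Ar C) \<Longrightarrow> map (Dom C) us \<in> lists (Ob C)"
  and lists_Cod [simp]: "us \<in> lists (Ar C) \<Longrightarrow> map (Cod C) us \<in> lists (Ob C)"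
  by (auto simp: in_lists_conv_set)

lemma map_Dom_Idn [simp]: "as \<in> lists (Ob C) \<Longrightarrow> map (Dom C \<circ> Idn C) as = as"
  and map_Cod_Idn [simp]: "as \<in> lists (Ob C) \<Longrightarrow> map (Cod C \<circ> Idn C) as = as"
  by (simp_all add: in_lists_conv_set map_idI)

end

lemma (in category) invertible_iso:
  assumes "invertible C f" "f \<in> Ar C"
  obtains g where "g \<in> Ar C" "Dom C g = Cod C f" "Cod C g = Dom C f"
    "g \<odot> f = Idn C (Dom C f)" "f \<odot> g = Idn C (Cod C f)"
  using assms unfolding invertible_def hom_def by auto

lemma (in category) invertible_epi:
  assumes "invertible C f" "f \<in> Ar C" "g \<in> Ar C" "h \<in> Ar C" "Dom C g = Cod C f" "Dom C h = Cod C f"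
    "g \<odot> f = h \<odot> f"
  shows "g = h"
proof -
  obtain k where k: "k \<in> Ar C" "Dom C k = Cod C f" "Cod C k = Dom C f" "f \<odot> k = Idn C (Cod C f)"
    using invertible_iso assms by metis
  have "(g \<odot> f) \<odot> k = (h \<odot> f) \<odot> k" using assms by simp
  then show ?thesis using assms(2-6) k by simp
qed

section \<open>Calculus of insertions and counits\<close>

context oplax_monoidal
begin

declare om_in [simp] omA_ids [simp]

lemma omA_Ar [simp]: "fs \<in> lists (Ar V) \<Longrightarrow> omA V fs \<in> Ar V"
  and Dom_omA [simp]: "fs \<in> lists (Ar V) \<Longrightarrow> Dom V (omA V fs) = om V (map (Dom V) fs)"
  and Cod_omA [simp]: "fs \<in> lists (Ar V) \<Longrightarrow> Cod V (omA V fs) = om V (map (Cod V) fs)"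
  using omA_hom[of fs] by (auto simp: hom_def)

lemma omA_Nil [simp]: "omA V [] = Idn V (om V [])"
  using omA_ids[of "[]"] by simp

lemma omA_Idn1 [simp]: "a \<in> Ob V \<Longrightarrow> omA V [Idn V a] = Idn V (om V [a])"
  using omA_ids[of "[a]"] by simp

lemma omA_Idn2 [simp]: "a \<in> Ob V \<Longrightarrow> b \<in> Ob V \<Longrightarrow> omA V [Idn V a, Idn V b] = Idn V (om V [a, b])"
  using omA_ids[of "[a, b]"] by simp

lemma omA_Cmp2: "f \<in> Ar V \<Longrightarrow> g \<in> Ar V \<Longrightarrow> Cod V f = Dom V g \<Longrightarrow>
    f' \<in> Ar V \<Longrightarrow> g' \<in> Ar V \<Longrightarrow> Cod V f' = Dom V g' \<Longrightarrow>
    omA V [g, g'] \<odot> omA V [f, f'] = omA V [g \<odot> f, g' \<odot> f']"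
  using omA_Cmp[of "[f, f']" "[g, g']"] by simp

lemma omA_Cmp2_assoc: "f \<in> Ar V \<Longrightarrow> g \<in> Ar V \<Longrightarrow> Cod V f = Dom V g \<Longrightarrow>
    f' \<in> Ar V \<Longrightarrow> g' \<in> Ar V \<Longrightarrow> Cod V f' = Dom V g' \<Longrightarrow>
    r \<in> Ar V \<Longrightarrow> Cod V r = om V [Dom V f, Dom V f'] \<Longrightarrow>
    omA V [g, g'] \<odot> omA V [f, f'] \<odot> r = omA V [g \<odot> f, g' \<odot> f'] \<odot> r"
  by (rule Cmp_reassoc[OF omA_Cmp2]) simp_all

lemma ins_Ar [simp]: "as \<in> lists (Ob V) \<Longrightarrow> bs \<in> lists (Ob V) \<Longrightarrow> cs \<in> lists (Ob V) \<Longrightarrow>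
      ins V as bs cs \<in> Ar V"
  and Dom_ins [simp]: "as \<in> lists (Ob V) \<Longrightarrow> bs \<in> lists (Ob V) \<Longrightarrow> cs \<in> lists (Ob V) \<Longrightarrow>
      Dom V (ins V as bs cs) = om V (as @ bs @ cs)"
  and Cod_ins [simp]: "as \<in> lists (Ob V) \<Longrightarrow> bs \<in> lists (Ob V) \<Longrightarrow> cs \<in> lists (Ob V) \<Longrightarrow>
      Cod V (ins V as bs cs) = om V (as @ om V bs # cs)"
  using ins_hom[of as bs cs] by (auto simp: hom_def)

lemma cou_Ar [simp]: "a \<in> Ob V \<Longrightarrow> cou V a \<in> Ar V"
  and Dom_cou [simp]: "a \<in> Ob V \<Longrightarrow> Dom V (cou V a) = om V [a]"
  and Cod_cou [simp]: "a \<in> Ob V \<Longrightarrow> Cod V (cou V a) = a"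
  using cou_hom[of a] by (auto simp: hom_def)

text \<open>For a hom object \<open>a\<close>, the left-hand side is the universal element
  restricted along \<open>r\<close> and then sent through \<alpha>; as a simp rule it contracts
  every such expansion.\<close>

lemma cou_single [simp]:
  assumes "r \<in> Ar V" "Dom V r = om V bs" "Cod V r = a" "bs \<in> lists (Ob V)"
  shows "cou V a \<odot> omA V [r] \<odot> ins V [] bs [] = r"
proof -
  have "cou V a \<odot> omA V [r] \<odot> ins V [] bs [] = r \<odot> cou V (om V bs) \<odot> ins V [] bs []"
    using assms Cmp_reassoc[OF cou_natural[of r], of "ins V [] bs []"] Cod_in[of r] by simp
  also have "\<dots> = r" using assms by (simp add: cou_outer)
  finally show ?thesis .
qed

text \<open>The comparison from \<open>om V (as @ bs)\<close> to the tensor product of the two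
  blocks that enters \<beta>. The left block is packed first; \<open>split_alt\<close> gives the
  other order, and the choice between them depends on the insertion to be moved or cancelled
  next.\<close>

definition split where "split as bs = ins V [om V as] bs [] \<odot> ins V [] as bs"

lemma split_Ar [simp]: "as \<in> lists (Ob V) \<Longrightarrow> bs \<in> lists (Ob V) \<Longrightarrow> split as bs \<in> Ar V"
  and Dom_split [simp]: "as \<in> lists (Ob V) \<Longrightarrow> bs \<in> lists (Ob V) \<Longrightarrow>
      Dom V (split as bs) = om V (as @ bs)"
  and Cod_split [simp]: "as \<in> lists (Ob V) \<Longrightarrow> bs \<in> lists (Ob V) \<Longrightarrow>
      Cod V (split as bs) = om V [om V as, om V bs]"
  by (simp_all add: split_def)

lemma split_alt:
  "as \<in> lists (Ob V) \<Longrightarrow> bs \<in> lists (Ob V) \<Longrightarrow>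
    split as bs = ins V [] as [om V bs] \<odot> ins V as bs []"
  using ins_parallel[of "[]" as "[]" bs "[]"] by (simp add: split_def)

lemma split_natural:
  assumes "us \<in> lists (Ar V)" "vs \<in> lists (Ar V)"
  shows "split (map (Cod V) us) (map (Cod V) vs) \<odot> omA V (us @ vs)
    = omA V [omA V us, omA V vs] \<odot> split (map (Dom V) us) (map (Dom V) vs)"
proof -
  have 1: "ins V [] (map (Cod V) us) (map (Cod V) vs) \<odot> omA V (us @ vs)
      = omA V (omA V us # vs) \<odot> ins V [] (map (Dom V) us) (map (Dom V) vs)"
    using ins_natural[of "[]" us vs] assms by simp
  have 2: "ins V [om V (map (Cod V) us)] (map (Cod V) vs) [] \<odot> omA V (omA V us # vs)
      = omA V [omA V us, omA V vs] \<odot> ins V [om V (map (Dom V) us)] (map (Dom V) vs) []"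
    using ins_natural[of "[omA V us]" vs "[]"] assms by simp
  show ?thesis using assms 1 Cmp_reassoc[OF 2] by (simp add: split_def)
qed

text \<open>Each counit undoes the packing of its own singleton by \<open>cou_inner\<close>: the
  right one meets the insertion applied last, and removing that insertion exposes the left
  one.\<close>

lemma split_cou:
  assumes "a \<in> Ob V" "b \<in> Ob V"
  shows "omA V [cou V a, cou V b] \<odot> split [a] [b] = Idn V (om V [a, b])"
proof -
  have "omA V [cou V a, cou V b] \<odot> split [a] [b]
      = omA V [cou V a, Idn V b] \<odot> omA V [Idn V (om V [a]), cou V b] \<odot> split [a] [b]"
    using assms by (simp add: omA_Cmp2_assoc)
  also have "\<dots> = omA V [cou V a, Idn V b] \<odot> ins V [] [a] [b]"
    using assms Cmp_reassoc[OF cou_inner[of "[om V [a]]" b "[]"]] by (simp add: split_def)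
  also have "\<dots> = Idn V (om V [a, b])"
    using assms cou_inner[of "[]" a "[b]"] by simp
  finally show ?thesis .
qed

text \<open>Naturality carries the insertion past the packing of \<open>ds\<close>, and
  \<open>ins_nested\<close> past the packing of its own block. This gives the compatibility of
  \<beta> with \<alpha> in its first argument.\<close>

lemma split_ins_left:
  assumes "as \<in> lists (Ob V)" "bs \<in> lists (Ob V)" "cs \<in> lists (Ob V)" "ds \<in> lists (Ob V)"
  shows "omA V [ins V as bs cs, Idn V (om V ds)] \<odot> split (as @ bs @ cs) ds
    = split (as @ om V bs # cs) ds \<odot> ins V as bs (cs @ ds)"
proof -
  have 1: "omA V [ins V as bs cs, Idn V (om V ds)] \<odot> ins V [om V (as @ bs @ cs)] ds []
      = ins V [om V (as @ om V bs # cs)] ds [] \<odot> omA V (ins V as bs cs # ids V ds)"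
    using ins_natural[of "[ins V as bs cs]" "ids V ds" "[]"] assms by simp
  have 2: "omA V (ins V as bs cs # ids V ds) \<odot> ins V [] (as @ bs @ cs) ds
      = ins V [] (as @ om V bs # cs) ds \<odot> ins V as bs (cs @ ds)"
    using ins_nested[of "[]" as bs cs ds] assms by simp
  show ?thesis using assms 2 Cmp_reassoc[OF 1] by (simp add: split_def)
qed

text \<open>Here the insertion meets the packing of its own block first, by
  \<open>ins_nested\<close>; it then lies in a slot disjoint from \<open>as\<close>, and
  \<open>ins_parallel\<close> applies.\<close>

lemma split_ins_right:
  assumes "as \<in> lists (Ob V)" "bs \<in> lists (Ob V)" "cs \<in> lists (Ob V)" "ds \<in> lists (Ob V)"
  shows "omA V [Idn V (om V as), ins V bs cs ds] \<odot> split as (bs @ cs @ ds)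
    = split as (bs @ om V cs # ds) \<odot> ins V (as @ bs) cs ds"
proof -
  have 1: "omA V [Idn V (om V as), ins V bs cs ds] \<odot> ins V [om V as] (bs @ cs @ ds) []
      = ins V [om V as] (bs @ om V cs # ds) [] \<odot> ins V (om V as # bs) cs ds"
    using ins_nested[of "[om V as]" bs cs ds "[]"] assms by simp
  have 2: "ins V (om V as # bs) cs ds \<odot> ins V [] as (bs @ cs @ ds)
      = ins V [] as (bs @ om V cs # ds) \<odot> ins V (as @ bs) cs ds"
    using ins_parallel[of "[]" as bs cs ds] assms by simp
  show ?thesis using assms 2 Cmp_reassoc[OF 1] by (simp add: split_def)
qed

text \<open>Packs three blocks from the left. Both bracketings of an iterated \<open>split\<close>
  factor through this map to the ternary product, which is where associativity of \<mu> is
  stated.\<close>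

definition split3 where
  "split3 as bs cs = ins V [om V as, om V bs] cs [] \<odot> ins V [om V as] bs cs \<odot> ins V [] as (bs @ cs)"

lemma split3_Ar [simp]:
  assumes "as \<in> lists (Ob V)" "bs \<in> lists (Ob V)" "cs \<in> lists (Ob V)"
  shows "split3 as bs cs \<in> Ar V" "Dom V (split3 as bs cs) = om V (as @ bs @ cs)"
    "Cod V (split3 as bs cs) = om V [om V as, om V bs, om V cs]"
  using assms by (simp_all add: split3_def)

lemma split_split_right:
  assumes "as \<in> lists (Ob V)" "bs \<in> lists (Ob V)" "cs \<in> lists (Ob V)"
  shows "omA V [Idn V (om V as), split bs cs] \<odot> split as (bs @ cs)
    = ins V [om V as] [om V bs, om V cs] [] \<odot> split3 as bs cs"
proof -
  have 1: "omA V [Idn V (om V as), ins V [] bs cs] \<odot> ins V [om V as] (bs @ cs) []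
      = ins V [om V as] (om V bs # cs) [] \<odot> ins V [om V as] bs cs"
    using ins_nested[of "[om V as]" "[]" bs cs "[]"] assms by simp
  have 2: "omA V [Idn V (om V as), ins V [om V bs] cs []] \<odot> ins V [om V as] (om V bs # cs) []
      = ins V [om V as] [om V bs, om V cs] [] \<odot> ins V [om V as, om V bs] cs []"
    using ins_nested[of "[om V as]" "[om V bs]" cs "[]" "[]"] assms by simp
  have "omA V [Idn V (om V as), split bs cs] \<odot> split as (bs @ cs)
      = omA V [Idn V (om V as), ins V [om V bs] cs []] \<odot>
        omA V [Idn V (om V as), ins V [] bs cs] \<odot> split as (bs @ cs)"
    using assms by (simp add: omA_Cmp2_assoc) (simp add: split_def)
  then show ?thesis
    using assms Cmp_reassoc[OF 1] Cmp_reassoc[OF 2] by (simp add: split_def split3_def)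
qed

text \<open>Rewritten with \<open>split_alt\<close>, since here the last block has to be packed
  before the other two; \<open>ins_parallel\<close> then brings the insertions into the order of
  \<open>split3\<close>.\<close>

lemma split_split_left:
  assumes "as \<in> lists (Ob V)" "bs \<in> lists (Ob V)" "cs \<in> lists (Ob V)"
  shows "omA V [split as bs, Idn V (om V cs)] \<odot> split (as @ bs) cs
    = ins V [] [om V as, om V bs] [om V cs] \<odot> split3 as bs cs"
proof -
  have 1: "omA V [ins V [] as bs, Idn V (om V cs)] \<odot> ins V [] (as @ bs) [om V cs]
      = ins V [] (om V as # bs) [om V cs] \<odot> ins V [] as (bs @ [om V cs])"
    using ins_nested[of "[]" "[]" as bs "[om V cs]"] assms by simp
  have 2: "omA V [ins V [om V as] bs [], Idn V (om V cs)] \<odot> ins V [] (om V as # bs) [om V cs]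
      = ins V [] [om V as, om V bs] [om V cs] \<odot> ins V [om V as] bs [om V cs]"
    using ins_nested[of "[]" "[om V as]" bs "[]" "[om V cs]"] assms by simp
  have 3: "ins V [] as (bs @ [om V cs]) \<odot> ins V (as @ bs) cs []
      = ins V (om V as # bs) cs [] \<odot> ins V [] as (bs @ cs)"
    using ins_parallel[of "[]" as bs cs "[]"] assms by simp
  have 4: "ins V [om V as] bs [om V cs] \<odot> ins V (om V as # bs) cs []
      = ins V [om V as, om V bs] cs [] \<odot> ins V [om V as] bs cs"
    using ins_parallel[of "[om V as]" bs "[]" cs "[]"] assms by simp
  have "omA V [split as bs, Idn V (om V cs)] \<odot> split (as @ bs) cs
      = omA V [ins V [om V as] bs [], Idn V (om V cs)] \<odot>
        omA V [ins V [] as bs, Idn V (om V cs)] \<odot> split (as @ bs) cs"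
    using assms by (simp add: omA_Cmp2_assoc) (simp add: split_def)
  then show ?thesis
    using assms Cmp_reassoc[OF 1] Cmp_reassoc[OF 2] 3 Cmp_reassoc[OF 4]
    by (simp add: split_alt split3_def)
qed

text \<open>Naturality of the insertion of the empty block moves \<open>r\<close> out of the tensor
  product. With a unit for \<open>x\<close>, the front becomes the composite in the left unit axiom
  of \<mu>, and the rest is the expansion that \<open>cou_single\<close> contracts.\<close>

lemma split_Nil_left:
  assumes "x \<in> Ar V" "Dom V x = om V []" "bs \<in> lists (Ob V)" "r \<in> Ar V" "Dom V r = om V bs"
  shows "omA V [x, r] \<odot> split [] bs
    = omA V [x, Idn V (Cod V r)] \<odot> ins V [] [] [Cod V r] \<odot> omA V [r] \<odot> ins V [] bs []"
proof -
  have 1: "ins V [] [] [Cod V r] \<odot> omA V [r] = omA V [Idn V (om V []), r] \<odot> ins V [] [] [om V bs]"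
    using ins_natural[of "[]" "[]" "[r]"] assms by simp
  show ?thesis using assms Cmp_reassoc[OF 1] by (simp add: omA_Cmp2_assoc split_alt)
qed

lemma split_Nil_right:
  assumes "x \<in> Ar V" "Dom V x = om V []" "as \<in> lists (Ob V)" "r \<in> Ar V" "Dom V r = om V as"
  shows "omA V [r, x] \<odot> split as []
    = omA V [Idn V (Cod V r), x] \<odot> ins V [Cod V r] [] [] \<odot> omA V [r] \<odot> ins V [] as []"
proof -
  have 1: "ins V [Cod V r] [] [] \<odot> omA V [r] = omA V [r, Idn V (om V [])] \<odot> ins V [om V as] [] []"
    using ins_natural[of "[r]" "[]" "[]"] assms by simp
  show ?thesis using assms Cmp_reassoc[OF 1] by (simp add: omA_Cmp2_assoc split_def)
qed

end

section \<open>The \<open>\<delta>\<close>-module of an enriched category\<close>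

locale enriched = V: oplax_monoidal V + M: enriched_category V M
  for V :: "('vo, 'va, 'z) oplax_scheme" and M :: "('o, 'a, 'vo, 'va) ecat"
begin

lemma HO_in [simp]: "x \<in> Ob M \<Longrightarrow> y \<in> Ob M \<Longrightarrow> HO M x y \<in> Ob V"
  using M.H.Fo_in by (simp add: opcat_def)

lemma HA_Ar [simp]: "f \<in> Ar M \<Longrightarrow> g \<in> Ar M \<Longrightarrow> HA M f g \<in> Ar V"
  and Dom_HA [simp]: "f \<in> Ar M \<Longrightarrow> g \<in> Ar M \<Longrightarrow> Dom V (HA M f g) = HO M (Cod M f) (Dom M g)"
  and Cod_HA [simp]: "f \<in> Ar M \<Longrightarrow> g \<in> Ar M \<Longrightarrow> Cod V (HA M f g) = HO M (Dom M f) (Cod M g)"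
  using M.H.Fa_hom[of f g] by (auto simp: opcat_def hom_def)

lemma HA_Idn [simp]: "x \<in> Ob M \<Longrightarrow> y \<in> Ob M \<Longrightarrow> HA M (Idn M x) (Idn M y) = Idn V (HO M x y)"
  using M.H.Fa_Idn by (simp add: opcat_def)

lemma HA_Cmp: "f \<in> Ar M \<Longrightarrow> f' \<in> Ar M \<Longrightarrow> Dom M f = Cod M f' \<Longrightarrow>
    g \<in> Ar M \<Longrightarrow> g' \<in> Ar M \<Longrightarrow> Dom M g' = Cod M g \<Longrightarrow>
    HA M f' g' \<odot>\<^bsub>V\<^esub> HA M f g = HA M (f \<odot>\<^bsub>M\<^esub> f') (g' \<odot>\<^bsub>M\<^esub> g)"
  using M.H.Fa_Cmp[of f f' g g'] by (simp add: opcat_def)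

lemma HA_Cmp_assoc: "f \<in> Ar M \<Longrightarrow> f' \<in> Ar M \<Longrightarrow> Dom M f = Cod M f' \<Longrightarrow>
    g \<in> Ar M \<Longrightarrow> g' \<in> Ar M \<Longrightarrow> Dom M g' = Cod M g \<Longrightarrow>
    r \<in> Ar V \<Longrightarrow> Cod V r = HO M (Cod M f) (Dom M g) \<Longrightarrow>
    HA M f' g' \<odot>\<^bsub>V\<^esub> HA M f g \<odot>\<^bsub>V\<^esub> r = HA M (f \<odot>\<^bsub>M\<^esub> f') (g' \<odot>\<^bsub>M\<^esub> g) \<odot>\<^bsub>V\<^esub> r"
  by (rule V.Cmp_reassoc[OF HA_Cmp]) simp_all

lemma eta_Ar [simp]: "x \<in> Ob M \<Longrightarrow> eta M x \<in> Ar V"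
  and Dom_eta [simp]: "x \<in> Ob M \<Longrightarrow> Dom V (eta M x) = om V []"
  and Cod_eta [simp]: "x \<in> Ob M \<Longrightarrow> Cod V (eta M x) = HO M x x"
  using M.eta_hom[of x] by (auto simp: hom_def)

lemma mu_Ar [simp]: "x \<in> Ob M \<Longrightarrow> y \<in> Ob M \<Longrightarrow> z \<in> Ob M \<Longrightarrow> mu M x y z \<in> Ar V"
  and Dom_mu [simp]: "x \<in> Ob M \<Longrightarrow> y \<in> Ob M \<Longrightarrow> z \<in> Ob M \<Longrightarrow>
      Dom V (mu M x y z) = om V [HO M y z, HO M x y]"
  and Cod_mu [simp]: "x \<in> Ob M \<Longrightarrow> y \<in> Ob M \<Longrightarrow> z \<in> Ob M \<Longrightarrow> Cod V (mu M x y z) = HO M x z"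
  using M.mu_hom[of x y z] by (auto simp: hom_def)

lemma eta_extranatural: "f \<in> Ar M \<Longrightarrow>
    HA M (Idn M (Dom M f)) f \<odot>\<^bsub>V\<^esub> eta M (Dom M f) = HA M f (Idn M (Cod M f)) \<odot>\<^bsub>V\<^esub> eta M (Cod M f)"
  using M.eta_extranatural by (simp add: hom_def)

lemma mu_natural: "f \<in> Ar M \<Longrightarrow> y \<in> Ob M \<Longrightarrow> g \<in> Ar M \<Longrightarrow>
    mu M (Dom M f) y (Cod M g) \<odot>\<^bsub>V\<^esub> omA V [HA M (Idn M y) g, HA M f (Idn M y)]
      = HA M f g \<odot>\<^bsub>V\<^esub> mu M (Cod M f) y (Dom M g)"
  using M.mu_natural by (simp add: hom_def)

lemma mu_extranatural: "x \<in> Ob M \<Longrightarrow> h \<in> Ar M \<Longrightarrow> z \<in> Ob M \<Longrightarrow>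
    mu M x (Dom M h) z \<odot>\<^bsub>V\<^esub> omA V [HA M h (Idn M z), Idn V (HO M x (Dom M h))]
      = mu M x (Cod M h) z \<odot>\<^bsub>V\<^esub> omA V [Idn V (HO M (Cod M h) z), HA M (Idn M x) h]"
  using M.mu_extranatural by (simp add: hom_def)

lemma mu_natural_Cmp:
  assumes "f \<in> Ar M" "y \<in> Ob M" "g \<in> Ar M" "r \<in> Ar V" "s \<in> Ar V"
    "Cod V r = HO M y (Dom M g)" "Cod V s = HO M (Cod M f) y"
  shows "mu M (Dom M f) y (Cod M g) \<odot>\<^bsub>V\<^esub> omA V [HA M (Idn M y) g \<odot>\<^bsub>V\<^esub> r, HA M f (Idn M y) \<odot>\<^bsub>V\<^esub> s]
    = HA M f g \<odot>\<^bsub>V\<^esub> mu M (Cod M f) y (Dom M g) \<odot>\<^bsub>V\<^esub> omA V [r, s]"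
  using assms V.Cmp_reassoc[OF mu_natural[of f y g], of "omA V [r, s]"]
  by (simp add: V.omA_Cmp2)

lemma mu_extranatural_Cmp:
  assumes "x \<in> Ob M" "h \<in> Ar M" "z \<in> Ob M" "r \<in> Ar V" "s \<in> Ar V"
    "Cod V r = HO M (Cod M h) z" "Cod V s = HO M x (Dom M h)"
  shows "mu M x (Dom M h) z \<odot>\<^bsub>V\<^esub> omA V [HA M h (Idn M z) \<odot>\<^bsub>V\<^esub> r, s]
    = mu M x (Cod M h) z \<odot>\<^bsub>V\<^esub> omA V [r, HA M (Idn M x) h \<odot>\<^bsub>V\<^esub> s]"
  using assms V.Cmp_reassoc[OF mu_extranatural[of x h z], of "omA V [r, s]"]
  by (simp add: V.omA_Cmp2)

lemma Phi_ob_sel [simp]: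
  "Ob (Phi_ob V M) = Ob M" "Ar (Phi_ob V M) = Ar M" "Dom (Phi_ob V M) = Dom M"
  "Cod (Phi_ob V M) = Cod M" "Idn (Phi_ob V M) = Idn M" "Cmp (Phi_ob V M) = Cmp M"
  "RS (Phi_ob V M) as x y = hom V (om V as) (HO M x y)"
  "RA (Phi_ob V M) us f g r = HA M f g \<odot>\<^bsub>V\<^esub> r \<odot>\<^bsub>V\<^esub> omA V us"
  "al (Phi_ob V M) as bs cs x y r = r \<odot>\<^bsub>V\<^esub> ins V as bs cs"
  "be (Phi_ob V M) as bs x m y r s = mu M x m y \<odot>\<^bsub>V\<^esub> omA V [r, s] \<odot>\<^bsub>V\<^esub> V.split as bs"
  "io (Phi_ob V M) f = HA M (Idn M (Dom M f)) f \<odot>\<^bsub>V\<^esub> eta M (Dom M f)"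
  by (simp_all add: Phi_ob_def V.split_def)

lemma hom_Phi_ob [simp]: "hom (Phi_ob V M) x y = hom M x y"
  by (simp add: hom_def)

lemma category_Phi_ob: "category (Phi_ob V M)"
  using M.category_axioms unfolding category_def hom_def by simp

lemma mu_unit_left:
  assumes "x \<in> Ob M" "y \<in> Ob M" "r \<in> Ar V" "Dom V r = om V bs" "bs \<in> lists (Ob V)"
    "Cod V r = HO M x y"
  shows "mu M x y y \<odot>\<^bsub>V\<^esub> omA V [eta M y, r] \<odot>\<^bsub>V\<^esub> V.split [] bs = r"
proof -
  have 1: "(mu M x y y \<odot>\<^bsub>V\<^esub> omA V [eta M y, Idn V (HO M x y)]) \<odot>\<^bsub>V\<^esub> ins V [] [] [HO M x y]
      = cou V (HO M x y)"
    using M.mu_eta_left[of x y] assms by simp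
  show ?thesis
    using assms V.Cmp_reassoc[OF 1, of "omA V [r] \<odot>\<^bsub>V\<^esub> ins V [] bs []"]
    by (simp add: V.split_Nil_left[OF _ _ _ assms(3,4)])
qed

lemma mu_unit_right:
  assumes "x \<in> Ob M" "y \<in> Ob M" "r \<in> Ar V" "Dom V r = om V as" "as \<in> lists (Ob V)"
    "Cod V r = HO M x y"
  shows "mu M x x y \<odot>\<^bsub>V\<^esub> omA V [r, eta M x] \<odot>\<^bsub>V\<^esub> V.split as [] = r"
proof -
  have 1: "(mu M x x y \<odot>\<^bsub>V\<^esub> omA V [Idn V (HO M x y), eta M x]) \<odot>\<^bsub>V\<^esub> ins V [HO M x y] [] []
      = cou V (HO M x y)"
    using M.mu_eta_right[of x y] assms by simp
  show ?thesis
    using assms V.Cmp_reassoc[OF 1, of "omA V [r] \<odot>\<^bsub>V\<^esub> ins V [] as []"]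
    by (simp add: V.split_Nil_right[OF _ _ _ assms(3,4)])
qed

text \<open>Each side is one of the composites in \<open>mu_assoc\<close> preceded by
  \<open>omA V [r, s, t]\<close> and \<open>split3\<close>: naturality of the ternary insertions
  pulls the three arrows out, and \<open>split_split_right\<close> and
  \<open>split_split_left\<close> supply the common tail.\<close>

lemma mu_assoc_Cmp:
  assumes "w \<in> Ob M" "x \<in> Ob M" "y \<in> Ob M" "z \<in> Ob M"
    "r \<in> Ar V" "s \<in> Ar V" "t \<in> Ar V" "Cod V r = HO M y z" "Cod V s = HO M x y" "Cod V t = HO M w x"
    "Dom V r = om V as" "Dom V s = om V bs" "Dom V t = om V cs"
    and [simp]: "as \<in> lists (Ob V)" "bs \<in> lists (Ob V)" "cs \<in> lists (Ob V)"
  shows "mu M w y z \<odot>\<^bsub>V\<^esub> omA V [r, mu M w x y \<odot>\<^bsub>V\<^esub> omA V [s, t] \<odot>\<^bsub>V\<^esub> V.split bs cs] \<odot>\<^bsub>V\<^esub>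
      V.split as (bs @ cs)
    = mu M w x z \<odot>\<^bsub>V\<^esub> omA V [mu M x y z \<odot>\<^bsub>V\<^esub> omA V [r, s] \<odot>\<^bsub>V\<^esub> V.split as bs, t] \<odot>\<^bsub>V\<^esub>
      V.split (as @ bs) cs"
proof -
  note [simp] = assms(1-13)
  have 1: "ins V [HO M y z] [HO M x y, HO M w x] [] \<odot>\<^bsub>V\<^esub> omA V [r, s, t]
      = omA V [r, omA V [s, t]] \<odot>\<^bsub>V\<^esub> ins V [om V as] [om V bs, om V cs] []"
    using V.ins_natural[of "[r]" "[s, t]" "[]"] by simp
  have 2: "ins V [] [HO M y z, HO M x y] [HO M w x] \<odot>\<^bsub>V\<^esub> omA V [r, s, t]
      = omA V [omA V [r, s], t] \<odot>\<^bsub>V\<^esub> ins V [] [om V as, om V bs] [om V cs]"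
    using V.ins_natural[of "[]" "[r, s]" "[t]"] by simp
  have "mu M w y z \<odot>\<^bsub>V\<^esub> omA V [r, mu M w x y \<odot>\<^bsub>V\<^esub> omA V [s, t] \<odot>\<^bsub>V\<^esub> V.split bs cs] \<odot>\<^bsub>V\<^esub>
      V.split as (bs @ cs)
    = mu M w y z \<odot>\<^bsub>V\<^esub> omA V [Idn V (HO M y z), mu M w x y] \<odot>\<^bsub>V\<^esub> omA V [r, omA V [s, t]] \<odot>\<^bsub>V\<^esub>
      omA V [Idn V (om V as), V.split bs cs] \<odot>\<^bsub>V\<^esub> V.split as (bs @ cs)"
    by (simp add: V.omA_Cmp2_assoc)
  also have "\<dots> = mu M w y z \<odot>\<^bsub>V\<^esub> omA V [Idn V (HO M y z), mu M w x y] \<odot>\<^bsub>V\<^esub>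
      ins V [HO M y z] [HO M x y, HO M w x] [] \<odot>\<^bsub>V\<^esub> omA V [r, s, t] \<odot>\<^bsub>V\<^esub> V.split3 as bs cs"
    using V.Cmp_reassoc[OF 1, of "V.split3 as bs cs"] by (simp add: V.split_split_right)
  also have "\<dots> = (mu M w y z \<odot>\<^bsub>V\<^esub> omA V [Idn V (HO M y z), mu M w x y] \<odot>\<^bsub>V\<^esub>
      ins V [HO M y z] [HO M x y, HO M w x] []) \<odot>\<^bsub>V\<^esub> omA V [r, s, t] \<odot>\<^bsub>V\<^esub> V.split3 as bs cs"
    by simp
  \<comment> \<open>The previous step bracketed the front exactly as in \<open>mu_assoc\<close>, so
    it can be exchanged as one block.\<close>
  also have "\<dots> = (mu M w x z \<odot>\<^bsub>V\<^esub> omA V [mu M x y z, Idn V (HO M w x)] \<odot>\<^bsub>V\<^esub>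
      ins V [] [HO M y z, HO M x y] [HO M w x]) \<odot>\<^bsub>V\<^esub> omA V [r, s, t] \<odot>\<^bsub>V\<^esub> V.split3 as bs cs"
    by (simp only: M.mu_assoc assms(1-4))
  also have "\<dots> = mu M w x z \<odot>\<^bsub>V\<^esub> omA V [mu M x y z, Idn V (HO M w x)] \<odot>\<^bsub>V\<^esub> omA V [omA V [r, s], t] \<odot>\<^bsub>V\<^esub>
      omA V [V.split as bs, Idn V (om V cs)] \<odot>\<^bsub>V\<^esub> V.split (as @ bs) cs"
    using V.Cmp_reassoc[OF 2, of "V.split3 as bs cs"] by (simp add: V.split_split_left)
  also have "\<dots> = mu M w x z \<odot>\<^bsub>V\<^esub> omA V [mu M x y z \<odot>\<^bsub>V\<^esub> omA V [r, s] \<odot>\<^bsub>V\<^esub> V.split as bs, t] \<odot>\<^bsub>V\<^esub>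
      V.split (as @ bs) cs"
    by (simp add: V.omA_Cmp2_assoc)
  finally show ?thesis .
qed

text \<open>The axioms about \<alpha> alone come from those of \<open>ins\<close> and
  \<open>cou\<close> in \<open>V\<close>. Those about \<beta> reduce to the lemmas on
  \<open>split\<close> together with naturality, extranaturality, associativity and unit laws of
  \<mu>, and naturality of \<iota> reduces to extranaturality of \<open>eta\<close>.\<close>

lemma delta_module_Phi_ob: "delta_module V (Phi_ob V M)"
proof (intro delta_module.intro delta_module_axioms.intro, goal_cases)
  case 1
  show ?case by (rule category_Phi_ob)
next
  case (2 us f g r)
  then show ?case by (simp add: hom_def)
next
  case (3 as x y r)
  then show ?case by (simp add: hom_def)
next
  case (4 us us' f f' g g' r)
  then show ?case
    using HA_Cmp_assoc[of f f' g g' "r \<odot>\<^bsub>V\<^esub> omA V us \<odot>\<^bsub>V\<^esub> omA V us'"]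
    by (simp add: hom_def V.omA_Cmp)
next
  case (5 as bs cs x y r)
  then show ?case by (simp add: hom_def)
next
  case (6 us vs ws f g r)
  then show ?case using V.ins_natural[of us vs ws] by (simp add: hom_def)
next
  case (7 as bs x m y r s)
  then show ?case by (simp add: hom_def)
next
  case (8 us vs f m g r s)
  have "omA V [r \<odot>\<^bsub>V\<^esub> omA V us, s \<odot>\<^bsub>V\<^esub> omA V vs] \<odot>\<^bsub>V\<^esub> V.split (map (Dom V) us) (map (Dom V) vs)
      = omA V [r, s] \<odot>\<^bsub>V\<^esub> V.split (map (Cod V) us) (map (Cod V) vs) \<odot>\<^bsub>V\<^esub> omA V (us @ vs)"
    using 8 V.split_natural[of us vs]
      V.omA_Cmp2_assoc[of "omA V us" r "omA V vs" s "V.split (map (Dom V) us) (map (Dom V) vs)"]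
    by (simp add: hom_def)
  moreover have "mu M (Dom M f) m (Cod M g) \<odot>\<^bsub>V\<^esub> omA V [HA M (Idn M m) g \<odot>\<^bsub>V\<^esub> r \<odot>\<^bsub>V\<^esub> omA V us,
        HA M f (Idn M m) \<odot>\<^bsub>V\<^esub> s \<odot>\<^bsub>V\<^esub> omA V vs]
      = HA M f g \<odot>\<^bsub>V\<^esub> mu M (Cod M f) m (Dom M g) \<odot>\<^bsub>V\<^esub> omA V [r \<odot>\<^bsub>V\<^esub> omA V us, s \<odot>\<^bsub>V\<^esub> omA V vs]"
    using 8 by (intro mu_natural_Cmp) (simp_all add: hom_def)
  note V.Cmp_reassoc[OF this, of "V.split (map (Dom V) us) (map (Dom V) vs)"]
  ultimately show ?case using 8 by (simp add: hom_def)
next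
  case (9 as bs x y h m m' r s)
  then have "mu M x (Dom M h) y \<odot>\<^bsub>V\<^esub> omA V [HA M h (Idn M y) \<odot>\<^bsub>V\<^esub> r, s]
      = mu M x (Cod M h) y \<odot>\<^bsub>V\<^esub> omA V [r, HA M (Idn M x) h \<odot>\<^bsub>V\<^esub> s]"
    by (intro mu_extranatural_Cmp) (simp_all add: hom_def)
  note V.Cmp_reassoc[OF this, of "V.split as bs"]
  then show ?case using 9 M.Dom_in[of h] M.Cod_in[of h] by (simp add: hom_def)
next
  case (10 f)
  then show ?case by (simp add: hom_def)
next
  case (11 f k g)
  \<comment> \<open>\<open>f\<close> acts covariantly in \<iota> of the composite but
    contravariantly in the module action; extranaturality of \<open>eta\<close> switches the
    slot.\<close>
  have "HA M (Idn M (Dom M f)) (g \<odot>\<^bsub>M\<^esub> k) \<odot>\<^bsub>V\<^esub> HA M (Idn M (Dom M f)) f \<odot>\<^bsub>V\<^esub> eta M (Dom M f)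
      = HA M (Idn M (Dom M f)) (g \<odot>\<^bsub>M\<^esub> k) \<odot>\<^bsub>V\<^esub> HA M f (Idn M (Cod M f)) \<odot>\<^bsub>V\<^esub> eta M (Cod M f)"
    using 11 by (simp add: eta_extranatural)
  then show ?case using 11 by (simp add: HA_Cmp_assoc hom_def)
next
  case (12 bs x g m y r)
  have "mu M x (Dom M g) (Cod M g) \<odot>\<^bsub>V\<^esub> omA V [HA M (Idn M (Dom M g)) g \<odot>\<^bsub>V\<^esub> eta M (Dom M g), r]
      = HA M (Idn M x) g \<odot>\<^bsub>V\<^esub> mu M x (Dom M g) (Dom M g) \<odot>\<^bsub>V\<^esub> omA V [eta M (Dom M g), r]"
    using 12 mu_natural_Cmp[of "Idn M x" "Dom M g" g "eta M (Dom M g)" r] M.Dom_in[of g] by (simp add: hom_def)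
  note V.Cmp_reassoc[OF this, of "V.split [] bs"]
  then show ?case using 12 M.Dom_in[of g] M.Cod_in[of g] mu_unit_left[of x "Dom M g" r bs] by (simp add: hom_def)
next
  case (13 as f x m y r)
  \<comment> \<open>Extranaturality of \<mu> in the middle object shifts \<open>f\<close> to the
    first factor; the unit then stands alone and \<open>mu_unit_right\<close> applies.\<close>
  have "mu M (Dom M f) (Cod M f) y \<odot>\<^bsub>V\<^esub> omA V [r, HA M (Idn M (Dom M f)) f \<odot>\<^bsub>V\<^esub> eta M (Dom M f)]
      = mu M (Dom M f) (Dom M f) y \<odot>\<^bsub>V\<^esub> omA V [HA M f (Idn M y) \<odot>\<^bsub>V\<^esub> r, eta M (Dom M f)]"
    using 13 M.Dom_in[of f] by (intro mu_extranatural_Cmp[symmetric]) (simp_all add: hom_def)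
  note V.Cmp_reassoc[OF this, of "V.split as []"]
  then show ?case using 13 M.Dom_in[of f] M.Cod_in[of f] mu_unit_right[of "Dom M f" y "HA M f (Idn M y) \<odot>\<^bsub>V\<^esub> r" as]
    by (simp add: hom_def)
next
  case (14 as v cs x y r)
  then show ?case using V.cou_inner[of as v cs] by (simp add: hom_def)
next
  case (15 as bs cs ds es x y r)
  then show ?case using V.ins_parallel[of as bs cs ds es] by (simp add: hom_def)
next
  case (16 as bs cs ds x m y r s)
  then show ?case
    using V.split_ins_left[of as bs cs ds]
      V.omA_Cmp2_assoc[of "ins V as bs cs" r "Idn V (om V ds)" s "V.split (as @ bs @ cs) ds"]
    by (simp add: hom_def)
next
  case (17 as bs cs ds x m y r s)
  then show ?case
    using V.split_ins_right[of as bs cs ds]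
      V.omA_Cmp2_assoc[of "Idn V (om V as)" r "ins V bs cs ds" s "V.split as (bs @ cs @ ds)"]
    by (simp add: hom_def)
next
  case (18 as bs cs ds es x y r)
  then show ?case using V.ins_nested[of as bs cs ds es] by (simp add: hom_def)
next
  case (19 as bs cs x n m y r s t)
  then show ?case using mu_assoc_Cmp[of x n m y r s t as bs cs] by (simp add: hom_def)
qed

text \<open>The hom functor represents, with \<phi> the identity: the map
  \<open>\<phi>\<^sup>p\<close> then composes with a counit and an insertion, which cancel by
  \<open>cou_outer\<close>.\<close>

lemma right_representable_Phi_ob: "right_representable V (Phi_ob V M)"
  unfolding right_representable_def
proof (intro exI[of _ "HO M"] exI[of _ "HA M"] exI[of _ "\<lambda>a x y k. k"] conjI ballI)
  show "bifunctor (opcat (Phi_ob V M)) (Phi_ob V M) V (HO M) (HA M)"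
    using M.H.bifunctor_axioms unfolding bifunctor_def opcat_def by simp
  fix as x y assume "as \<in> lists (Ob V)" "x \<in> Ob (Phi_ob V M)" "y \<in> Ob (Phi_ob V M)"
  then have *: "al (Phi_ob V M) [] as [] x y (k \<odot>\<^bsub>V\<^esub> cou V (om V as)) = k"
    if "k \<in> hom V (om V as) (HO M x y)" for k
    using that by (simp add: hom_def V.cou_outer)
  then show "bij_betw (\<lambda>k. al (Phi_ob V M) [] as [] x y (k \<odot>\<^bsub>V\<^esub> cou V (om V as)))
      (hom V (om V as) (HO M x y)) (RS (Phi_ob V M) as x y)"
    using bij_betw_cong[OF *, of "hom V (om V as) (HO M x y)"] by (simp add: bij_betw_id[unfolded id_def])
qed (simp_all add: hom_def bij_betw_def)

end

section \<open>The 2-categories of enriched categories and of \<open>\<delta>\<close>-modules\<close>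

lemma is_functor_id:
  assumes "category A"
  shows "is_functor A A (\<lambda>x\<in>Ob A. x) (\<lambda>f\<in>Ar A. f)"
proof -
  interpret category A by fact
  show ?thesis by standard (simp_all add: hom_def)
qed

lemma is_functor_comp:
  assumes "category A" "category B" "is_functor A B Fo Fa" "is_functor B C Go Ga"
  shows "is_functor A C (\<lambda>x\<in>Ob A. Go (Fo x)) (\<lambda>f\<in>Ar A. Ga (Fa f))"
proof -
  interpret A: category A by fact
  interpret B: category B by fact
  interpret F: is_functor A B Fo Fa by fact
  interpret G: is_functor B C Go Ga by fact
  show ?thesis by standard (simp_all add: hom_def F.Fo_in G.Fo_in F.Fa_Idn G.Fa_Idn F.Fa_Cmp G.Fa_Cmp)
qed

locale enriched_fun = A: enriched V A + B: enriched V B + F: enriched_functor V A B F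
  for V :: "('vo, 'va, 'z) oplax_scheme" and A B :: "('o, 'a, 'vo, 'va) ecat" and F
begin

declare F.Fo_in [simp] F.Fa_Idn [simp]

lemma FH_Ar [simp]: "x \<in> Ob A \<Longrightarrow> y \<in> Ob A \<Longrightarrow> FH F x y \<in> Ar V"
  and Dom_FH [simp]: "x \<in> Ob A \<Longrightarrow> y \<in> Ob A \<Longrightarrow> Dom V (FH F x y) = HO A x y"
  and Cod_FH [simp]: "x \<in> Ob A \<Longrightarrow> y \<in> Ob A \<Longrightarrow> Cod V (FH F x y) = HO B (FO F x) (FO F y)"
  using F.FH_hom[of x y] by (auto simp: hom_def)

lemma FH_natural: "f \<in> Ar A \<Longrightarrow> g \<in> Ar A \<Longrightarrow>
    FH F (Dom A f) (Cod A g) \<odot>\<^bsub>V\<^esub> HA A f g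
      = HA B (FA F f) (FA F g) \<odot>\<^bsub>V\<^esub> FH F (Cod A f) (Dom A g)"
  using F.FH_natural by (simp add: hom_def)

lemma FH_natural_assoc: "f \<in> Ar A \<Longrightarrow> g \<in> Ar A \<Longrightarrow> r \<in> Ar V \<Longrightarrow>
    Cod V r = HO A (Cod A f) (Dom A g) \<Longrightarrow>
    FH F (Dom A f) (Cod A g) \<odot>\<^bsub>V\<^esub> HA A f g \<odot>\<^bsub>V\<^esub> r
      = HA B (FA F f) (FA F g) \<odot>\<^bsub>V\<^esub> FH F (Cod A f) (Dom A g) \<odot>\<^bsub>V\<^esub> r"
  using A.V.Cmp_reassoc[OF FH_natural[of f g], of r] by simp

end

context oplax_monoidal
begin

lemma enrichedI [intro]: "enriched_category V M \<Longrightarrow> enriched V M"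
  by (intro enriched.intro oplax_monoidal_axioms)

lemma enriched_funI [intro]:
  "enriched_category V A \<Longrightarrow> enriched_category V B \<Longrightarrow> enriched_functor V A B F \<Longrightarrow> enriched_fun V A B F"
  by (intro enriched_fun.intro enrichedI)

lemma enriched_functor_id:
  assumes "enriched_category V A"
  shows "enriched_functor V A A (efun_id V A)"
proof -
  interpret enriched V A using assms ..
  show ?thesis
  proof (intro enriched_functor.intro enriched_functor_axioms.intro, goal_cases)
    case 1
    show ?case using is_functor_id[OF M.category_axioms] by (simp add: efun_id_def)
  qed (auto simp: efun_id_def hom_def)
qed

lemma enriched_functor_comp:
  assumes "enriched_category V A" "enriched_category V B" "enriched_category V C"
    "enriched_functor V A B F" "enriched_functor V B C G"
  shows "enriched_functor V A C (efun_comp V A G F)"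
proof -
  interpret F: enriched_fun V A B F using assms by blast
  interpret G: enriched_fun V B C G using assms by blast
  show ?thesis
  proof (intro enriched_functor.intro enriched_functor_axioms.intro, goal_cases)
    case 1
    show ?case using is_functor_comp[OF F.A.M.category_axioms F.B.M.category_axioms
        F.F.is_functor_axioms G.F.is_functor_axioms] by (simp add: efun_comp_def)
  next
    case (6 f x' x g y y')
    then show ?case
      using F.A.M.Dom_in[of f] F.A.M.Cod_in[of f] F.A.M.Dom_in[of g] F.A.M.Cod_in[of g]
        F.FH_natural[of f g] G.FH_natural_assoc[of "FA F f" "FA F g" "FH F x y"]
      by (simp add: efun_comp_def hom_def)
  next
    case (7 x)
    then show ?case using F.F.FH_eta[of x] G.F.FH_eta[of "FO F x"] by (simp add: efun_comp_def)
  next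
    case (8 x y z)
    then show ?case
      using F.F.FH_mu[of x y z]
        Cmp_reassoc[OF G.F.FH_mu[of "FO F x" "FO F y" "FO F z"], of "omA V [FH F y z, FH F x y]"]
      by (simp add: efun_comp_def omA_Cmp2)
  qed (auto simp: efun_comp_def hom_def)
qed

text \<open>Apply \<open>[-, t y]\<close> to the condition on \<open>s\<close> and
  \<open>[s x, -]\<close> to the condition on \<open>t\<close>. The inner terms agree because the
  covariant and contravariant actions on hom objects commute.\<close>

lemma enriched_nat_vert:
  assumes "enriched_category V A" "enriched_category V B"
    "enriched_functor V A B F" "enriched_functor V A B G" "enriched_functor V A B H"
    "is_natural A B F G s" "enriched_nat V A B F G s"
    "is_natural A B G H t" "enriched_nat V A B G H t"
  shows "enriched_nat V A B F H (\<lambda>x\<in>Ob A. t x \<odot>\<^bsub>B\<^esub> s x)"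
  unfolding enriched_nat_def
proof (intro ballI)
  interpret F: enriched_fun V A B F using assms by blast
  interpret G: enriched_fun V A B G using assms by blast
  interpret H: enriched_fun V A B H using assms by blast
  have [simp]: "s x \<in> Ar B" "Dom B (s x) = FO F x" "Cod B (s x) = FO G x"
    "t x \<in> Ar B" "Dom B (t x) = FO G x" "Cod B (t x) = FO H x" if "x \<in> Ob A" for x
    using assms(6,8) that unfolding is_natural_def hom_def by auto
  fix x y assume xy [simp]: "x \<in> Ob A" "y \<in> Ob A"
  have "HA B (Idn B (FO F x)) (t y) \<odot>\<^bsub>V\<^esub> HA B (Idn B (FO F x)) (s y) \<odot>\<^bsub>V\<^esub> FH F x y
      = HA B (Idn B (FO F x)) (t y) \<odot>\<^bsub>V\<^esub> HA B (s x) (Idn B (FO G y)) \<odot>\<^bsub>V\<^esub> FH G x y"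
    using assms(7) by (simp add: enriched_nat_def)
  moreover have "HA B (s x) (Idn B (FO H y)) \<odot>\<^bsub>V\<^esub> HA B (Idn B (FO G x)) (t y) \<odot>\<^bsub>V\<^esub> FH G x y
      = HA B (s x) (Idn B (FO H y)) \<odot>\<^bsub>V\<^esub> HA B (t x) (Idn B (FO H y)) \<odot>\<^bsub>V\<^esub> FH H x y"
    using assms(9) by (simp add: enriched_nat_def)
  ultimately show "HA B (Idn B (FO F x)) ((\<lambda>x\<in>Ob A. t x \<odot>\<^bsub>B\<^esub> s x) y) \<odot>\<^bsub>V\<^esub> FH F x y
      = HA B ((\<lambda>x\<in>Ob A. t x \<odot>\<^bsub>B\<^esub> s x) x) (Idn B (FO H y)) \<odot>\<^bsub>V\<^esub> FH H x y"
    by (simp add: F.B.HA_Cmp_assoc)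
qed

text \<open>The condition on \<open>s\<close> is carried through the hom maps of \<open>G\<close> by
  their naturality, and the condition on \<open>t\<close> is used at \<open>FO F' x\<close> and
  \<open>FO F' y\<close>; the two are then pasted as for vertical composition.\<close>

lemma enriched_nat_horiz:
  assumes "enriched_category V A" "enriched_category V B" "enriched_category V C"
    "enriched_functor V A B F" "enriched_functor V A B F'"
    "enriched_functor V B C G" "enriched_functor V B C G'"
    "is_natural A B F F' s" "enriched_nat V A B F F' s"
    "is_natural B C G G' t" "enriched_nat V B C G G' t"
  shows "enriched_nat V A C (efun_comp V A G F) (efun_comp V A G' F')
    (\<lambda>x\<in>Ob A. t (FO F' x) \<odot>\<^bsub>C\<^esub> FA G (s x))"
  unfolding enriched_nat_def
proof (intro ballI)
  interpret F: enriched_fun V A B F using assms by blast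
  interpret F': enriched_fun V A B F' using assms by blast
  interpret G: enriched_fun V B C G using assms by blast
  interpret G': enriched_fun V B C G' using assms by blast
  have [simp]: "s x \<in> Ar B" "Dom B (s x) = FO F x" "Cod B (s x) = FO F' x" if "x \<in> Ob A" for x
    using assms(8) that unfolding is_natural_def hom_def by auto
  have [simp]: "t x \<in> Ar C" "Dom C (t x) = FO G x" "Cod C (t x) = FO G' x" if "x \<in> Ob B" for x
    using assms(10) that unfolding is_natural_def hom_def by auto
  fix x y assume xy [simp]: "x \<in> Ob A" "y \<in> Ob A"
  have "FH G (FO F x) (FO F' y) \<odot>\<^bsub>V\<^esub> HA B (Idn B (FO F x)) (s y) \<odot>\<^bsub>V\<^esub> FH F x y
      = FH G (FO F x) (FO F' y) \<odot>\<^bsub>V\<^esub> HA B (s x) (Idn B (FO F' y)) \<odot>\<^bsub>V\<^esub> FH F' x y"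
    using assms(9) by (simp add: enriched_nat_def)
  then have "HA C (Idn C (FO G (FO F x))) (FA G (s y)) \<odot>\<^bsub>V\<^esub> FH G (FO F x) (FO F y) \<odot>\<^bsub>V\<^esub> FH F x y
      = HA C (FA G (s x)) (Idn C (FO G (FO F' y))) \<odot>\<^bsub>V\<^esub> FH G (FO F' x) (FO F' y) \<odot>\<^bsub>V\<^esub> FH F' x y"
    using G.FH_natural_assoc[of "Idn B (FO F x)" "s y" "FH F x y"]
      G.FH_natural_assoc[of "s x" "Idn B (FO F' y)" "FH F' x y"] by simp
  then have "HA C (Idn C (FO G (FO F x))) (t (FO F' y)) \<odot>\<^bsub>V\<^esub>
        HA C (Idn C (FO G (FO F x))) (FA G (s y)) \<odot>\<^bsub>V\<^esub> FH G (FO F x) (FO F y) \<odot>\<^bsub>V\<^esub> FH F x y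
      = HA C (Idn C (FO G (FO F x))) (t (FO F' y)) \<odot>\<^bsub>V\<^esub>
        HA C (FA G (s x)) (Idn C (FO G (FO F' y))) \<odot>\<^bsub>V\<^esub> FH G (FO F' x) (FO F' y) \<odot>\<^bsub>V\<^esub> FH F' x y"
    by simp
  moreover have "HA C (Idn C (FO G (FO F' x))) (t (FO F' y)) \<odot>\<^bsub>V\<^esub> FH G (FO F' x) (FO F' y)
      = HA C (t (FO F' x)) (Idn C (FO G' (FO F' y))) \<odot>\<^bsub>V\<^esub> FH G' (FO F' x) (FO F' y)"
    using assms(11) by (simp add: enriched_nat_def)
  from Cmp_reassoc[OF this, of "FH F' x y"]
  have "HA C (FA G (s x)) (Idn C (FO G' (FO F' y))) \<odot>\<^bsub>V\<^esub>
        HA C (Idn C (FO G (FO F' x))) (t (FO F' y)) \<odot>\<^bsub>V\<^esub> FH G (FO F' x) (FO F' y) \<odot>\<^bsub>V\<^esub> FH F' x y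
      = HA C (FA G (s x)) (Idn C (FO G' (FO F' y))) \<odot>\<^bsub>V\<^esub>
        HA C (t (FO F' x)) (Idn C (FO G' (FO F' y))) \<odot>\<^bsub>V\<^esub> FH G' (FO F' x) (FO F' y) \<odot>\<^bsub>V\<^esub> FH F' x y"
    by simp
  ultimately show "HA C (Idn C (FO (efun_comp V A G F) x)) ((\<lambda>x\<in>Ob A. t (FO F' x) \<odot>\<^bsub>C\<^esub> FA G (s x)) y)
        \<odot>\<^bsub>V\<^esub> FH (efun_comp V A G F) x y
      = HA C ((\<lambda>x\<in>Ob A. t (FO F' x) \<odot>\<^bsub>C\<^esub> FA G (s x)) x) (Idn C (FO (efun_comp V A G' F') y))
        \<odot>\<^bsub>V\<^esub> FH (efun_comp V A G' F') x y"
    by (simp add: G.B.HA_Cmp_assoc efun_comp_def)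
qed

lemma cells_enriched:
  "cells {M :: ('p, 'b, 'o, 'a) ecat. enriched_category V M} (\<lambda>A B. {F. enriched_functor V A B F})
    (enriched_nat V) (efun_id V) (efun_comp V)"
proof (intro cells.intro, goal_cases)
  case (1 A)
  then show ?case by (simp add: enriched_category_def)
next
  case (2 A B F)
  then show ?case by (simp add: enriched_functor_def)
next
  case (3 A)
  then show ?case by (simp add: enriched_functor_id)
next
  case (6 A B C F G)
  then show ?case by (simp add: enriched_functor_comp)
next
  case (9 A B F)
  then interpret enriched_fun V A B F by blast
  \<comment> \<open>The strict unit laws are equations between records of total functions, so values
    outside \<open>A\<close> have to agree too.\<close>
  have "FO F x = undefined" if "x \<notin> Ob A" for x
    using F.FO_ext that by (auto simp: extensional_def)
  moreover have "FA F x = undefined" if "x \<notin> Ar A" for x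
    using F.FA_ext that by (auto simp: extensional_def)
  ultimately show ?case
    by (auto simp: efun_id_def efun_comp_def F.FH_ext intro!: efun.equality ext)
next
  case (10 A B F)
  then interpret enriched_fun V A B F by blast
  have "FO F x = undefined" if "x \<notin> Ob A" for x
    using F.FO_ext that by (auto simp: extensional_def)
  moreover have "FA F x = undefined" if "x \<notin> Ar A" for x
    using F.FA_ext that by (auto simp: extensional_def)
  ultimately show ?case
    by (auto simp: efun_id_def efun_comp_def F.FH_ext intro!: efun.equality ext)
next
  case (11 A B C D F G H)
  then interpret F: enriched_fun V A B F by blast
  interpret G: enriched_fun V B C G using 11 by blast
  interpret H: enriched_fun V C D H using 11 by blast
  show ?case by (auto simp: efun_comp_def intro!: ext)
next
  case (12 A B F)
  then interpret enriched_fun V A B F by blast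
  show ?case by (simp add: enriched_nat_def)
next
  case (13 A B F G H s t)
  then show ?case using enriched_nat_vert by simp
next
  case (14 A B C F F' G G' s t)
  then show ?case using enriched_nat_horiz by simp
qed (simp_all add: efun_id_def efun_comp_def)

lemma two_category_Cat_enr: "two_category (Cat_enr V)"
  unfolding Cat_enr_def cells.cell_two_cat_def[OF cells_enriched, symmetric]
  by (rule cells.two_category_cells[OF cells_enriched])

end

section \<open>The 2-category of delta-modules\<close>

locale dmodule = V: oplax_monoidal V + M: delta_module V M
  for V :: "('vo, 'va, 'z) oplax_scheme" and M :: "('o, 'a, 'vo, 'va, 'r) dmod"
begin

lemma RA_ids_Cmp:
  assumes "as \<in> lists (Ob V)" "f \<in> Ar M" "f' \<in> Ar M" "Dom M f = Cod M f'"
    "g \<in> Ar M" "g' \<in> Ar M" "Dom M g' = Cod M g" "r \<in> RS M as (Cod M f) (Dom M g)"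
  shows "RA M (ids V as) f' g' (RA M (ids V as) f g r) = RA M (ids V as) (f \<odot>\<^bsub>M\<^esub> f') (g' \<odot>\<^bsub>M\<^esub> g) r"
proof -
  have "map2 (Cmp V) (ids V as) (ids V as) = ids V as"
    using assms(1) by (induction as) auto
  then show ?thesis
    using M.RA_Cmp[of "ids V as" "ids V as" f f' g g' r] assms by simp
qed

end

locale dmodule_fun = M: dmodule V M + N: dmodule V N + F: oplax_functor V M N F
  for V :: "('vo, 'va, 'z) oplax_scheme" and M N :: "('o, 'a, 'vo, 'va, 'r) dmod" and F
begin

declare F.Fo_in [simp] F.Fa_Idn [simp] F.FR_in [simp]

lemma FR_ids: "as \<in> lists (Ob V) \<Longrightarrow> f \<in> Ar M \<Longrightarrow> g \<in> Ar M \<Longrightarrow>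
    r \<in> RS M as (Cod M f) (Dom M g) \<Longrightarrow> Dom M f = x \<Longrightarrow> Cod M g = y \<Longrightarrow>
    FR F as x y (RA M (ids V as) f g r)
      = RA N (ids V as) (FA F f) (FA F g) (FR F as (Cod M f) (Dom M g) r)"
  using F.FR_natural[of "ids V as" f g r] by auto

end

context oplax_monoidal
begin

lemma dmoduleI [intro]: "delta_module V M \<Longrightarrow> dmodule V M"
  by (intro dmodule.intro oplax_monoidal_axioms)

lemma dmodule_funI [intro]:
  "delta_module V M \<Longrightarrow> delta_module V N \<Longrightarrow> oplax_functor V M N F \<Longrightarrow> dmodule_fun V M N F"
  by (intro dmodule_fun.intro dmoduleI)

lemma oplax_functor_id:
  assumes "delta_module V M"
  shows "oplax_functor V M M (dfun_id V M)"
proof -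
  interpret dmodule V M using assms ..
  show ?thesis
  proof (intro oplax_functor.intro oplax_functor_axioms.intro, goal_cases)
    case 1
    show ?case using is_functor_id[OF M.category_axioms] by (simp add: dfun_id_def)
  next
    case (6 us f g r)
    then show ?case using M.RA_in[of us f g r] by (simp add: dfun_id_def)
  next
    case (7 f)
    then show ?case using M.io_in[of f] by (simp add: dfun_id_def)
  next
    case (8 as bs cs x y r)
    then show ?case using M.al_in[of as bs cs x y r] by (simp add: dfun_id_def)
  next
    case (9 as bs x m y r s)
    then show ?case using M.be_in[of as bs x m y r s] by (simp add: dfun_id_def)
  qed (auto simp: dfun_id_def)
qed

lemma oplax_functor_comp:
  assumes "delta_module V M" "delta_module V N" "delta_module V L"
    "oplax_functor V M N F" "oplax_functor V N L G"
  shows "oplax_functor V M L (dfun_comp V M G F)"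
proof -
  interpret F: dmodule_fun V M N F using assms by blast
  interpret G: dmodule_fun V N L G using assms by blast
  show ?thesis
  proof (intro oplax_functor.intro oplax_functor_axioms.intro, goal_cases)
    case 1
    show ?case using is_functor_comp[OF F.M.M.category_axioms F.N.M.category_axioms
        F.F.is_functor_axioms G.F.is_functor_axioms] by (simp add: dfun_comp_def)
  next
    case (6 us f g r)
    then show ?case using F.M.M.RA_in[of us f g r] F.F.FR_natural[of us f g r]
        G.F.FR_natural[of us "FA F f" "FA F g" "FR F (map (Cod V) us) (Cod M f) (Dom M g) r"]
      by (simp add: dfun_comp_def)
  next
    case (7 f)
    then show ?case using F.M.M.io_in[of f] F.F.FR_io[of f] G.F.FR_io[of "FA F f"]
      by (simp add: dfun_comp_def)
  next
    case (8 as bs cs x y r)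
    then show ?case using F.M.M.al_in[of as bs cs x y r] F.F.FR_al[of as bs cs x y r]
        F.F.FR_in[of "as @ [om V bs] @ cs" x y r]
        G.F.FR_al[of as bs cs "FO F x" "FO F y" "FR F (as @ [om V bs] @ cs) x y r"]
      by (simp add: dfun_comp_def)
  next
    case (9 as bs x m y r s)
    then show ?case using F.M.M.be_in[of as bs x m y r s] F.F.FR_be[of as bs x m y r s]
        G.F.FR_be[of as bs "FO F x" "FO F m" "FO F y" "FR F as m y r" "FR F bs x m s"]
      by (simp add: dfun_comp_def)
  qed (auto simp: dfun_comp_def)
qed

text \<open>The pasting of \<open>enriched_nat_vert\<close>, with the module action on a fixed
  element in place of composition with hom arrows.\<close>

lemma delta_nat_vert:
  assumes "delta_module V M" "delta_module V N"
    "oplax_functor V M N F" "oplax_functor V M N G" "oplax_functor V M N H"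
    "is_natural M N F G s" "delta_nat V M N F G s"
    "is_natural M N G H t" "delta_nat V M N G H t"
  shows "delta_nat V M N F H (\<lambda>x\<in>Ob M. t x \<odot>\<^bsub>N\<^esub> s x)"
  unfolding delta_nat_def
proof (intro ballI)
  interpret F: dmodule_fun V M N F using assms by blast
  interpret G: dmodule_fun V M N G using assms by blast
  interpret H: dmodule_fun V M N H using assms by blast
  have [simp]: "s x \<in> Ar N" "Dom N (s x) = FO F x" "Cod N (s x) = FO G x"
    "t x \<in> Ar N" "Dom N (t x) = FO G x" "Cod N (t x) = FO H x" if "x \<in> Ob M" for x
    using assms(6,8) that unfolding is_natural_def hom_def by auto
  fix as x y r assume [simp]: "as \<in> lists (Ob V)" "x \<in> Ob M" "y \<in> Ob M" "r \<in> RS M as x y"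
  have "RA N (ids V as) (Idn N (FO F x)) (t y) (RA N (ids V as) (Idn N (FO F x)) (s y) (FR F as x y r))
      = RA N (ids V as) (Idn N (FO F x)) (t y) (RA N (ids V as) (s x) (Idn N (FO G y)) (FR G as x y r))"
    using assms(7) by (simp add: delta_nat_def)
  moreover
  have "RA N (ids V as) (s x) (Idn N (FO H y)) (RA N (ids V as) (Idn N (FO G x)) (t y) (FR G as x y r))
      = RA N (ids V as) (s x) (Idn N (FO H y)) (RA N (ids V as) (t x) (Idn N (FO H y)) (FR H as x y r))"
    using assms(9) by (simp add: delta_nat_def)
  ultimately
  show "RA N (ids V as) (Idn N (FO F x)) ((\<lambda>x\<in>Ob M. t x \<odot>\<^bsub>N\<^esub> s x) y) (FR F as x y r)
      = RA N (ids V as) ((\<lambda>x\<in>Ob M. t x \<odot>\<^bsub>N\<^esub> s x) x) (Idn N (FO H y)) (FR H as x y r)"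
    by (simp add: F.N.RA_ids_Cmp)
qed

lemma delta_nat_horiz:
  assumes "delta_module V M" "delta_module V N" "delta_module V L"
    "oplax_functor V M N F" "oplax_functor V M N F'"
    "oplax_functor V N L G" "oplax_functor V N L G'"
    "is_natural M N F F' s" "delta_nat V M N F F' s"
    "is_natural N L G G' t" "delta_nat V N L G G' t"
  shows "delta_nat V M L (dfun_comp V M G F) (dfun_comp V M G' F')
    (\<lambda>x\<in>Ob M. t (FO F' x) \<odot>\<^bsub>L\<^esub> FA G (s x))"
  unfolding delta_nat_def
proof (intro ballI)
  interpret F: dmodule_fun V M N F using assms by blast
  interpret F': dmodule_fun V M N F' using assms by blast
  interpret G: dmodule_fun V N L G using assms by blast
  interpret G': dmodule_fun V N L G' using assms by blast
  have [simp]: "s x \<in> Ar N" "Dom N (s x) = FO F x" "Cod N (s x) = FO F' x" if "x \<in> Ob M" for x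
    using assms(8) that unfolding is_natural_def hom_def by auto
  have [simp]: "t x \<in> Ar L" "Dom L (t x) = FO G x" "Cod L (t x) = FO G' x" if "x \<in> Ob N" for x
    using assms(10) that unfolding is_natural_def hom_def by auto
  fix as x y r assume [simp]: "as \<in> lists (Ob V)" "x \<in> Ob M" "y \<in> Ob M" "r \<in> RS M as x y"
  have "FR G as (FO F x) (FO F' y) (RA N (ids V as) (Idn N (FO F x)) (s y) (FR F as x y r))
      = FR G as (FO F x) (FO F' y) (RA N (ids V as) (s x) (Idn N (FO F' y)) (FR F' as x y r))"
    using assms(9) by (simp add: delta_nat_def)
  then have "RA L (ids V as) (Idn L (FO G (FO F x))) (FA G (s y))
        (FR G as (FO F x) (FO F y) (FR F as x y r))
      = RA L (ids V as) (FA G (s x)) (Idn L (FO G (FO F' y)))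
        (FR G as (FO F' x) (FO F' y) (FR F' as x y r))"
    by (simp add: G.FR_ids)
  then have "RA L (ids V as) (Idn L (FO G (FO F x))) (t (FO F' y))
        (RA L (ids V as) (Idn L (FO G (FO F x))) (FA G (s y))
          (FR G as (FO F x) (FO F y) (FR F as x y r)))
      = RA L (ids V as) (Idn L (FO G (FO F x))) (t (FO F' y))
        (RA L (ids V as) (FA G (s x)) (Idn L (FO G (FO F' y)))
          (FR G as (FO F' x) (FO F' y) (FR F' as x y r)))"
    by simp
  moreover have "RA L (ids V as) (FA G (s x)) (Idn L (FO G' (FO F' y)))
        (RA L (ids V as) (Idn L (FO G (FO F' x))) (t (FO F' y))
          (FR G as (FO F' x) (FO F' y) (FR F' as x y r)))
      = RA L (ids V as) (FA G (s x)) (Idn L (FO G' (FO F' y)))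
        (RA L (ids V as) (t (FO F' x)) (Idn L (FO G' (FO F' y)))
          (FR G' as (FO F' x) (FO F' y) (FR F' as x y r)))"
    using assms(11) by (simp add: delta_nat_def)
  ultimately show "RA L (ids V as) (Idn L (FO (dfun_comp V M G F) x))
        ((\<lambda>x\<in>Ob M. t (FO F' x) \<odot>\<^bsub>L\<^esub> FA G (s x)) y) (FR (dfun_comp V M G F) as x y r)
      = RA L (ids V as) ((\<lambda>x\<in>Ob M. t (FO F' x) \<odot>\<^bsub>L\<^esub> FA G (s x)) x)
        (Idn L (FO (dfun_comp V M G' F') y)) (FR (dfun_comp V M G' F') as x y r)"
    by (simp add: G.N.RA_ids_Cmp dfun_comp_def)
qed

lemma cells_delta_module:
  "cells {M :: ('p, 'b, 'o, 'a, 'r) dmod. delta_module V M} (\<lambda>M N. {F. oplax_functor V M N F})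
    (delta_nat V) (dfun_id V) (dfun_comp V)"
proof (intro cells.intro, goal_cases)
  case (1 A)
  then show ?case by (simp add: delta_module_def)
next
  case (2 A B F)
  then show ?case by (simp add: oplax_functor_def)
next
  case (3 A)
  then show ?case by (simp add: oplax_functor_id)
next
  case (6 A B C F G)
  then show ?case by (simp add: oplax_functor_comp)
next
  case (9 A B F)
  then interpret dmodule_fun V A B F by blast
  have "FO F x = undefined" if "x \<notin> Ob A" for x
    using F.FO_ext that by (auto simp: extensional_def)
  moreover have "FA F x = undefined" if "x \<notin> Ar A" for x
    using F.FA_ext that by (auto simp: extensional_def)
  ultimately show ?case
    by (auto simp: dfun_id_def dfun_comp_def F.FR_ext intro!: dfun.equality ext)
next
  case (10 A B F)
  then interpret dmodule_fun V A B F by blast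
  have "FO F x = undefined" if "x \<notin> Ob A" for x
    using F.FO_ext that by (auto simp: extensional_def)
  moreover have "FA F x = undefined" if "x \<notin> Ar A" for x
    using F.FA_ext that by (auto simp: extensional_def)
  ultimately show ?case
    by (auto simp: dfun_id_def dfun_comp_def F.FR_ext intro!: dfun.equality ext)
next
  case (11 A B C D F G H)
  then interpret F: dmodule_fun V A B F by blast
  interpret G: dmodule_fun V B C G using 11 by blast
  interpret H: dmodule_fun V C D H using 11 by blast
  show ?case by (auto simp: dfun_comp_def intro!: ext)
next
  case (12 A B F)
  then interpret dmodule_fun V A B F by blast
  show ?case by (simp add: delta_nat_def)
next
  case (13 A B F G H s t)
  then show ?case using delta_nat_vert by simp
next
  case (14 A B C F F' G G' s t)
  then show ?case using delta_nat_horiz by simp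
qed (simp_all add: dfun_id_def dfun_comp_def)

lemma two_category_Rep_delta_mod: "two_category (Rep_delta_mod V)"
  unfolding Rep_delta_mod_def Delta_mod_def cells.cell_two_cat_def[OF cells_delta_module, symmetric]
  by (intro two_category_full_sub cells.two_category_cells[OF cells_delta_module])

end

section \<open>The 2-functor is locally an isomorphism\<close>

lemma Phi_1_sel [simp]:
  "FO (Phi_1 V A F) = FO F" "FA (Phi_1 V A F) = FA F"
  "FR (Phi_1 V A F) as x y r =
    (if as \<in> lists (Ob V) \<and> x \<in> Ob A \<and> y \<in> Ob A \<and> r \<in> hom V (om V as) (HO A x y)
     then FH F x y \<odot>\<^bsub>V\<^esub> r else undefined)"
  by (simp_all add: Phi_1_def)

context enriched_fun
begin

text \<open>Compatibility with \<alpha> is associativity of composition, since \<alpha> precomposes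
  and \<open>FH\<close> postcomposes; the other structure maps use the naturality, unit and
  multiplication axioms of an enriched functor.\<close>

lemma oplax_functor_Phi_1: "oplax_functor V (Phi_ob V A) (Phi_ob V B) (Phi_1 V A F)"
proof (intro oplax_functor.intro oplax_functor_axioms.intro, goal_cases)
  case 1
  show ?case using F.is_functor_axioms unfolding is_functor_def by simp
next
  case 2
  show ?case using F.FO_ext by simp
next
  case 3
  show ?case using F.FA_ext by simp
next
  case (4 as x y r)
  then show ?case by auto
next
  case (5 as x y r)
  then show ?case by (simp add: hom_def)
next
  case (6 us f g r)
  then show ?case using FH_natural_assoc[of f g "r \<odot>\<^bsub>V\<^esub> omA V us"] by (simp add: hom_def)
next
  case (7 f)
  then show ?case
    using FH_natural_assoc[of "Idn A (Dom A f)" f "eta A (Dom A f)"] F.FH_eta[of "Dom A f"]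
    by (simp add: hom_def)
next
  case (8 as bs cs x y r)
  then show ?case by (simp add: hom_def)
next
  case (9 as bs x m y r s)
  then show ?case
    using A.V.Cmp_reassoc[OF F.FH_mu[of x m y], of "omA V [r, s] \<odot>\<^bsub>V\<^esub> A.V.split as bs"]
    by (simp add: hom_def A.V.omA_Cmp2_assoc)
qed

end

section \<open>Recovering enriched cells from module cells\<close>

context normal_oplax_monoidal
begin

definition couinv where
  "couinv a = (SOME g. g \<in> hom V a (om V [a]) \<and> g \<odot> cou V a = Idn V (om V [a]) \<and> cou V a \<odot> g = Idn V a)"

lemma couinv:
  assumes "a \<in> Ob V"
  shows couinv_Ar [simp]: "couinv a \<in> Ar V" and Dom_couinv [simp]: "Dom V (couinv a) = a"
    and Cod_couinv [simp]: "Cod V (couinv a) = om V [a]"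
    and couinv_cou [simp]: "couinv a \<odot> cou V a = Idn V (om V [a])"
    and cou_couinv [simp]: "cou V a \<odot> couinv a = Idn V a"
proof -
  have "\<exists>g. g \<in> hom V a (om V [a]) \<and> g \<odot> cou V a = Idn V (om V [a]) \<and> cou V a \<odot> g = Idn V a"
    using normal[OF assms] assms by (auto simp: invertible_def)
  from someI_ex[OF this, folded couinv_def]
  show "couinv a \<in> Ar V" "Dom V (couinv a) = a" "Cod V (couinv a) = om V [a]"
    "couinv a \<odot> cou V a = Idn V (om V [a])" "cou V a \<odot> couinv a = Idn V a"
    by (auto simp: hom_def)
qed

lemma cou_epi:
  assumes "g \<odot> cou V a = h \<odot> cou V a" "a \<in> Ob V" "g \<in> Ar V" "h \<in> Ar V" "Dom V g = a" "Dom V h = a"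
  shows "g = h"
  using invertible_epi[of "cou V a" g h] normal[of a] assms by simp

lemma Phi_1_inj:
  assumes "enriched_category V A" "enriched_category V B"
    "enriched_functor V A B F" "enriched_functor V A B G" "Phi_1 V A F = Phi_1 V A G"
  shows "F = G"
proof -
  interpret F: enriched_fun V A B F using assms by blast
  interpret G: enriched_fun V A B G using assms by blast
  have FO: "FO F = FO G" and FA: "FA F = FA G" using assms(5) by (metis Phi_1_sel)+
  have "FH F x y = FH G x y" for x y
  proof (cases "x \<in> Ob A \<and> y \<in> Ob A")
    case True
    \<comment> \<open>Two enriched functors with the same image are compared at the universal
      element alone; \<open>cou_epi\<close> removes the counit.\<close>
    have "FR (Phi_1 V A F) [HO A x y] x y (cou V (HO A x y))
        = FR (Phi_1 V A G) [HO A x y] x y (cou V (HO A x y))"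
      using assms(5) by simp
    then have "FH F x y \<odot> cou V (HO A x y) = FH G x y \<odot> cou V (HO A x y)"
      using True by (simp add: hom_def)
    then show ?thesis by (rule cou_epi) (use True in simp_all)
  qed (simp add: F.F.FH_ext G.F.FH_ext)
  then show ?thesis using FO FA by (auto intro!: efun.equality ext)
qed

text \<open>An element \<open>r\<close> of \<open>V(\<omega>(as), [x, y])\<close> is obtained from the universal element
  \<open>cou [x, y]\<close> by restricting along \<open>\<omega>(r)\<close> and applying \<open>\<alpha>\<close>, so that an oplax functor is determined
  by its values on the universal elements.\<close>

lemma oplax_functor_FR:
  assumes "enriched_category V A" "enriched_category V B"
    "oplax_functor V (Phi_ob V A) (Phi_ob V B) F"
    "as \<in> lists (Ob V)" "x \<in> Ob A" "y \<in> Ob A" "r \<in> hom V (om V as) (HO A x y)"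
    and u: "u = FR F [HO A x y] x y (cou V (HO A x y)) \<odot> couinv (HO A x y)"
  shows "FR F as x y r = u \<odot> r" and "u \<in> hom V (HO A x y) (HO B (FO F x) (FO F y))"
proof -
  interpret A: enriched V A using assms by blast
  interpret B: enriched V B using assms by blast
  interpret F: oplax_functor V "Phi_ob V A" "Phi_ob V B" F by fact
  let ?H = "HO A x y" and ?k = "FR F [HO A x y] x y (cou V (HO A x y))"
  note [simp] = assms(4-6)
  have r [simp]: "r \<in> Ar V" "Dom V r = om V as" "Cod V r = ?H"
    using assms(7) by (simp_all add: hom_def)
  have FO [simp]: "FO F z \<in> Ob B" if "z \<in> Ob A" for z using F.Fo_in that by simp
  have [simp]: "FA F (Idn A z) = Idn B (FO F z)" if "z \<in> Ob A" for z
    using F.Fa_Idn that by simp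
  have k [simp]: "?k \<in> Ar V" "Dom V ?k = om V [?H]" "Cod V ?k = HO B (FO F x) (FO F y)"
    using F.FR_in[of "[?H]" x y "cou V ?H"] by (simp_all add: hom_def)
  show "u \<in> hom V (HO A x y) (HO B (FO F x) (FO F y))" by (simp add: hom_def u)
  have "FR F [om V as] x y (cou V ?H \<odot> omA V [r]) = ?k \<odot> omA V [r]"
    using F.FR_natural[of "[r]" "Idn A x" "Idn A y" "cou V ?H"] by (simp add: hom_def)
  then have "FR F as x y (cou V ?H \<odot> omA V [r] \<odot> ins V [] as []) = ?k \<odot> omA V [r] \<odot> ins V [] as []"
    using F.FR_al[of "[]" as "[]" x y "cou V ?H \<odot> omA V [r]"] by (simp add: hom_def)
  \<comment> \<open>The pair \<open>couinv\<close> and \<open>cou\<close> is inserted here.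
    \<open>cou_single\<close> is withheld, as it would contract the tail to \<open>r\<close> before
    the pair can cancel.\<close>
  also have "\<dots> = u \<odot> cou V ?H \<odot> omA V [r] \<odot> ins V [] as []"
    using Cmp_reassoc[OF couinv_cou[of ?H], of "omA V [r] \<odot> ins V [] as []"]
    by (simp add: u del: cou_single)
  also have "\<dots> = u \<odot> r" by simp
  finally show "FR F as x y r = u \<odot> r" by simp
qed

lemma Phi_1_surj:
  fixes A B :: "('p, 'q, 'a, 'b) ecat"
  assumes "enriched_category V A" "enriched_category V B"
    "oplax_functor V (Phi_ob V A) (Phi_ob V B) F"
  shows "\<exists>G. enriched_functor V A B G \<and> Phi_1 V A G = F"
proof -
  interpret A: enriched V A using assms by blast
  interpret B: enriched V B using assms by blast
  interpret F: oplax_functor V "Phi_ob V A" "Phi_ob V B" F by fact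
  define u where "u x y = FR F [HO A x y] x y (cou V (HO A x y)) \<odot> couinv (HO A x y)" for x y
  note FR = oplax_functor_FR(1)[OF assms _ _ _ _ u_def]
  have u [simp]: "u x y \<in> Ar V" "Dom V (u x y) = HO A x y" "Cod V (u x y) = HO B (FO F x) (FO F y)"
    if "x \<in> Ob A" "y \<in> Ob A" for x y
    using oplax_functor_FR(2)[OF assms _ _ _ _ u_def, where as = "[HO A x y]" and r = "cou V (HO A x y)"] that
    by (simp_all add: hom_def)
  have FO [simp]: "FO F z \<in> Ob B" if "z \<in> Ob A" for z using F.Fo_in that by simp
  have FA [simp]: "FA F f \<in> Ar B" "Dom B (FA F f) = FO F (Dom A f)" "Cod B (FA F f) = FO F (Cod A f)"
    if "f \<in> Ar A" for f
    using F.Fa_Ar F.Dom_Fa F.Cod_Fa that by simp_all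
  have FI [simp]: "FA F (Idn A z) = Idn B (FO F z)" if "z \<in> Ob A" for z
    using F.Fa_Idn that by simp
  define G :: "('p, 'q, 'b) efun" where "G = \<lparr>FO = FO F, FA = FA F,
    FH = (\<lambda>x y. if x \<in> Ob A \<and> y \<in> Ob A then u x y else undefined)\<rparr>"
  have "enriched_functor V A B G"
  proof (intro enriched_functor.intro enriched_functor_axioms.intro, goal_cases)
    case 1
    show ?case using F.is_functor_axioms unfolding is_functor_def G_def by simp
  next
    case 2
    show ?case using F.FO_ext by (simp add: G_def)
  next
    case 3
    show ?case using F.FA_ext by (simp add: G_def)
  next
    case (4 x y)
    then show ?case by (auto simp: G_def)
  next
    case (5 x y)
    then show ?case by (simp add: G_def hom_def)
  next
    case (6 f x' x g y y')
    then have fg [simp]: "f \<in> Ar A" "g \<in> Ar A" and eq: "x' = Dom A f" "x = Cod A f" "y = Dom A g" "y' = Cod A g"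
      by (auto simp: hom_def)
    \<comment> \<open>Naturality at the universal element: with an identity in the list slot only
      the actions of \<open>f\<close> and \<open>g\<close> remain.\<close>
    have "u x' y' \<odot> HA A f g \<odot> cou V (HO A x y) = HA B (FA F f) (FA F g) \<odot> u x y \<odot> cou V (HO A x y)"
      using F.FR_natural[of "ids V [HO A x y]" f g "cou V (HO A x y)"]
      by (simp add: FR hom_def eq)
    then have "(u x' y' \<odot> HA A f g) \<odot> cou V (HO A x y)
        = (HA B (FA F f) (FA F g) \<odot> u x y) \<odot> cou V (HO A x y)"
      by (simp add: eq)
    then have "u x' y' \<odot> HA A f g = HA B (FA F f) (FA F g) \<odot> u x y"
      by (rule cou_epi) (simp_all add: eq)
    then show ?case by (simp add: G_def eq)
  next
    case (7 x)
    \<comment> \<open>\<open>io\<close> of an identity is \<open>eta\<close>, so preservation of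
      \<iota> at \<open>Idn A x\<close> is the unit axiom.\<close>
    then show ?case using F.FR_io[of "Idn A x"] by (simp add: G_def FR hom_def)
  next
    case (8 x y z)
    \<comment> \<open>Preservation of \<beta> on two universal elements. The counits and the packing
      occur on both sides and vanish by \<open>split_cou\<close>.\<close>
    have "u x z \<odot> mu A x y z \<odot> omA V [cou V (HO A y z), cou V (HO A x y)] \<odot> split [HO A y z] [HO A x y]
        = mu B (FO F x) (FO F y) (FO F z) \<odot> omA V [u y z \<odot> cou V (HO A y z), u x y \<odot> cou V (HO A x y)] \<odot>
          split [HO A y z] [HO A x y]"
      using F.FR_be[of "[HO A y z]" "[HO A x y]" x y z "cou V (HO A y z)" "cou V (HO A x y)"] 8
      by (simp add: FR hom_def)
    also have "\<dots> = mu B (FO F x) (FO F y) (FO F z) \<odot> omA V [u y z, u x y] \<odot>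
        omA V [cou V (HO A y z), cou V (HO A x y)] \<odot> split [HO A y z] [HO A x y]"
      using 8 by (simp add: omA_Cmp2_assoc)
    finally show ?case using 8 by (simp add: G_def split_cou)
  qed
  moreover have "Phi_1 V A G = F"
  proof (rule dfun.equality)
    show "FR (Phi_1 V A G) = FR F"
      using FR F.FR_ext by (auto simp: G_def intro!: ext)
  qed (simp_all add: G_def)
  ultimately show ?thesis by blast
qed

text \<open>In one direction the module condition is read at the universal element and the counit
  cancelled; in the other the enriched condition is composed with an arbitrary
  \<open>r\<close>.\<close>

lemma delta_nat_Phi_1_iff:
  assumes "enriched_category V A" "enriched_category V B"
    "enriched_functor V A B F" "enriched_functor V A B G" "is_natural A B F G t"
  shows "delta_nat V (Phi_ob V A) (Phi_ob V B) (Phi_1 V A F) (Phi_1 V A G) t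
    \<longleftrightarrow> enriched_nat V A B F G t" (is "?L = ?R")
proof -
  interpret F: enriched_fun V A B F using assms by blast
  interpret G: enriched_fun V A B G using assms by blast
  have [simp]: "t x \<in> Ar B" "Dom B (t x) = FO F x" "Cod B (t x) = FO G x" if "x \<in> Ob A" for x
    using assms(5) that unfolding is_natural_def hom_def by auto
  show ?thesis
  proof
    assume L: ?L
    show ?R unfolding enriched_nat_def
    proof (intro ballI)
      fix x y assume [simp]: "x \<in> Ob A" "y \<in> Ob A"
      have "(HA B (Idn B (FO F x)) (t y) \<odot> FH F x y) \<odot> cou V (HO A x y)
          = (HA B (t x) (Idn B (FO G y)) \<odot> FH G x y) \<odot> cou V (HO A x y)"
        using L[unfolded delta_nat_def, rule_format, of "[HO A x y]" x y "cou V (HO A x y)"]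
        by (simp add: hom_def)
      then show "HA B (Idn B (FO F x)) (t y) \<odot> FH F x y = HA B (t x) (Idn B (FO G y)) \<odot> FH G x y"
        by (rule cou_epi) simp_all
    qed
  next
    assume R: ?R
    show ?L unfolding delta_nat_def
    proof (intro ballI)
      fix as x y r assume as [simp]: "as \<in> lists (Ob V)"
        and "x \<in> Ob (Phi_ob V A)" "y \<in> Ob (Phi_ob V A)" "r \<in> RS (Phi_ob V A) as x y"
      then have [simp]: "x \<in> Ob A" "y \<in> Ob A" "r \<in> Ar V" "Dom V r = om V as" "Cod V r = HO A x y"
        by (simp_all add: hom_def)
      have "HA B (Idn B (FO F x)) (t y) \<odot> FH F x y = HA B (t x) (Idn B (FO G y)) \<odot> FH G x y"
        using R by (simp add: enriched_nat_def)
      from Cmp_reassoc[OF this, of r]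
      show "RA (Phi_ob V B) (ids V as) (Idn (Phi_ob V B) (FO (Phi_1 V A F) x)) (t y) (FR (Phi_1 V A F) as x y r)
          = RA (Phi_ob V B) (ids V as) (t x) (Idn (Phi_ob V B) (FO (Phi_1 V A G) y)) (FR (Phi_1 V A G) as x y r)"
        by (simp add: hom_def)
    qed
  qed
qed

lemma Phi_1_comp:
  assumes "enriched_category V A" "enriched_category V B" "enriched_category V C"
    "enriched_functor V A B F" "enriched_functor V B C G"
  shows "Phi_1 V A (efun_comp V A G F)
      = dfun_comp V (Phi_ob V A) (Phi_1 V B G) (Phi_1 V A F)"
proof -
  interpret F: enriched_fun V A B F using assms by blast
  interpret G: enriched_fun V B C G using assms by blast
  show ?thesis
    by (auto simp: efun_comp_def dfun_comp_def hom_def intro!: dfun.equality ext)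
qed

text \<open>\<open>Phi\<close> leaves underlying functors and components unchanged, so what remains
  is \<open>Phi_1_comp\<close> for the added data and \<open>delta_nat_Phi_1_iff\<close> for the
  condition on 2-cells.\<close>

lemma two_functor_Phi: "two_functor (Cat_enr V) (Rep_delta_mod V) (Phi V)"
proof (intro two_functor.intro two_functor_axioms.intro, goal_cases)
  case 1
  show ?case by (rule two_category_Cat_enr)
next
  case 2
  show ?case by (rule two_category_Rep_delta_mod)
next
  case (3 A)
  then interpret enriched V A by (simp add: Cat_enr_def enrichedI)
  show ?case using delta_module_Phi_ob right_representable_Phi_ob
    by (simp add: Phi_def Rep_delta_mod_def Delta_mod_def full_sub_def)
next
  case (4 A B)
  then have AB: "enriched_category V A" "enriched_category V B" by (simp_all add: Cat_enr_def)
  then interpret A: enriched V A by blast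
  interpret B: enriched V B using AB by blast
  show ?case
  proof (rule is_functor.intro, goal_cases)
    case (1 F)
    then show ?case
      using AB by (auto simp: Phi_def Rep_delta_mod_def Delta_mod_def full_sub_def Cat_enr_def cell_cat_def
          intro!: enriched_fun.oplax_functor_Phi_1)
  next
    case (2 c)
    then show ?case
      using AB delta_nat_Phi_1_iff[OF AB]
      by (auto simp: Phi_def Rep_delta_mod_def Delta_mod_def full_sub_def Cat_enr_def cell_cat_def
          hom_def is_natural_def intro!: enriched_fun.oplax_functor_Phi_1)
  qed (simp_all add: Phi_def Rep_delta_mod_def Delta_mod_def full_sub_def Cat_enr_def cell_cat_def)
next
  case (5 A)
  then interpret enriched V A by (simp add: Cat_enr_def enrichedI)
  show ?case
    by (auto simp: Phi_def Rep_delta_mod_def Delta_mod_def full_sub_def Cat_enr_def cell_cat_def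
        efun_id_def dfun_id_def hom_def intro!: dfun.equality ext)
next
  case (6 A B C F G)
  then show ?case using Phi_1_comp[of A B C F G]
    by (simp add: Phi_def Rep_delta_mod_def Delta_mod_def full_sub_def Cat_enr_def cell_cat_def)
next
  case (7 A B C a b)
  then show ?case
    using Phi_1_comp[of A B C "Src a" "Src b"] Phi_1_comp[of A B C "Tgt a" "Tgt b"]
    by (simp add: Phi_def Rep_delta_mod_def Delta_mod_def full_sub_def Cat_enr_def cell_cat_def
        cell_hcomp_def enriched.Phi_ob_sel[OF enrichedI])
qed

end

section \<open>Representable \<open>\<delta>\<close>-modules come from enriched categories\<close>

text \<open>An isomorphism of modules over the identity of one underlying category. Source and
  target have the same type of elements, so the inverse family \<open>Pinv\<close> is again an
  instance, and every construction made from \<open>P\<close> is available for it as well.\<close>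

locale dmodule_iso = M: dmodule V M + N: dmodule V N
  for V :: "('vo, 'va, 'z) oplax_scheme" and M N :: "('o, 'a, 'vo, 'va, 'r) dmod" +
  fixes P :: "'vo list \<Rightarrow> 'o \<Rightarrow> 'o \<Rightarrow> 'r \<Rightarrow> 'r"
  assumes same [simp]: "Ob N = Ob M" "Ar N = Ar M" "Dom N = Dom M" "Cod N = Cod M" "Idn N = Idn M"
      "Cmp N = Cmp M"
    and P_bij: "as \<in> lists (Ob V) \<Longrightarrow> x \<in> Ob M \<Longrightarrow> y \<in> Ob M \<Longrightarrow>
      bij_betw (P as x y) (RS M as x y) (RS N as x y)"
    and P_RA: "us \<in> lists (Ar V) \<Longrightarrow> f \<in> Ar M \<Longrightarrow> g \<in> Ar M \<Longrightarrow>
      r \<in> RS M (map (Cod V) us) (Cod M f) (Dom M g) \<Longrightarrow>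
      P (map (Dom V) us) (Dom M f) (Cod M g) (RA M us f g r)
        = RA N us f g (P (map (Cod V) us) (Cod M f) (Dom M g) r)"
    and P_io: "f \<in> Ar M \<Longrightarrow> P [] (Dom M f) (Cod M f) (io M f) = io N f"
    and P_al: "as \<in> lists (Ob V) \<Longrightarrow> bs \<in> lists (Ob V) \<Longrightarrow> cs \<in> lists (Ob V) \<Longrightarrow>
      x \<in> Ob M \<Longrightarrow> y \<in> Ob M \<Longrightarrow> r \<in> RS M (as @ om V bs # cs) x y \<Longrightarrow>
      P (as @ bs @ cs) x y (al M as bs cs x y r) = al N as bs cs x y (P (as @ om V bs # cs) x y r)"
    and P_be: "as \<in> lists (Ob V) \<Longrightarrow> bs \<in> lists (Ob V) \<Longrightarrow> x \<in> Ob M \<Longrightarrow> m \<in> Ob M \<Longrightarrow> y \<in> Ob M \<Longrightarrow>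
      r \<in> RS M as m y \<Longrightarrow> s \<in> RS M bs x m \<Longrightarrow>
      P (as @ bs) x y (be M as bs x m y r s) = be N as bs x m y (P as m y r) (P bs x m s)"
begin

lemma P_in [simp]: "as \<in> lists (Ob V) \<Longrightarrow> x \<in> Ob M \<Longrightarrow> y \<in> Ob M \<Longrightarrow> r \<in> RS M as x y \<Longrightarrow>
    P as x y r \<in> RS N as x y"
  using P_bij bij_betwE by blast

definition Pinv where "Pinv as x y = inv_into (RS M as x y) (P as x y)"

lemma Pinv_in [simp]: "as \<in> lists (Ob V) \<Longrightarrow> x \<in> Ob M \<Longrightarrow> y \<in> Ob M \<Longrightarrow> r \<in> RS N as x y \<Longrightarrow>
    Pinv as x y r \<in> RS M as x y"
  and P_Pinv [simp]: "as \<in> lists (Ob V) \<Longrightarrow> x \<in> Ob M \<Longrightarrow> y \<in> Ob M \<Longrightarrow> r \<in> RS N as x y \<Longrightarrow>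
    P as x y (Pinv as x y r) = r"
  and Pinv_P [simp]: "as \<in> lists (Ob V) \<Longrightarrow> x \<in> Ob M \<Longrightarrow> y \<in> Ob M \<Longrightarrow> s \<in> RS M as x y \<Longrightarrow>
    Pinv as x y (P as x y s) = s"
  using P_bij[of as x y] unfolding Pinv_def bij_betw_def
  by (auto intro: inv_into_into f_inv_into_f)

lemma Pinv_eqI:
  assumes "as \<in> lists (Ob V)" "x \<in> Ob M" "y \<in> Ob M" "s \<in> RS M as x y" "P as x y s = r"
  shows "Pinv as x y r = s"
  unfolding assms(5)[symmetric] using assms(1-4) by simp

text \<open>A family of bijections compatible with the structure has compatible inverses: both sides
  of each law have the same image under \<open>P\<close>.\<close>

lemma dmodule_iso_Pinv: "dmodule_iso V N M Pinv"
proof (intro dmodule_iso.intro dmodule_iso_axioms.intro, goal_cases)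
  case 1
  show ?case by (rule N.dmodule_axioms)
next
  case 2
  show ?case by (rule M.dmodule_axioms)
next
  case (9 as x y)
  then show ?case using P_bij[of as x y] by (simp add: Pinv_def bij_betw_inv_into)
next
  case (10 us f g r)
  then show ?case by (intro Pinv_eqI) (simp_all add: P_RA M.M.RA_in)
next
  case (11 f)
  then show ?case using M.M.io_in[of f] by (intro Pinv_eqI) (simp_all add: P_io)
next
  case (12 as bs cs x y r)
  then show ?case using M.M.al_in[of as bs cs x y] by (intro Pinv_eqI) (simp_all add: P_al)
next
  case (13 as bs x m y r s)
  then show ?case by (intro Pinv_eqI) (simp_all add: P_be M.M.be_in)
qed simp_all

definition iso_fun where
  "iso_fun = \<lparr>FO = (\<lambda>x\<in>Ob M. x), FA = (\<lambda>f\<in>Ar M. f),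
     FR = (\<lambda>as x y r. if as \<in> lists (Ob V) \<and> x \<in> Ob M \<and> y \<in> Ob M \<and> r \<in> RS M as x y
                      then P as x y r else undefined)\<rparr>"

lemma oplax_functor_iso_fun: "oplax_functor V M N iso_fun"
proof (intro oplax_functor.intro oplax_functor_axioms.intro, goal_cases)
  case 1
  have "is_functor M N (\<lambda>x\<in>Ob M. x) (\<lambda>f\<in>Ar M. f)"
    by standard (simp_all add: hom_def)
  then show ?case by (simp add: iso_fun_def)
next
  case (6 us f g r)
  then show ?case using M.M.RA_in[of us f g r] by (simp add: iso_fun_def P_RA)
next
  case (7 f)
  then show ?case using M.M.io_in[of f] by (simp add: iso_fun_def P_io)
next
  case (8 as bs cs x y r)
  then show ?case using M.M.al_in[of as bs cs x y r] by (simp add: iso_fun_def P_al)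
next
  case (9 as bs x m y r s)
  then show ?case using M.M.be_in[of as bs x m y r s] by (simp add: iso_fun_def P_be)
qed (auto simp: iso_fun_def)

text \<open>The inverse 1-cell is \<open>iso_fun\<close> of the inverse family. The composites are
  identities on the nose because all components are cut down to the same domains.\<close>

lemma invertible_iso_fun:
  assumes "right_representable V M" "right_representable V N"
  shows "invertible1 (Rep_delta_mod V) M N iso_fun"
proof -
  let ?J = "dmodule_iso.iso_fun V N Pinv"
  note J = dmodule_iso.iso_fun_def[OF dmodule_iso_Pinv]
  have "dfun_comp V M ?J iso_fun = dfun_id V M"
    by (auto simp: dfun_comp_def dfun_id_def iso_fun_def J intro!: dfun.equality ext)
  moreover have "dfun_comp V N iso_fun ?J = dfun_id V N"
    by (auto simp: dfun_comp_def dfun_id_def iso_fun_def J intro!: dfun.equality ext)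
  ultimately show ?thesis
    unfolding invertible1_def
    by (intro bexI[of _ ?J])
      (simp_all add: Rep_delta_mod_def Delta_mod_def full_sub_def cell_cat_def
        dmodule_iso.oplax_functor_iso_fun[OF dmodule_iso_Pinv])
qed

end

text \<open>Representing data in a chosen form. \<psi> collects the maps
  \<open>\<phi>\<^sup>p\<close> for all lists at once and is a parameter fixed by
  \<open>psi_def\<close>, so that it can serve as the family of bijections in
  \<open>dmodule_iso\<close>.\<close>

locale represented = V: oplax_monoidal V + M: delta_module V M + H: bifunctor "opcat M" M V Ho Ha
  for V :: "('vo, 'va, 'z) oplax_scheme" and M :: "('o, 'a, 'vo, 'va, 'r) dmod"
    and Ho :: "'o \<Rightarrow> 'o \<Rightarrow> 'vo" and Ha :: "'a \<Rightarrow> 'a \<Rightarrow> 'va" +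
  fixes \<phi> :: "'vo \<Rightarrow> 'o \<Rightarrow> 'o \<Rightarrow> 'va \<Rightarrow> 'r" and \<psi>
  assumes phi_in: "a \<in> Ob V \<Longrightarrow> x \<in> Ob M \<Longrightarrow> y \<in> Ob M \<Longrightarrow> k \<in> hom V (om V [a]) (Ho x y) \<Longrightarrow>
      \<phi> a x y k \<in> RS M [a] x y"
    and phi_natural: "u \<in> Ar V \<Longrightarrow> f \<in> Ar M \<Longrightarrow> g \<in> Ar M \<Longrightarrow>
      k \<in> hom V (om V [Cod V u]) (Ho (Cod M f) (Dom M g)) \<Longrightarrow>
      \<phi> (Dom V u) (Dom M f) (Cod M g) (Ha f g \<odot>\<^bsub>V\<^esub> k \<odot>\<^bsub>V\<^esub> omA V [u])
        = RA M [u] f g (\<phi> (Cod V u) (Cod M f) (Dom M g) k)"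
    and psi_def: "\<psi> as x y k = al M [] as [] x y (\<phi> (om V as) x y (k \<odot>\<^bsub>V\<^esub> cou V (om V as)))"
    and psi_bij: "as \<in> lists (Ob V) \<Longrightarrow> x \<in> Ob M \<Longrightarrow> y \<in> Ob M \<Longrightarrow>
      bij_betw (\<psi> as x y) (hom V (om V as) (Ho x y)) (RS M as x y)"
begin

lemma Ho_in [simp]: "x \<in> Ob M \<Longrightarrow> y \<in> Ob M \<Longrightarrow> Ho x y \<in> Ob V"
  using H.Fo_in by (simp add: opcat_def)

lemma Ha_Ar [simp]: "f \<in> Ar M \<Longrightarrow> g \<in> Ar M \<Longrightarrow> Ha f g \<in> Ar V"
  and Dom_Ha [simp]: "f \<in> Ar M \<Longrightarrow> g \<in> Ar M \<Longrightarrow> Dom V (Ha f g) = Ho (Cod M f) (Dom M g)"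
  and Cod_Ha [simp]: "f \<in> Ar M \<Longrightarrow> g \<in> Ar M \<Longrightarrow> Cod V (Ha f g) = Ho (Dom M f) (Cod M g)"
  using H.Fa_hom[of f g] by (auto simp: opcat_def hom_def)

lemma Ha_Idn [simp]: "x \<in> Ob M \<Longrightarrow> y \<in> Ob M \<Longrightarrow> Ha (Idn M x) (Idn M y) = Idn V (Ho x y)"
  using H.Fa_Idn by (simp add: opcat_def)

lemma psi_in [simp]:
  "as \<in> lists (Ob V) \<Longrightarrow> x \<in> Ob M \<Longrightarrow> y \<in> Ob M \<Longrightarrow> k \<in> Ar V \<Longrightarrow> Dom V k = om V as \<Longrightarrow>
    Cod V k = Ho x y \<Longrightarrow> \<psi> as x y k \<in> RS M as x y"
  using bij_betwE[OF psi_bij] by (auto simp: hom_def)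

lemma psi_eqD:
  assumes "\<psi> as x y k = \<psi> as x y k'" "as \<in> lists (Ob V)" "x \<in> Ob M" "y \<in> Ob M"
    "k \<in> Ar V" "Dom V k = om V as" "Cod V k = Ho x y"
    "k' \<in> Ar V" "Dom V k' = om V as" "Cod V k' = Ho x y"
  shows "k = k'"
  using psi_bij[of as x y] assms unfolding bij_betw_def inj_on_def hom_def by simp

lemma psi_surj:
  assumes "r \<in> RS M as x y" "as \<in> lists (Ob V)" "x \<in> Ob M" "y \<in> Ob M"
  shows "\<exists>k. k \<in> hom V (om V as) (Ho x y) \<and> \<psi> as x y k = r"
proof -
  have "r \<in> \<psi> as x y ` hom V (om V as) (Ho x y)"
    using psi_bij[of as x y] assms by (simp add: bij_betw_def)
  then show ?thesis by blast
qed

text \<open>By naturality of the counit, composing with \<open>omA V us\<close> under \<phi> is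
  restriction along a single arrow, where naturality of \<phi> applies; naturality of \<alpha> then
  unpacks that arrow into the list \<open>us\<close>.\<close>

lemma psi_RA:
  assumes "us \<in> lists (Ar V)" "f \<in> Ar M" "g \<in> Ar M"
    "k \<in> Ar V" "Dom V k = om V (map (Cod V) us)" "Cod V k = Ho (Cod M f) (Dom M g)"
  shows "\<psi> (map (Dom V) us) (Dom M f) (Cod M g) (Ha f g \<odot>\<^bsub>V\<^esub> k \<odot>\<^bsub>V\<^esub> omA V us)
    = RA M us f g (\<psi> (map (Cod V) us) (Cod M f) (Dom M g) k)"
proof -
  have 1: "omA V us \<odot>\<^bsub>V\<^esub> cou V (om V (map (Dom V) us))
      = cou V (om V (map (Cod V) us)) \<odot>\<^bsub>V\<^esub> omA V [omA V us]"
    using V.cou_natural[of "omA V us"] assms by simp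
  let ?r = "\<phi> (om V (map (Cod V) us)) (Cod M f) (Dom M g) (k \<odot>\<^bsub>V\<^esub> cou V (om V (map (Cod V) us)))"
  have 2: "?r \<in> RS M [om V (map (Cod V) us)] (Cod M f) (Dom M g)"
    using assms by (intro phi_in) (simp_all add: hom_def)
  have "\<phi> (om V (map (Dom V) us)) (Dom M f) (Cod M g)
      ((Ha f g \<odot>\<^bsub>V\<^esub> k \<odot>\<^bsub>V\<^esub> omA V us) \<odot>\<^bsub>V\<^esub> cou V (om V (map (Dom V) us))) = RA M [omA V us] f g ?r"
    using phi_natural[of "omA V us" f g "k \<odot>\<^bsub>V\<^esub> cou V (om V (map (Cod V) us))"] assms
    by (simp add: hom_def 1)
  then show ?thesis
    using M.al_natural[of "[]" us "[]" f g ?r] assms 2 by (simp add: psi_def)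
qed

lemma psi_RA':
  assumes "us \<in> lists (Ar V)" "x \<in> Ob M" "y \<in> Ob M"
    "k \<in> Ar V" "Dom V k = om V (map (Cod V) us)" "Cod V k = Ho x y"
  shows "RA M us (Idn M x) (Idn M y) (\<psi> (map (Cod V) us) x y k)
    = \<psi> (map (Dom V) us) x y (k \<odot>\<^bsub>V\<^esub> omA V us)"
  using psi_RA[of us "Idn M x" "Idn M y" k] assms by simp

text \<open>The insertion is itself one arrow, so \<phi> turns composition with it into a
  restriction; \<open>al_nested\<close> with empty outer lists rewrites this restriction followed by
  \<alpha> as two successive applications of \<alpha>.\<close>

lemma psi_al:
  assumes "as \<in> lists (Ob V)" "bs \<in> lists (Ob V)" "cs \<in> lists (Ob V)" "x \<in> Ob M" "y \<in> Ob M"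
    "k \<in> Ar V" "Dom V k = om V (as @ om V bs # cs)" "Cod V k = Ho x y"
  shows "al M as bs cs x y (\<psi> (as @ om V bs # cs) x y k)
    = \<psi> (as @ bs @ cs) x y (k \<odot>\<^bsub>V\<^esub> ins V as bs cs)"
proof -
  let ?d = "om V (as @ om V bs # cs)" and ?e = "om V (as @ bs @ cs)"
  let ?r = "\<phi> ?d x y (k \<odot>\<^bsub>V\<^esub> cou V ?d)"
  have 1: "ins V as bs cs \<odot>\<^bsub>V\<^esub> cou V ?e = cou V ?d \<odot>\<^bsub>V\<^esub> omA V [ins V as bs cs]"
    using V.cou_natural[of "ins V as bs cs"] assms by simp
  have 2: "?r \<in> RS M [?d] x y"
    using assms by (intro phi_in) (simp_all add: hom_def)
  have "\<phi> ?e x y ((k \<odot>\<^bsub>V\<^esub> ins V as bs cs) \<odot>\<^bsub>V\<^esub> cou V ?e)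
      = RA M [ins V as bs cs] (Idn M x) (Idn M y) ?r"
    using phi_natural[of "ins V as bs cs" "Idn M x" "Idn M y" "k \<odot>\<^bsub>V\<^esub> cou V ?d"] assms
    by (simp add: hom_def 1)
  then show ?thesis
    using M.al_nested[of "[]" as bs cs "[]" x y ?r] assms 2 by (simp add: psi_def)
qed

text \<open>The counterpart in \<open>M\<close> of the universal element \<open>cou\<close>, from
  which \<open>psi_univ\<close> generates every element in the image of \<psi>.\<close>

definition univ where "univ x y = \<psi> [Ho x y] x y (cou V (Ho x y))"

lemma univ_in [simp]: "x \<in> Ob M \<Longrightarrow> y \<in> Ob M \<Longrightarrow> univ x y \<in> RS M [Ho x y] x y"
  by (simp add: univ_def)

lemma psi_univ:
  assumes "as \<in> lists (Ob V)" "x \<in> Ob M" "y \<in> Ob M" "r \<in> Ar V" "Dom V r = om V as" "Cod V r = Ho x y"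
  shows "\<psi> as x y r = al M [] as [] x y (RA M [r] (Idn M x) (Idn M y) (univ x y))"
  using assms psi_RA'[of "[r]" x y "cou V (Ho x y)"] psi_al[of "[]" as "[]" x y "cou V (Ho x y) \<odot>\<^bsub>V\<^esub> omA V [r]"]
  by (simp add: univ_def)

text \<open>\<open>psi_surj\<close> makes the choice possible here and in \<open>E_mu\<close>, and
  injectivity of \<psi> makes the result unique.\<close>

definition E_eta where
  "E_eta x = (SOME k. k \<in> hom V (om V []) (Ho x x) \<and> \<psi> [] x x k = io M (Idn M x))"

definition E_mu where
  "E_mu x y z = (SOME k. k \<in> hom V (om V [Ho y z, Ho x y]) (Ho x z) \<and>
     \<psi> [Ho y z, Ho x y] x z k = be M [Ho y z] [Ho x y] x y z (univ y z) (univ x y))"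

lemma E_eta:
  assumes "x \<in> Ob M"
  shows "E_eta x \<in> Ar V" "Dom V (E_eta x) = om V []" "Cod V (E_eta x) = Ho x x"
    "\<psi> [] x x (E_eta x) = io M (Idn M x)"
proof -
  have "\<exists>k. k \<in> hom V (om V []) (Ho x x) \<and> \<psi> [] x x k = io M (Idn M x)"
    using M.io_in[of "Idn M x"] assms by (intro psi_surj) simp_all
  from someI_ex[OF this, folded E_eta_def]
  show "E_eta x \<in> Ar V" "Dom V (E_eta x) = om V []" "Cod V (E_eta x) = Ho x x"
    "\<psi> [] x x (E_eta x) = io M (Idn M x)"
    by (auto simp: hom_def)
qed

lemma E_mu:
  assumes "x \<in> Ob M" "y \<in> Ob M" "z \<in> Ob M"
  shows "E_mu x y z \<in> Ar V" "Dom V (E_mu x y z) = om V [Ho y z, Ho x y]"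
    "Cod V (E_mu x y z) = Ho x z"
    "\<psi> [Ho y z, Ho x y] x z (E_mu x y z) = be M [Ho y z] [Ho x y] x y z (univ y z) (univ x y)"
proof -
  have "be M [Ho y z] [Ho x y] x y z (univ y z) (univ x y) \<in> RS M [Ho y z, Ho x y] x z"
    using M.be_in[of "[Ho y z]" "[Ho x y]" x y z "univ y z" "univ x y"] assms by simp
  then have "\<exists>k. k \<in> hom V (om V [Ho y z, Ho x y]) (Ho x z) \<and>
      \<psi> [Ho y z, Ho x y] x z k = be M [Ho y z] [Ho x y] x y z (univ y z) (univ x y)"
    using assms by (intro psi_surj) simp_all
  from someI_ex[OF this, folded E_mu_def]
  show "E_mu x y z \<in> Ar V" "Dom V (E_mu x y z) = om V [Ho y z, Ho x y]"
    "Cod V (E_mu x y z) = Ho x z"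
    "\<psi> [Ho y z, Ho x y] x z (E_mu x y z) = be M [Ho y z] [Ho x y] x y z (univ y z) (univ x y)"
    by (auto simp: hom_def)
qed

declare E_eta(1-3) [simp] E_mu(1-3) [simp]

text \<open>Both arguments are written as \<alpha> of a restriction of a universal element.
  Compatibility of \<beta> with \<alpha> and with restriction moves all of this outside, leaving
  \<beta> of two universal elements, which is \<psi> of \<open>E_mu\<close> by definition; moving
  back under \<psi> turns the operations into composition.\<close>

lemma psi_be:
  assumes "as \<in> lists (Ob V)" "bs \<in> lists (Ob V)" "x \<in> Ob M" "m \<in> Ob M" "y \<in> Ob M"
    "r \<in> Ar V" "Dom V r = om V as" "Cod V r = Ho m y"
    "s \<in> Ar V" "Dom V s = om V bs" "Cod V s = Ho x m"
  shows "be M as bs x m y (\<psi> as m y r) (\<psi> bs x m s)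
    = \<psi> (as @ bs) x y (E_mu x m y \<odot>\<^bsub>V\<^esub> omA V [r, s] \<odot>\<^bsub>V\<^esub> V.split as bs)"
proof -
  note [simp] = assms
  let ?r = "RA M [r] (Idn M m) (Idn M y) (univ m y)" and ?s = "RA M [s] (Idn M x) (Idn M m) (univ x m)"
  have r: "?r \<in> RS M [om V as] m y" and s: "?s \<in> RS M [om V bs] x m"
    using M.RA_in[of "[r]" "Idn M m" "Idn M y" "univ m y"]
      M.RA_in[of "[s]" "Idn M x" "Idn M m" "univ x m"] by simp_all
  have s': "al M [] bs [] x m ?s \<in> RS M bs x m"
    using M.al_in[of "[]" bs "[]" x m ?s] s by simp
  have "be M as bs x m y (\<psi> as m y r) (\<psi> bs x m s)
      = be M as bs x m y (al M [] as [] m y ?r) (al M [] bs [] x m ?s)"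
    by (simp add: psi_univ)
  \<comment> \<open>The left \<alpha> is pulled out before the right one, so that the two insertions
    arise in the order of \<open>split\<close>.\<close>
  also have "\<dots> = al M [] as bs x y (be M [om V as] bs x m y ?r (al M [] bs [] x m ?s))"
    using M.al_be_left[of "[]" as "[]" bs x m y ?r "al M [] bs [] x m ?s"] r s' by simp
  also have "\<dots> = al M [] as bs x y (al M [om V as] bs [] x y (be M [om V as] [om V bs] x m y ?r ?s))"
    using M.al_be_right[of "[om V as]" "[]" bs "[]" x m y ?r ?s] r s by simp
  also have "be M [om V as] [om V bs] x m y ?r ?s = RA M [r, s] (Idn M x) (Idn M y)
      (\<psi> [Ho m y, Ho x m] x y (E_mu x m y))"
    using M.be_natural[of "[r]" "[s]" "Idn M x" m "Idn M y" "univ m y" "univ x m"] by (simp add: E_mu(4))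
  also have "\<dots> = \<psi> [om V as, om V bs] x y (E_mu x m y \<odot>\<^bsub>V\<^esub> omA V [r, s])"
    using psi_RA'[of "[r, s]" x y "E_mu x m y"] by simp
  also have "al M [om V as] bs [] x y \<dots>
      = \<psi> (om V as # bs) x y (E_mu x m y \<odot>\<^bsub>V\<^esub> omA V [r, s] \<odot>\<^bsub>V\<^esub> ins V [om V as] bs [])"
    using psi_al[of "[om V as]" bs "[]" x y "E_mu x m y \<odot>\<^bsub>V\<^esub> omA V [r, s]"] by simp
  also have "al M [] as bs x y \<dots>
      = \<psi> (as @ bs) x y (E_mu x m y \<odot>\<^bsub>V\<^esub> omA V [r, s] \<odot>\<^bsub>V\<^esub> V.split as bs)"
    using psi_al[of "[]" as bs x y "E_mu x m y \<odot>\<^bsub>V\<^esub> omA V [r, s] \<odot>\<^bsub>V\<^esub> ins V [om V as] bs []"]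
    by (simp add: V.split_def)
  finally show ?thesis .
qed

text \<open>Precomposing with counits makes the packing disappear, so \<beta> corresponds to \<mu>
  after \<open>omA V [r, s]\<close> alone. This is the form in which naturality and extranaturality
  of \<mu> are stated.\<close>

lemma psi_be_cou:
  assumes "a \<in> Ob V" "b \<in> Ob V" "x \<in> Ob M" "m \<in> Ob M" "y \<in> Ob M"
    "r \<in> Ar V" "Dom V r = a" "Cod V r = Ho m y" "s \<in> Ar V" "Dom V s = b" "Cod V s = Ho x m"
  shows "be M [a] [b] x m y (\<psi> [a] m y (r \<odot>\<^bsub>V\<^esub> cou V a)) (\<psi> [b] x m (s \<odot>\<^bsub>V\<^esub> cou V b))
    = \<psi> [a, b] x y (E_mu x m y \<odot>\<^bsub>V\<^esub> omA V [r, s])"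
proof -
  have "omA V [r \<odot>\<^bsub>V\<^esub> cou V a, s \<odot>\<^bsub>V\<^esub> cou V b] \<odot>\<^bsub>V\<^esub> V.split [a] [b]
      = omA V [r, s] \<odot>\<^bsub>V\<^esub> omA V [cou V a, cou V b] \<odot>\<^bsub>V\<^esub> V.split [a] [b]"
    using assms by (simp add: V.omA_Cmp2_assoc)
  then show ?thesis
    using assms psi_be[of "[a]" "[b]" x m y "r \<odot>\<^bsub>V\<^esub> cou V a" "s \<odot>\<^bsub>V\<^esub> cou V b"]
    by (simp add: V.split_cou)
qed

lemma psi_RA_univ:
  assumes "f \<in> Ar M" "g \<in> Ar M"
  shows "RA M [Idn V (Ho (Cod M f) (Dom M g))] f g (univ (Cod M f) (Dom M g))
    = \<psi> [Ho (Cod M f) (Dom M g)] (Dom M f) (Cod M g) (Ha f g \<odot>\<^bsub>V\<^esub> cou V (Ho (Cod M f) (Dom M g)))"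
  using psi_RA[of "[Idn V (Ho (Cod M f) (Dom M g))]" f g "cou V (Ho (Cod M f) (Dom M g))"] assms
  by (simp add: univ_def)

text \<open>\<iota> of \<open>f\<close> arises from \<iota> of an identity by letting
  \<open>f\<close> act covariantly at its domain or contravariantly at its codomain. Comparing the
  two gives extranaturality of \<open>E_eta\<close>.\<close>

lemma psi_io:
  assumes "f \<in> Ar M"
  shows "\<psi> [] (Dom M f) (Cod M f) (Ha (Idn M (Dom M f)) f \<odot>\<^bsub>V\<^esub> E_eta (Dom M f)) = io M f"
    and "\<psi> [] (Dom M f) (Cod M f) (Ha f (Idn M (Cod M f)) \<odot>\<^bsub>V\<^esub> E_eta (Cod M f)) = io M f"
  using assms psi_RA[of "[]" "Idn M (Dom M f)" f "E_eta (Dom M f)"]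
    psi_RA[of "[]" f "Idn M (Cod M f)" "E_eta (Cod M f)"]
    M.io_natural[of "Idn M (Dom M f)" "Idn M (Dom M f)" f]
    M.io_natural[of f "Idn M (Cod M f)" "Idn M (Cod M f)"]
  by (simp_all add: E_eta(4))

definition E :: "('o, 'a, 'vo, 'va) ecat" where
  "E = \<lparr>Ob = Ob M, Ar = Ar M, Dom = Dom M, Cod = Cod M, Idn = Idn M, Cmp = Cmp M,
     HO = Ho, HA = Ha, eta = E_eta, mu = E_mu\<rparr>"

lemma E_sel [simp]:
  "Ob E = Ob M" "Ar E = Ar M" "Dom E = Dom M" "Cod E = Cod M" "Idn E = Idn M" "Cmp E = Cmp M"
  "HO E = Ho" "HA E = Ha" "eta E = E_eta" "mu E = E_mu"
  by (simp_all add: E_def)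

lemma hom_E [simp]: "hom E x y = hom M x y"
  by (simp add: hom_def)

text \<open>Under \<psi>, naturality of \<mu> becomes \<open>be_natural\<close>, extranaturality
  \<open>be_extranatural\<close>, associativity \<open>be_assoc\<close>, and the unit laws
  \<open>be_io_left\<close> and \<open>be_io_right\<close>, all at universal elements.\<close>

lemma enriched_category_E: "enriched_category V E"
proof (intro enriched_category.intro enriched_category_axioms.intro, goal_cases)
  case 1
  show ?case using M.category_axioms unfolding category_def by simp
next
  case 2
  show ?case using H.bifunctor_axioms unfolding bifunctor_def opcat_def by simp
next
  case (3 x)
  then show ?case by (simp add: hom_def)
next
  case (4 f x y)
  then have f: "f \<in> Ar M" "x = Dom M f" "y = Cod M f" by (auto simp: hom_def)
  have "\<psi> [] x y (Ha (Idn M x) f \<odot>\<^bsub>V\<^esub> E_eta x) = \<psi> [] x y (Ha f (Idn M y) \<odot>\<^bsub>V\<^esub> E_eta y)"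
    using psi_io[of f] f by simp
  then show ?case unfolding E_sel by (rule psi_eqD) (use f in simp_all)
next
  case (5 x y z)
  then show ?case by (simp add: hom_def)
next
  case (6 f x' x y g z z')
  then have f [simp]: "f \<in> Ar M" "g \<in> Ar M" "y \<in> Ob M"
    and eq: "x' = Dom M f" "x = Cod M f" "z = Dom M g" "z' = Cod M g" by (auto simp: hom_def)
  have "RA M [Idn V (Ho y z), Idn V (Ho x y)] f g (\<psi> [Ho y z, Ho x y] x z (E_mu x y z))
      = be M [Ho y z] [Ho x y] x' y z' (\<psi> [Ho y z] y z' (Ha (Idn M y) g \<odot>\<^bsub>V\<^esub> cou V (Ho y z)))
        (\<psi> [Ho x y] x' y (Ha f (Idn M y) \<odot>\<^bsub>V\<^esub> cou V (Ho x y)))"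
    using M.be_natural[of "[Idn V (Ho y z)]" "[Idn V (Ho x y)]" f y g "univ y z" "univ x y"]
      psi_RA_univ[of "Idn M y" g] psi_RA_univ[of f "Idn M y"]
    by (simp add: eq E_mu(4))
  also have "\<dots> = \<psi> [Ho y z, Ho x y] x' z' (E_mu x' y z' \<odot>\<^bsub>V\<^esub> omA V [Ha (Idn M y) g, Ha f (Idn M y)])"
    by (rule psi_be_cou) (simp_all add: eq)
  finally have "\<psi> [Ho y z, Ho x y] x' z' (E_mu x' y z' \<odot>\<^bsub>V\<^esub> omA V [Ha (Idn M y) g, Ha f (Idn M y)])
      = \<psi> [Ho y z, Ho x y] x' z' (Ha f g \<odot>\<^bsub>V\<^esub> E_mu x y z)"
    using psi_RA[of "[Idn V (Ho y z), Idn V (Ho x y)]" f g "E_mu x y z"] by (simp add: eq)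
  then show ?case unfolding E_sel by (rule psi_eqD) (simp_all add: eq)
next
  case (7 x h y y' z)
  then have h [simp]: "h \<in> Ar M" "x \<in> Ob M" "z \<in> Ob M" and eq: "y = Dom M h" "y' = Cod M h"
    by (auto simp: hom_def)
  \<comment> \<open>The universal element is written with an explicit identity in front of its
    counit to match \<open>psi_be_cou\<close>; the next step removes it again.\<close>
  have "\<psi> [Ho y' z, Ho x y] x z (E_mu x y z \<odot>\<^bsub>V\<^esub> omA V [Ha h (Idn M z), Idn V (Ho x y)])
      = be M [Ho y' z] [Ho x y] x y z (\<psi> [Ho y' z] y z (Ha h (Idn M z) \<odot>\<^bsub>V\<^esub> cou V (Ho y' z)))
        (\<psi> [Ho x y] x y (Idn V (Ho x y) \<odot>\<^bsub>V\<^esub> cou V (Ho x y)))"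
    by (rule psi_be_cou[symmetric]) (simp_all add: eq)
  also have "\<dots> = be M [Ho y' z] [Ho x y] x y z (RA M [Idn V (Ho y' z)] h (Idn M z) (univ y' z)) (univ x y)"
    using psi_RA_univ[of h "Idn M z"] by (simp add: eq univ_def)
  also have "\<dots> = be M [Ho y' z] [Ho x y] x y' z (univ y' z) (RA M [Idn V (Ho x y)] (Idn M x) h (univ x y))"
    using M.be_extranatural[of "[Ho y' z]" "[Ho x y]" x z h y y' "univ y' z" "univ x y"]
    by (simp add: eq hom_def)
  also have "\<dots> = be M [Ho y' z] [Ho x y] x y' z (\<psi> [Ho y' z] y' z (Idn V (Ho y' z) \<odot>\<^bsub>V\<^esub> cou V (Ho y' z)))
        (\<psi> [Ho x y] x y' (Ha (Idn M x) h \<odot>\<^bsub>V\<^esub> cou V (Ho x y)))"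
    using psi_RA_univ[of "Idn M x" h] by (simp add: eq univ_def)
  also have "\<dots> = \<psi> [Ho y' z, Ho x y] x z (E_mu x y' z \<odot>\<^bsub>V\<^esub> omA V [Idn V (Ho y' z), Ha (Idn M x) h])"
    by (rule psi_be_cou) (simp_all add: eq)
  finally show ?case unfolding E_sel by (rule psi_eqD) (simp_all add: eq)
next
  case (8 w x y z)
  then have [simp]: "w \<in> Ob M" "x \<in> Ob M" "y \<in> Ob M" "z \<in> Ob M" by simp_all
  let ?a = "Ho y z" and ?b = "Ho x y" and ?c = "Ho w x"
  \<comment> \<open>The counit on the singleton block undoes its packing, so only the packing of the
    pair survives. In \<open>split\<close> as defined this singleton is packed last and meets the
    counit directly; in \<open>r\<close> below the singleton comes first, which calls for
    \<open>split_alt\<close>.\<close>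
  have l: "omA V [E_mu x y z, cou V ?c] \<odot>\<^bsub>V\<^esub> V.split [?a, ?b] [?c]
      = omA V [E_mu x y z, Idn V ?c] \<odot>\<^bsub>V\<^esub> ins V [] [?a, ?b] [?c]"
  proof -
    have "omA V [E_mu x y z, cou V ?c] \<odot>\<^bsub>V\<^esub> V.split [?a, ?b] [?c]
        = omA V [E_mu x y z, Idn V ?c] \<odot>\<^bsub>V\<^esub> omA V [Idn V (om V [?a, ?b]), cou V ?c] \<odot>\<^bsub>V\<^esub> V.split [?a, ?b] [?c]"
      by (simp add: V.omA_Cmp2_assoc)
    then show ?thesis
      using V.Cmp_reassoc[OF V.cou_inner[of "[om V [?a, ?b]]" ?c "[]"]] by (simp add: V.split_def)
  qed
  have r: "omA V [cou V ?a, E_mu w x y] \<odot>\<^bsub>V\<^esub> V.split [?a] [?b, ?c]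
      = omA V [Idn V ?a, E_mu w x y] \<odot>\<^bsub>V\<^esub> ins V [?a] [?b, ?c] []"
  proof -
    have "omA V [cou V ?a, E_mu w x y] \<odot>\<^bsub>V\<^esub> V.split [?a] [?b, ?c]
        = omA V [Idn V ?a, E_mu w x y] \<odot>\<^bsub>V\<^esub> omA V [cou V ?a, Idn V (om V [?b, ?c])] \<odot>\<^bsub>V\<^esub> V.split [?a] [?b, ?c]"
      by (simp add: V.omA_Cmp2_assoc)
    then show ?thesis
      using V.Cmp_reassoc[OF V.cou_inner[of "[]" ?a "[om V [?b, ?c]]"]] by (simp add: V.split_alt)
  qed
  \<comment> \<open>\<open>univ\<close> is \<psi> of the counit and \<beta> of two of them is \<psi>
    of \<open>E_mu\<close>, so \<open>psi_be\<close> evaluates the nested \<beta>.\<close>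
  have "\<psi> [?a, ?b, ?c] w z (E_mu w x z \<odot>\<^bsub>V\<^esub> omA V [E_mu x y z, Idn V ?c] \<odot>\<^bsub>V\<^esub> ins V [] [?a, ?b] [?c])
      = be M [?a, ?b] [?c] w x z (be M [?a] [?b] x y z (univ y z) (univ x y)) (univ w x)"
    using psi_be[of "[?a, ?b]" "[?c]" w x z "E_mu x y z" "cou V ?c"]
    by (simp add: l E_mu(4) flip: univ_def)
  also have "\<dots> = be M [?a] [?b, ?c] w y z (univ y z) (be M [?b] [?c] w x y (univ x y) (univ w x))"
    using M.be_assoc[of "[?a]" "[?b]" "[?c]" w x y z "univ y z" "univ x y" "univ w x"] by simp
  also have "\<dots> = \<psi> [?a, ?b, ?c] w z (E_mu w y z \<odot>\<^bsub>V\<^esub> omA V [Idn V ?a, E_mu w x y] \<odot>\<^bsub>V\<^esub>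
      ins V [?a] [?b, ?c] [])"
    using psi_be[of "[?a]" "[?b, ?c]" w y z "cou V ?a" "E_mu w x y"]
    by (simp add: r E_mu(4) flip: univ_def)
  finally show ?case unfolding E_sel by (rule psi_eqD) simp_all
next
  case (9 x y)
  then have [simp]: "x \<in> Ob M" "y \<in> Ob M" by simp_all
  \<comment> \<open>\<open>E_eta y\<close> stands for \<iota> of the identity, and \<beta> with that
    fixes \<open>univ x y\<close>.\<close>
  have "be M [] [Ho x y] x y y (\<psi> [] y y (E_eta y)) (univ x y) = univ x y"
    using M.be_io_left[of "[Ho x y]" x "Idn M y" y y "univ x y"] M.RA_Idn[of "[Ho x y]" x y "univ x y"]
    by (simp add: E_eta(4) M.Idn_hom)
  moreover have "omA V [E_eta y, cou V (Ho x y)] \<odot>\<^bsub>V\<^esub> V.split [] [Ho x y]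
      = omA V [E_eta y, Idn V (Ho x y)] \<odot>\<^bsub>V\<^esub> ins V [] [] [Ho x y]"
    using V.split_Nil_left[of "E_eta y" "[Ho x y]" "cou V (Ho x y)"] V.cou_inner[of "[]" "Ho x y" "[]"]
    by simp
  ultimately have "\<psi> [Ho x y] x y (E_mu x y y \<odot>\<^bsub>V\<^esub> omA V [E_eta y, Idn V (Ho x y)] \<odot>\<^bsub>V\<^esub> ins V [] [] [Ho x y])
      = \<psi> [Ho x y] x y (cou V (Ho x y))"
    using psi_be[of "[]" "[Ho x y]" x y y "E_eta y" "cou V (Ho x y)"] by (simp flip: univ_def)
  then show ?case unfolding E_sel by (rule psi_eqD) simp_all
next
  case (10 x y)
  then have [simp]: "x \<in> Ob M" "y \<in> Ob M" by simp_all
  have "be M [Ho x y] [] x x y (univ x y) (\<psi> [] x x (E_eta x)) = univ x y"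
    using M.be_io_right[of "[Ho x y]" "Idn M x" x x y "univ x y"] M.RA_Idn[of "[Ho x y]" x y "univ x y"]
    by (simp add: E_eta(4) M.Idn_hom)
  moreover have "omA V [cou V (Ho x y), E_eta x] \<odot>\<^bsub>V\<^esub> V.split [Ho x y] []
      = omA V [Idn V (Ho x y), E_eta x] \<odot>\<^bsub>V\<^esub> ins V [Ho x y] [] []"
    using V.split_Nil_right[of "E_eta x" "[Ho x y]" "cou V (Ho x y)"] V.cou_inner[of "[]" "Ho x y" "[]"]
    by simp
  ultimately have "\<psi> [Ho x y] x y (E_mu x x y \<odot>\<^bsub>V\<^esub> omA V [Idn V (Ho x y), E_eta x] \<odot>\<^bsub>V\<^esub> ins V [Ho x y] [] [])
      = \<psi> [Ho x y] x y (cou V (Ho x y))"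
    using psi_be[of "[Ho x y]" "[]" x x y "cou V (Ho x y)" "E_eta x"] by (simp flip: univ_def)
  then show ?case unfolding E_sel by (rule psi_eqD) simp_all
qed

end

section \<open>Comparing a representable module with its enriched category\<close>

context normal_oplax_monoidal
begin

text \<open>The elements of \<open>M\<close> are taken in the type of arrows of \<open>V\<close>,
  where those of \<open>Phi_ob\<close> live, so that source and target fit the format of
  \<open>dmodule_iso\<close>.\<close>

lemma dmodule_iso_Phi_E:
  fixes M :: "('p, 'q, 'a, 'b, 'b) dmod"
  assumes "represented V M Ho Ha \<phi> \<psi>"
  shows "dmodule_iso V (Phi_ob V (represented.E V M Ho Ha \<psi>)) M \<psi>"
proof -
  interpret R: represented V M Ho Ha \<phi> \<psi> by fact
  interpret E: enriched V R.E using R.enriched_category_E by blast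
  show ?thesis
  proof (intro dmodule_iso.intro dmodule_iso_axioms.intro, goal_cases)
    case 1
    show ?case using E.delta_module_Phi_ob by blast
  next
    case 2
    show ?case using R.M.delta_module_axioms by blast
  next
    case (9 as x y)
    then show ?case using R.psi_bij by simp
  next
    case (10 us f g r)
    then show ?case using R.psi_RA[of us f g r] by (simp add: hom_def)
  next
    case (11 f)
    then show ?case using R.psi_io(1)[of f] by simp
  next
    case (12 as bs cs x y r)
    then show ?case using R.psi_al[of as bs cs x y r] by (simp add: hom_def)
  next
    case (13 as bs x m y r s)
    then show ?case using R.psi_be[of as bs x m y r s] by (simp add: hom_def)
  qed simp_all
qed

text \<open>The object is the enriched category \<open>E\<close> of some choice of representing
  data, and \<psi>, read as an oplax functor over the identity, is the invertible 1-cell.\<close>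

lemma Phi_essentially_surjective:
  fixes M :: "('p, 'q, 'a, 'b, 'b) dmod"
  assumes "delta_module V M" "right_representable V M"
  shows "\<exists>A. enriched_category V A \<and> (\<exists>F. oplax_functor V (Phi_ob V A) M F \<and>
    invertible1 (Rep_delta_mod V) (Phi_ob V A) M F)"
proof -
  obtain Ho Ha \<phi> where H: "bifunctor (opcat M) M V Ho Ha"
    and phi: "\<forall>a \<in> Ob V. \<forall>x \<in> Ob M. \<forall>y \<in> Ob M.
       bij_betw (\<phi> a x y) (hom V (om V [a]) (Ho x y)) (RS M [a] x y)"
    and phi_natural: "\<forall>u \<in> Ar V. \<forall>f \<in> Ar M. \<forall>g \<in> Ar M. \<forall>k \<in> hom V (om V [Cod V u]) (Ho (Cod M f) (Dom M g)).
       \<phi> (Dom V u) (Dom M f) (Cod M g) (Ha f g \<odot> k \<odot> omA V [u])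
         = RA M [u] f g (\<phi> (Cod V u) (Cod M f) (Dom M g) k)"
    and psi: "\<forall>as \<in> lists (Ob V). \<forall>x \<in> Ob M. \<forall>y \<in> Ob M.
       bij_betw (\<lambda>k. al M [] as [] x y (\<phi> (om V as) x y (k \<odot> cou V (om V as))))
         (hom V (om V as) (Ho x y)) (RS M as x y)"
    using assms(2) unfolding right_representable_def by blast
  define \<psi> where "\<psi> as x y k = al M [] as [] x y (\<phi> (om V as) x y (k \<odot> cou V (om V as)))" for as x y k
  interpret R: represented V M Ho Ha \<phi> \<psi>
  proof (intro represented.intro represented_axioms.intro)
    show "oplax_monoidal V" "delta_module V M" "bifunctor (opcat M) M V Ho Ha"
      using oplax_monoidal_axioms assms(1) H .
    show "\<phi> a x y k \<in> RS M [a] x y"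
      if "a \<in> Ob V" "x \<in> Ob M" "y \<in> Ob M" "k \<in> hom V (om V [a]) (Ho x y)" for a x y k
      using phi that bij_betwE by blast
    show "bij_betw (\<psi> as x y) (hom V (om V as) (Ho x y)) (RS M as x y)"
      if "as \<in> lists (Ob V)" "x \<in> Ob M" "y \<in> Ob M" for as x y
    proof -
      have "\<psi> as x y = (\<lambda>k. al M [] as [] x y (\<phi> (om V as) x y (k \<odot> cou V (om V as))))"
        by (simp add: \<psi>_def fun_eq_iff)
      then show ?thesis using psi that by simp
    qed
  qed (use phi_natural in \<open>simp_all add: \<psi>_def\<close>)
  interpret I: dmodule_iso V "Phi_ob V R.E" M \<psi>
    by (rule dmodule_iso_Phi_E) (rule R.represented_axioms)
  interpret E: enriched V R.E using R.enriched_category_E by blast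
  show ?thesis
    using R.enriched_category_E I.oplax_functor_iso_fun
      I.invertible_iso_fun[OF E.right_representable_Phi_ob assms(2)] by blast
qed

theorem two_equivalence_Phi:
  "two_equivalence (Cat_enr V :: (('p, 'q, 'a, 'b) ecat, ('p, 'q, 'b) efun,
      (('p, 'q, 'b) efun, 'p, 'q) cell) two_cat) (Rep_delta_mod V) (Phi V)"
proof -
  interpret F: two_functor "Cat_enr V :: (('p, 'q, 'a, 'b) ecat, ('p, 'q, 'b) efun,
      (('p, 'q, 'b) efun, 'p, 'q) cell) two_cat" "Rep_delta_mod V" "Phi V"
    by (rule two_functor_Phi)
  note defs = Phi_def Rep_delta_mod_def Delta_mod_def full_sub_def Cat_enr_def cell_cat_def
  interpret L: two_functor_local_iso "Cat_enr V :: (('p, 'q, 'a, 'b) ecat, ('p, 'q, 'b) efun,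
      (('p, 'q, 'b) efun, 'p, 'q) cell) two_cat" "Rep_delta_mod V" "Phi V"
  proof
    fix A B :: "('p, 'q, 'a, 'b) ecat"
    assume "A \<in> Ob0 (Cat_enr V)" "B \<in> Ob0 (Cat_enr V)"
    then have AB: "enriched_category V A" "enriched_category V B" by (simp_all add: Cat_enr_def)
    let ?X = "{F. enriched_functor V A B F}"
      and ?Y = "{F. oplax_functor V (Phi_ob V A) (Phi_ob V B) F}"
    have inj: "inj_on (Phi_1 V A) ?X"
      using Phi_1_inj[OF AB] by (auto simp: inj_on_def)
    have img: "Phi_1 V A ` ?X = ?Y"
      using Phi_1_surj[OF AB] enriched_fun.oplax_functor_Phi_1[OF enriched_funI[OF AB]] by blast
    from inj img show "bij_betw (P1 (Phi V) A B) (Ob (HomC (Cat_enr V) A B))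
        (Ob (HomC (Rep_delta_mod V) (P0 (Phi V) A) (P0 (Phi V) B)))"
      by (simp add: defs bij_betw_def)
    interpret A: enriched V A using AB by blast
    interpret B: enriched V B using AB by blast
    \<comment> \<open>\<open>Phi_ob\<close> and \<open>Phi_1\<close> change neither the underlying
      categories nor the underlying functors, so naturality means the same on both sides.\<close>
    have nat: "is_natural (Phi_ob V A) (Phi_ob V B) (Phi_1 V A F) (Phi_1 V A G) t
        \<longleftrightarrow> is_natural A B F G t" for F G t
      by (simp add: is_natural_def)
    show "bij_betw (P2 (Phi V) A B) (Ar (HomC (Cat_enr V) A B))
        (Ar (HomC (Rep_delta_mod V) (P0 (Phi V) A) (P0 (Phi V) B)))"
      unfolding bij_betw_def
    proof (intro conjI subset_antisym subsetI)
      \<comment> \<open>A 2-cell is determined by its endpoints and components; components are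
        unchanged, and endpoints are separated by injectivity on 1-cells.\<close>
      show "inj_on (P2 (Phi V) A B) (Ar (HomC (Cat_enr V) A B))"
        using inj by (auto simp: defs inj_on_def intro!: cell.equality)
      fix c
      {
        assume "c \<in> P2 (Phi V) A B ` Ar (HomC (Cat_enr V) A B)"
        then obtain d where "d \<in> Ar (HomC (Cat_enr V) A B)" "c = P2 (Phi V) A B d" by blast
        then show "c \<in> Ar (HomC (Rep_delta_mod V) (P0 (Phi V) A) (P0 (Phi V) B))"
          using F.P2_in(1)[of A B d] AB by (simp add: Cat_enr_def)
      next
        assume c: "c \<in> Ar (HomC (Rep_delta_mod V) (P0 (Phi V) A) (P0 (Phi V) B))"
        then have "Src c \<in> ?Y" "Tgt c \<in> ?Y" by (simp_all add: defs)
        \<comment> \<open>A 2-cell between images is lifted by lifting its endpoints and keeping its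
          components; \<open>delta_nat_Phi_1_iff\<close> makes it an enriched 2-cell.\<close>
        then obtain F G where F: "enriched_functor V A B F" "Src c = Phi_1 V A F"
          and G: "enriched_functor V A B G" "Tgt c = Phi_1 V A G"
          unfolding img[symmetric] by blast
        have t: "is_natural A B F G (At c)" using c F G by (simp add: defs nat)
        then have "enriched_nat V A B F G (At c)"
          using c F G delta_nat_Phi_1_iff[OF AB F(1) G(1) t] by (simp add: defs)
        then have "\<lparr>Src = F, Tgt = G, At = At c\<rparr> \<in> Ar (HomC (Cat_enr V) A B)"
          using c F G t by (simp add: defs)
        moreover have "c = P2 (Phi V) A B \<lparr>Src = F, Tgt = G, At = At c\<rparr>"
          using F G by (simp add: defs)
        ultimately show "c \<in> P2 (Phi V) A B ` Ar (HomC (Cat_enr V) A B)" by blast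
      }
    qed
  qed
  show ?thesis
  proof (rule L.two_equivalenceI)
    fix M :: "('p, 'q, 'a, 'b, 'b) dmod" assume "M \<in> Ob0 (Rep_delta_mod V)"
    then show "\<exists>A \<in> Ob0 (Cat_enr V). \<exists>F \<in> Ob (HomC (Rep_delta_mod V) (P0 (Phi V) A) M).
        invertible1 (Rep_delta_mod V) (P0 (Phi V) A) M F"
      using Phi_essentially_surjective[of M] by (auto simp: defs)
  qed
qed

end

theorem mainTheorem3:
  fixes V :: "('vo, 'va) oplax"
  assumes "normal_oplax_monoidal V"
  shows "two_equivalence
    (Cat_enr V :: (('o, 'a, 'vo, 'va) ecat, ('o, 'a, 'va) efun,
                   (('o, 'a, 'va) efun, 'o, 'a) cell) two_cat)
    (Rep_delta_mod V)
    (Phi V)"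
  using normal_oplax_monoidal.two_equivalence_Phi[OF assms] .

end
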